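(* For every $k\ge1$, $\mathsf{TT}^1_k$ admits strong avoidance of bounded enumeration: for every $D\subseteq\omega$, every $S\subseteq 2^{<\omega}$ that admits no $D$-computable bounded enumeration, and every coloring $C:2^{<\omega}\to k$ (not necessarily $D$-computable), there is an infinite perfect tree $T\subseteq 2^{<\omega}$ on which $C$ is constant such that $D\oplus T$ computes no bounded enumeration of $S$.
   Context: An infinite perfect tree is a subset of $2^{<\omega}$ which, ordered by the initial-segment relation, is isomorphic to $2^{<\omega}$. For $S\subseteq 2^{<\omega}$ and $l\in\omega$, an $l$-enumeration of $S$ is a function $g:\omega\to$ (finite subsets of $2^{<\omega}$) with $|g(n)|\le l$ and $g(n)\cap S\cap 2^n\ne\emptyset$ for all $n$; a bounded enumeration of $S$ is an $l$-enumeration for some $l$. *)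

theory Defs
  imports Main "HOL-Library.Nat_Bijection" "HOL-Library.Sublist"
begin

text \<open>
  Relative computability. Partial functions on \<open>nat\<close> that are partial recursive in an oracle
  are generated by the codes below; functions of several arguments are handled through the
  Cantor pairing \<^const>\<open>prod_encode\<close>. The relation \<open>eval A c x y\<close> says that the function with code
  \<open>c\<close>, relative to the oracle \<open>A\<close>, is defined at \<open>x\<close> with value \<open>y\<close>.
\<close>

datatype code =
    Zero | Succ | Fst | Snd | Oracle
  | Pair code code | Comp code code | Prec code code | Mu code

inductive eval :: "nat set \<Rightarrow> code \<Rightarrow> nat \<Rightarrow> nat \<Rightarrow> bool" for A :: "nat set" where
  Zero: "eval A Zero x 0"
| Succ: "eval A Succ x (Suc x)"
| Fst: "eval A Fst x (fst (prod_decode x))"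
| Snd: "eval A Snd x (snd (prod_decode x))"
| Oracle: "eval A Oracle x (if x \<in> A then 1 else 0)"
| Pair: "eval A f x y \<Longrightarrow> eval A g x z \<Longrightarrow> eval A (Pair f g) x (prod_encode (y, z))"
| Comp: "eval A g x y \<Longrightarrow> eval A f y z \<Longrightarrow> eval A (Comp f g) x z"
| Prec_0: "eval A f x y \<Longrightarrow> eval A (Prec f g) (prod_encode (x, 0)) y"
| Prec_Suc: "eval A (Prec f g) (prod_encode (x, n)) y \<Longrightarrow>
    eval A g (prod_encode (x, prod_encode (n, y))) z \<Longrightarrow>
    eval A (Prec f g) (prod_encode (x, Suc n)) z"
| Mu: "eval A f (prod_encode (x, n)) 0 \<Longrightarrow>
    \<forall>m<n. \<exists>v. eval A f (prod_encode (x, m)) (Suc v) \<Longrightarrow>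
    eval A (Mu f) x n"

lemma eval_deterministic: "eval A c x y \<Longrightarrow> eval A c x z \<Longrightarrow> y = z"
proof (induction arbitrary: z rule: eval.induct)
  case (Mu f x n)
  from Mu.prems obtain "eval A f (prod_encode (x, z)) 0"
    and "\<forall>m<z. \<exists>v. eval A f (prod_encode (x, m)) (Suc v)"
    by (auto elim: eval.cases)
  with Mu.IH show ?case
    by (metis linorder_neqE_nat nat.distinct(1))
next
  case (Pair f x y g z')
  from Pair.prems show ?case
    by (cases rule: eval.cases) (auto dest: Pair.IH)
next
  case (Comp g x y f z')
  from Comp.prems show ?case
    by (cases rule: eval.cases) (auto dest: Comp.IH)
next
  case (Prec_0 f x y g)
  from Prec_0.prems show ?case
    by (cases rule: eval.cases) (auto dest: Prec_0.IH)
next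
  case (Prec_Suc f g x n y z')
  from Prec_Suc.prems show ?case
    by (cases rule: eval.cases) (auto dest: Prec_Suc.IH)
qed (auto elim: eval.cases)

definition computable_in :: "nat set \<Rightarrow> (nat \<Rightarrow> nat) \<Rightarrow> bool" where
  "computable_in A f \<longleftrightarrow> (\<exists>c. \<forall>n. eval A c n (f n))"

definition join :: "nat set \<Rightarrow> nat set \<Rightarrow> nat set"  (infixl \<open>\<oplus>\<^sub>T\<close> 65) where
  "A \<oplus>\<^sub>T B = {2 * n |n. n \<in> A} \<union> {2 * n + 1 |n. n \<in> B}"

text \<open>
  Binary strings, the elements of $2^{<\omega}$, are boolean lists. The code of a string is its
  position in the length-lexicographic enumeration of all strings.
\<close>

definition str_encode :: "bool list \<Rightarrow> nat" where
  "str_encode s = foldl (\<lambda>m b. 2 * m + (if b then 2 else 1)) 0 s"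

lemma str_encode_Nil: "str_encode [] = 0"
  and str_encode_snoc: "str_encode (s @ [b]) = 2 * str_encode s + (if b then 2 else 1)"
  by (simp_all add: str_encode_def)

lemma bij_str_encode: "bij str_encode"
proof (rule bijI)
  have "str_encode s = str_encode t \<Longrightarrow> s = t" for s t
  proof (induction s arbitrary: t rule: rev_induct)
    case Nil
    then show ?case
      by (cases t rule: rev_cases) (auto simp: str_encode_Nil str_encode_snoc split: if_splits)
  next
    case (snoc b s)
    then show ?case
    proof (cases t rule: rev_cases)
      case Nil
      with snoc.prems show ?thesis
        by (simp add: str_encode_Nil str_encode_snoc split: if_splits)
    next
      case (snoc u d)
      with snoc.prems have "str_encode s = str_encode u \<and> b = d"
        by (cases b; cases d; simp add: str_encode_snoc; presburger)
      with snoc.IH snoc show ?thesis by simp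
    qed
  qed
  then show "inj str_encode" by (rule injI)
  have "\<exists>s. n = str_encode s" for n
  proof (induction n rule: less_induct)
    case (less n)
    show ?case
    proof (cases "n = 0")
      case True
      then show ?thesis by (metis str_encode_Nil)
    next
      case False
      then have "(n - 1) div 2 < n" by linarith
      then obtain s where "(n - 1) div 2 = str_encode s" using less.IH by blast
      with False have "n = str_encode (s @ [even n])"
        unfolding str_encode_snoc by presburger
      then show ?thesis ..
    qed
  qed
  then show "surj str_encode" unfolding surj_def by blast
qed

text \<open>Meaningful for finite \<open>F\<close> only: \<^const>\<open>set_encode\<close> gives the canonical index of a finite set.\<close>

definition fin_encode :: "bool list set \<Rightarrow> nat" where
  "fin_encode F = set_encode (str_encode ` F)"

definition enumeration :: "nat \<Rightarrow> bool list set \<Rightarrow> (nat \<Rightarrow> bool list set) \<Rightarrow> bool" where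
  "enumeration l S g \<longleftrightarrow>
    (\<forall>n. finite (g n) \<and> card (g n) \<le> l \<and> g n \<inter> S \<inter> {s. length s = n} \<noteq> {})"

definition bounded_enumeration :: "bool list set \<Rightarrow> (nat \<Rightarrow> bool list set) \<Rightarrow> bool" where
  "bounded_enumeration S g \<longleftrightarrow> (\<exists>l. enumeration l S g)"

definition computes_bounded_enumeration :: "nat set \<Rightarrow> bool list set \<Rightarrow> bool" where
  "computes_bounded_enumeration A S \<longleftrightarrow>
    (\<exists>g. bounded_enumeration S g \<and> computable_in A (\<lambda>n. fin_encode (g n)))"

definition infinite_perfect_tree :: "bool list set \<Rightarrow> bool" where
  "infinite_perfect_tree T \<longleftrightarrow>
    (\<exists>h. bij_betw h (UNIV :: bool list set) T \<and> (\<forall>s t. prefix s t \<longleftrightarrow> prefix (h s) (h t)))"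

end

theory Submission imports Defs "HOL-Library.Countable" begin

text \<open>
  The pool from which the homogeneous tree is built is not controlled by its computational power.
  Instead, colour choices are organized by a largeness notion.

  A point is a pair \<open>(\<rho>, x)\<close> with \<open>\<rho>\<close> a prefix of \<open>x\<close>. Given a finite colouring \<open>Y\<close> of the
  strings, a selection \<open>z\<close> picks one colour \<open>z \<rho>\<close> for the cone above each \<open>\<rho>\<close> and thereby the points
  with \<open>Y x = z \<rho>\<close>. A family of finitary properties (``some finite set of strings of a given kind
  can be found above the roots in \<open>\<Lambda>\<close>'') is abundant if for each finite colouring one selection
  realizes any finitely many of its members. Let \<open>M\<^sub>0\<close> be a maximal abundant family of properties
  that are semidecidable in \<open>D\<close> and that is closed under moving roots upwards.

  For a finite tree \<open>F\<close> with open slots \<open>\<Lambda>\<close> consider a functional that should not become an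
  \<open>l\<close>-enumeration of \<open>S\<close>. If for some \<open>n\<close> the property ``an extension of \<open>F\<close> outputs at most \<open>l\<close>
  strings at \<open>n\<close>'' is not in \<open>M\<^sub>0\<close>, then by maximality a colouring excludes it, and thinning out the
  pool forces the functional to fail at \<open>n\<close>. If all these properties are in \<open>M\<^sub>0\<close>, then \<open>M\<^sub>0\<close>
  remains abundant when one adds ``for some \<open>n\<close> an extension outputs a set that misses
  \<open>S \<inter> 2\<^sup>n\<close>'', and hence such an extension exists in every pool. Indeed, otherwise a colouring with
  \<open>b\<close> colours prevents this. By compactness it is semidecidable whether \<open>b\<close> colours do not suffice to
  prevent missing a set \<open>V \<subseteq> 2\<^sup>n\<close>, and \<open>S \<inter> 2\<^sup>n\<close> is never found to be such a \<open>V\<close>. If for every \<open>n\<close>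
  some \<open>w\<close> of bounded size met all \<open>V\<close> that are never found, then searching for \<open>w\<close> would give a
  \<open>D\<close>-computable bounded enumeration of \<open>S\<close>. So for some \<open>n\<close> there is no such \<open>w\<close>. But a selection for
  a common refinement of the colourings that prevent missing these \<open>V\<close> comes with outputs of
  bounded size, whose union then misses one of the \<open>V\<close>, a contradiction.
\<close>

subsection \<open>Relative computability\<close>

abbreviation pfst :: "nat \<Rightarrow> nat" where "pfst z \<equiv> fst (prod_decode z)"
abbreviation psnd :: "nat \<Rightarrow> nat" where "psnd z \<equiv> snd (prod_decode z)"

lemma computable_inI: "(\<And>n. eval A c n (f n)) \<Longrightarrow> computable_in A f"
  by (auto simp: computable_in_def)

lemma computable_id: "computable_in A (\<lambda>x. x)"
proof (rule computable_inI)
  fix n show "eval A (Pair Fst Snd) n n"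
    using eval.Pair[OF eval.Fst eval.Snd, of A n] by simp
qed

lemma computable_const: "computable_in A (\<lambda>x. c)"
proof (induction c)
  case 0
  show ?case by (rule computable_inI) (rule eval.Zero)
next
  case (Suc c)
  then obtain d where "\<And>n. eval A d n c" by (auto simp: computable_in_def)
  then show ?case by (intro computable_inI) (rule eval.Comp[OF _ eval.Succ])
qed

lemma computable_compose:
  assumes "computable_in A f" "computable_in A g"
  shows "computable_in A (\<lambda>x. f (g x))"
proof -
  obtain c d where "\<And>n. eval A c n (f n)" "\<And>n. eval A d n (g n)"
    using assms by (auto simp: computable_in_def)
  then show ?thesis by (intro computable_inI) (rule eval.Comp)
qed

lemma computable_Suc: "computable_in A f \<Longrightarrow> computable_in A (\<lambda>x. Suc (f x))"
  by (rule computable_compose[of A Suc]) (auto intro: computable_inI eval.Succ)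

lemma computable_fst: "computable_in A f \<Longrightarrow> computable_in A (\<lambda>x. pfst (f x))"
  by (rule computable_compose[of A pfst]) (auto intro: computable_inI eval.Fst)

lemma computable_snd: "computable_in A f \<Longrightarrow> computable_in A (\<lambda>x. psnd (f x))"
  by (rule computable_compose[of A psnd]) (auto intro: computable_inI eval.Snd)

lemma computable_pair:
  assumes "computable_in A f" "computable_in A g"
  shows "computable_in A (\<lambda>x. prod_encode (f x, g x))"
proof -
  obtain c d where "\<And>n. eval A c n (f n)" "\<And>n. eval A d n (g n)"
    using assms by (auto simp: computable_in_def)
  then show ?thesis by (intro computable_inI) (rule eval.Pair)
qed

lemma computable_rec:
  assumes "computable_in A f" "computable_in A h"
    and "computable_in A (\<lambda>z. g (pfst z) (pfst (psnd z)) (psnd (psnd z)))"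
  shows "computable_in A (\<lambda>x. rec_nat (f x) (g x) (h x))"
proof -
  obtain c d where c: "\<And>n. eval A c n (f n)"
    and d: "\<And>z. eval A d z (g (pfst z) (pfst (psnd z)) (psnd (psnd z)))"
    using assms by (auto simp: computable_in_def)
  have "eval A (Prec c d) (prod_encode (x, n)) (rec_nat (f x) (g x) n)" for x n
  proof (induction n)
    case 0
    show ?case using eval.Prec_0[OF c] by simp
  next
    case (Suc n)
    from eval.Prec_Suc[OF this d] show ?case by simp
  qed
  then have "computable_in A (\<lambda>z. rec_nat (f (pfst z)) (g (pfst z)) (psnd z))"
    using computable_inI[of A "Prec c d" "\<lambda>z. rec_nat (f (pfst z)) (g (pfst z)) (psnd z)"]
    by (metis prod.collapse prod_decode_inverse)
  from computable_compose[OF this computable_pair[OF computable_id assms(2)]] show ?thesis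
    by simp
qed

lemmas computable_basic = computable_const computable_id computable_Suc computable_fst
  computable_snd computable_pair

lemma computable_add:
  assumes "computable_in A f" "computable_in A g" shows "computable_in A (\<lambda>x. f x + g x)"
proof -
  have rec: "rec_nat m (\<lambda>_ y. Suc y) n = m + n" for m n by (induction n) auto
  have "computable_in A (\<lambda>z. Suc (psnd (psnd z)))" by (intro computable_basic)
  from computable_rec[OF assms this] show ?thesis by (simp only: rec)
qed

lemma computable_mult:
  assumes "computable_in A f" "computable_in A g" shows "computable_in A (\<lambda>x. f x * g x)"
proof -
  have rec: "rec_nat 0 (\<lambda>_ y. y + m) n = m * n" for m n by (induction n) auto
  have "computable_in A (\<lambda>z. psnd (psnd z) + f (pfst z))"
    by (intro computable_add computable_basic computable_compose[OF assms(1)])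
  from computable_rec[where g = "\<lambda>x _ y. y + f x", OF computable_const[of A 0] assms(2) this]
  show ?thesis by (simp only: rec)
qed

lemma computable_power:
  assumes "computable_in A f" "computable_in A g" shows "computable_in A (\<lambda>x. f x ^ g x)"
proof -
  have rec: "rec_nat (Suc 0) (\<lambda>_ y. y * m) n = m ^ n" for m n :: nat by (induction n) auto
  have "computable_in A (\<lambda>z. psnd (psnd z) * f (pfst z))"
    by (intro computable_mult computable_basic computable_compose[OF assms(1)])
  from computable_rec[where g = "\<lambda>x _ y. y * f x", OF computable_const[of A "Suc 0"] assms(2) this]
  show ?thesis by (simp only: rec)
qed

lemma computable_diff:
  assumes "computable_in A f" "computable_in A g" shows "computable_in A (\<lambda>x. f x - g x)"
proof -
  have pred: "computable_in A (\<lambda>x. h x - Suc 0)" if "computable_in A h" for h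
  proof -
    have rec: "rec_nat 0 (\<lambda>n _. n) m = m - Suc 0" for m by (cases m) auto
    have "computable_in A (\<lambda>z. pfst (psnd z))" by (intro computable_basic)
    from computable_rec[where g = "\<lambda>_ n _. n", OF computable_const[of A 0] that this]
    show ?thesis by (simp only: rec)
  qed
  have rec: "rec_nat m (\<lambda>_ y. y - Suc 0) n = m - n" for m n by (induction n) auto
  have "computable_in A (\<lambda>z. psnd (psnd z) - Suc 0)" by (intro pred computable_basic)
  from computable_rec[OF assms this] show ?thesis by (simp only: rec)
qed

lemmas computable_intros = computable_basic computable_add computable_mult computable_power
  computable_diff

section \<open>Decidable predicates and bounded quantification\<close>

definition decidable_in :: "nat set \<Rightarrow> (nat \<Rightarrow> bool) \<Rightarrow> bool" where
  "decidable_in A P \<longleftrightarrow> computable_in A (\<lambda>x. if P x then 1 else 0)"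

lemma decidable_compose:
  "decidable_in A P \<Longrightarrow> computable_in A f \<Longrightarrow> decidable_in A (\<lambda>x. P (f x))"
  unfolding decidable_in_def by (rule computable_compose)

lemma decidable_eq_0:
  assumes "computable_in A f" shows "decidable_in A (\<lambda>x. f x = 0)"
proof -
  have "(\<lambda>x. if f x = 0 then 1 else 0) = (\<lambda>x. 1 - f x)" by auto
  moreover have "computable_in A (\<lambda>x. 1 - f x)"
    by (intro computable_diff computable_const assms)
  ultimately show ?thesis unfolding decidable_in_def by presburger
qed

lemma decidable_not:
  assumes "decidable_in A P" shows "decidable_in A (\<lambda>x. \<not> P x)"
proof -
  have "decidable_in A (\<lambda>x. (if P x then 1 else 0::nat) = 0)"
    by (rule decidable_eq_0) (use assms in \<open>simp add: decidable_in_def\<close>)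
  moreover have "(\<lambda>x. (if P x then 1 else 0::nat) = 0) = (\<lambda>x. \<not> P x)" by auto
  ultimately show ?thesis by simp
qed

lemma decidable_conj:
  assumes "decidable_in A P" "decidable_in A Q" shows "decidable_in A (\<lambda>x. P x \<and> Q x)"
proof -
  have "(\<lambda>x. if P x \<and> Q x then 1 else 0::nat) = (\<lambda>x. (if P x then 1 else 0) * (if Q x then 1 else 0))"
    by auto
  moreover have "computable_in A (\<lambda>x. (if P x then 1 else 0) * (if Q x then 1 else 0))"
    by (intro computable_mult assms[unfolded decidable_in_def])
  ultimately show ?thesis unfolding decidable_in_def by presburger
qed

lemma decidable_disj:
  assumes "decidable_in A P" "decidable_in A Q" shows "decidable_in A (\<lambda>x. P x \<or> Q x)"
  using decidable_not[OF decidable_conj[OF decidable_not[OF assms(1)] decidable_not[OF assms(2)]]]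
  by simp

lemma decidable_imp:
  assumes "decidable_in A P" "decidable_in A Q" shows "decidable_in A (\<lambda>x. P x \<longrightarrow> Q x)"
  using decidable_disj[OF decidable_not[OF assms(1)] assms(2)] by simp

lemma decidable_le:
  assumes "computable_in A f" "computable_in A g" shows "decidable_in A (\<lambda>x. f x \<le> g x)"
  using decidable_eq_0[OF computable_diff[OF assms]] by simp

lemma decidable_less:
  assumes "computable_in A f" "computable_in A g" shows "decidable_in A (\<lambda>x. f x < g x)"
  using decidable_le[OF computable_Suc[OF assms(1)] assms(2)] by (simp add: Suc_le_eq)

lemma decidable_eq:
  assumes "computable_in A f" "computable_in A g" shows "decidable_in A (\<lambda>x. f x = g x)"
proof -
  have "(\<lambda>x. f x = g x) = (\<lambda>x. f x \<le> g x \<and> g x \<le> f x)" by auto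
  with decidable_conj[OF decidable_le[OF assms] decidable_le[OF assms(2,1)]]
  show ?thesis by presburger
qed

lemma decidable_const: "decidable_in A (\<lambda>x. P)"
  unfolding decidable_in_def by (rule computable_const)

lemma decidable_bex:
  assumes "computable_in A f" "decidable_in A (\<lambda>z. P (pfst z) (psnd z))"
  shows "decidable_in A (\<lambda>x. \<exists>y<f x. P x y)"
proof -
  let ?b = "\<lambda>Q. if Q then 1 else 0::nat"
  \<comment> \<open>On the values 0 and 1 the expression \<open>a + b - a * b\<close> is
    disjunction, so bounded search becomes a primitive recursion.\<close>
  have rec: "rec_nat 0 (\<lambda>n a. a + ?b (P x n) - a * ?b (P x n)) m = ?b (\<exists>y<m. P x y)" for x m
    by (induction m) (auto simp: less_Suc_eq)
  have "computable_in A (\<lambda>z. prod_encode (pfst z, pfst (psnd z)))"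
    by (intro computable_basic)
  from computable_compose[OF assms(2)[unfolded decidable_in_def] this]
  have "computable_in A (\<lambda>z. ?b (P (pfst z) (pfst (psnd z))))"
    by (simp only: prod_encode_inverse fst_conv snd_conv)
  then have "computable_in A (\<lambda>z. psnd (psnd z) + ?b (P (pfst z) (pfst (psnd z)))
      - psnd (psnd z) * ?b (P (pfst z) (pfst (psnd z))))"
    by (intro computable_intros)
  from computable_rec[OF computable_const assms(1),
      of "\<lambda>x n a. a + ?b (P x n) - a * ?b (P x n)" 0, OF this]
  show ?thesis unfolding decidable_in_def rec .
qed

lemma decidable_ball:
  assumes "computable_in A f" "decidable_in A (\<lambda>z. P (pfst z) (psnd z))"
  shows "decidable_in A (\<lambda>x. \<forall>y<f x. P x y)"
  using decidable_not[OF decidable_bex[OF assms(1) decidable_not[OF assms(2)]]] by simp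

lemma decidable_oracle: "computable_in A f \<Longrightarrow> decidable_in A (\<lambda>x. f x \<in> A)"
  by (rule decidable_compose[of A "\<lambda>x. x \<in> A"])
    (simp add: decidable_in_def computable_inI[OF eval.Oracle])

lemmas decidable_intros = decidable_const decidable_not decidable_conj decidable_disj decidable_imp
  decidable_le decidable_less decidable_eq decidable_bex decidable_ball

section \<open>Semidecidable predicates and unbounded search\<close>

definition semidecidable_in :: "nat set \<Rightarrow> (nat \<Rightarrow> bool) \<Rightarrow> bool" where
  "semidecidable_in A P \<longleftrightarrow>
    (\<exists>Q. decidable_in A (\<lambda>z. Q (pfst z) (psnd z)) \<and> (\<forall>x. P x \<longleftrightarrow> (\<exists>y. Q x y)))"

lemma semidecidableI:
  "decidable_in A (\<lambda>z. Q (pfst z) (psnd z)) \<Longrightarrow> (\<And>x. P x \<longleftrightarrow> (\<exists>y. Q x y)) \<Longrightarrow> semidecidable_in A P"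
  by (auto simp: semidecidable_in_def)

lemma semidecidableE:
  assumes "semidecidable_in A P"
  obtains Q where "\<And>f g. computable_in A f \<Longrightarrow> computable_in A g \<Longrightarrow> decidable_in A (\<lambda>x. Q (f x) (g x))"
    "\<And>x. P x \<longleftrightarrow> (\<exists>y. Q x y)"
proof -
  obtain Q where Q: "decidable_in A (\<lambda>z. Q (pfst z) (psnd z))" "\<And>x. P x \<longleftrightarrow> (\<exists>y. Q x y)"
    using assms by (auto simp: semidecidable_in_def)
  have "decidable_in A (\<lambda>x. Q (f x) (g x))" if "computable_in A f" "computable_in A g" for f g
    using decidable_compose[OF Q(1) computable_pair[OF that]] by simp
  with Q(2) show ?thesis using that by blast
qed

lemma semidecidable_decidable: "decidable_in A P \<Longrightarrow> semidecidable_in A P"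
  by (rule semidecidableI[where Q = "\<lambda>x _. P x"])
    (rule decidable_compose[of A P], simp, intro computable_basic, simp)

lemma semidecidable_compose:
  assumes "semidecidable_in A P" "computable_in A f"
  shows "semidecidable_in A (\<lambda>x. P (f x))"
proof -
  obtain Q where Q: "\<And>f g. computable_in A f \<Longrightarrow> computable_in A g \<Longrightarrow> decidable_in A (\<lambda>x. Q (f x) (g x))"
    "\<And>x. P x \<longleftrightarrow> (\<exists>y. Q x y)"
    using semidecidableE[OF assms(1)] by blast
  show ?thesis
    by (rule semidecidableI[where Q = "\<lambda>x. Q (f x)"])
      (auto simp: Q(2) intro!: Q(1) computable_compose[OF assms(2)] computable_intros)
qed

lemma semidecidable_ex:
  assumes "semidecidable_in A (\<lambda>z. P (pfst z) (psnd z))"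
  shows "semidecidable_in A (\<lambda>x. \<exists>y. P x y)"
proof -
  obtain Q where Q: "\<And>f g. computable_in A f \<Longrightarrow> computable_in A g \<Longrightarrow> decidable_in A (\<lambda>x. Q (f x) (g x))"
    "\<And>z. P (pfst z) (psnd z) \<longleftrightarrow> (\<exists>y. Q z y)"
    using semidecidableE[OF assms] by blast
  have "P x y \<longleftrightarrow> (\<exists>w. Q (prod_encode (x, y)) w)" for x y
    using Q(2)[of "prod_encode (x, y)"] by simp
  then have "(\<exists>y. P x y) \<longleftrightarrow> (\<exists>w. Q (prod_encode (x, pfst w)) (psnd w))" for x
    by (metis fst_conv prod_encode_inverse snd_conv)
  moreover have "decidable_in A (\<lambda>z. Q (prod_encode (pfst z, pfst (psnd z))) (psnd (psnd z)))"
    by (intro Q(1) computable_intros)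
  ultimately show ?thesis
    by (intro semidecidableI[where Q = "\<lambda>x w. Q (prod_encode (x, pfst w)) (psnd w)"])
qed

lemma semidecidable_conj:
  assumes "semidecidable_in A P" "semidecidable_in A P'"
  shows "semidecidable_in A (\<lambda>x. P x \<and> P' x)"
proof -
  obtain Q where Q: "\<And>f g. computable_in A f \<Longrightarrow> computable_in A g \<Longrightarrow> decidable_in A (\<lambda>x. Q (f x) (g x))"
    "\<And>x. P x \<longleftrightarrow> (\<exists>y. Q x y)"
    using semidecidableE[OF assms(1)] by blast
  obtain Q' where Q': "\<And>f g. computable_in A f \<Longrightarrow> computable_in A g \<Longrightarrow> decidable_in A (\<lambda>x. Q' (f x) (g x))"
    "\<And>x. P' x \<longleftrightarrow> (\<exists>y. Q' x y)"
    using semidecidableE[OF assms(2)] by blast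
  have "semidecidable_in A (\<lambda>x. \<exists>y. \<exists>y'. Q x y \<and> Q' x y')"
    by (intro semidecidable_ex semidecidable_decidable decidable_intros Q(1) Q'(1) computable_intros)
  then show ?thesis by (simp add: Q(2) Q'(2))
qed

lemma semidecidable_disj:
  assumes "semidecidable_in A P" "semidecidable_in A P'"
  shows "semidecidable_in A (\<lambda>x. P x \<or> P' x)"
proof -
  obtain Q where Q: "\<And>f g. computable_in A f \<Longrightarrow> computable_in A g \<Longrightarrow> decidable_in A (\<lambda>x. Q (f x) (g x))"
    "\<And>x. P x \<longleftrightarrow> (\<exists>y. Q x y)"
    using semidecidableE[OF assms(1)] by blast
  obtain Q' where Q': "\<And>f g. computable_in A f \<Longrightarrow> computable_in A g \<Longrightarrow> decidable_in A (\<lambda>x. Q' (f x) (g x))"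
    "\<And>x. P' x \<longleftrightarrow> (\<exists>y. Q' x y)"
    using semidecidableE[OF assms(2)] by blast
  have "semidecidable_in A (\<lambda>x. \<exists>y. Q x y \<or> Q' x y)"
    by (intro semidecidable_ex semidecidable_decidable decidable_intros Q(1) Q'(1) computable_intros)
  then show ?thesis by (simp add: Q(2) Q'(2) ex_disj_distrib)
qed

text \<open>A number is read as an infinite stream of nested pairs: the first component is the head,
  the second codes the tail. No length is stored, and every finite sequence is an initial segment of
  some stream.\<close>

definition seq_nth :: "nat \<Rightarrow> nat \<Rightarrow> nat" where
  "seq_nth a m = pfst (rec_nat a (\<lambda>_. psnd) m)"

lemma computable_seq_nth:
  assumes "computable_in A f" "computable_in A g"
  shows "computable_in A (\<lambda>x. seq_nth (f x) (g x))"
  unfolding seq_nth_def using assms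
  by (intro computable_fst computable_rec[where g = "\<lambda>_ _. psnd"] computable_intros)

lemma seq_nth_exists: "\<exists>a. \<forall>m<n. seq_nth a m = f m"
proof (induction n arbitrary: f)
  case 0
  show ?case by simp
next
  case (Suc n)
  from Suc[of "\<lambda>m. f (Suc m)"] obtain a where a: "\<And>m. m < n \<Longrightarrow> seq_nth a m = f (Suc m)" by blast
  have "rec_nat (prod_encode (f 0, a)) (\<lambda>_. psnd) (Suc m) = rec_nat a (\<lambda>_. psnd) m" for m
    by (induction m) auto
  then have "seq_nth (prod_encode (f 0, a)) (Suc m) = seq_nth a m" for m
    by (simp add: seq_nth_def)
  then have "seq_nth (prod_encode (f 0, a)) m = f m" if "m < Suc n" for m
    using that a by (cases m) (simp_all add: seq_nth_def)
  then show ?case by blast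
qed

text \<open>Witnesses for the finitely many \<open>y\<close> are gathered in one stream code, which
  moves the unbounded existential quantifier in front of the bounded universal one.\<close>

lemma semidecidable_ball:
  assumes "computable_in A f" "semidecidable_in A (\<lambda>z. P (pfst z) (psnd z))"
  shows "semidecidable_in A (\<lambda>x. \<forall>y<f x. P x y)"
proof -
  obtain Q where Q: "\<And>f g. computable_in A f \<Longrightarrow> computable_in A g \<Longrightarrow> decidable_in A (\<lambda>x. Q (f x) (g x))"
    "\<And>z. P (pfst z) (psnd z) \<longleftrightarrow> (\<exists>y. Q z y)"
    using semidecidableE[OF assms(2)] by blast
  have P: "P x y \<longleftrightarrow> (\<exists>w. Q (prod_encode (x, y)) w)" for x y
    using Q(2)[of "prod_encode (x, y)"] by simp
  have "(\<forall>y<f x. P x y) \<longleftrightarrow> (\<exists>a. \<forall>y<f x. Q (prod_encode (x, y)) (seq_nth a y))" for x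
  proof
    assume "\<forall>y<f x. P x y"
    then obtain w where w: "\<And>y. y < f x \<Longrightarrow> Q (prod_encode (x, y)) (w y)" unfolding P by metis
    obtain a where "\<forall>y<f x. seq_nth a y = w y" using seq_nth_exists by blast
    with w show "\<exists>a. \<forall>y<f x. Q (prod_encode (x, y)) (seq_nth a y)" by metis
  qed (auto simp: P)
  moreover have "semidecidable_in A (\<lambda>x. \<exists>a. \<forall>y<f x. Q (prod_encode (x, y)) (seq_nth a y))"
    by (intro semidecidable_ex semidecidable_decidable decidable_intros Q(1) computable_intros
        computable_seq_nth computable_compose[OF assms(1)])
  ultimately show ?thesis by simp
qed

lemma semidecidable_finite_ball:
  assumes "finite I" "\<And>i. i \<in> I \<Longrightarrow> semidecidable_in A (P i)"
  shows "semidecidable_in A (\<lambda>x. \<forall>i\<in>I. P i x)"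
  using assms
proof (induction I)
  case empty
  show ?case by (simp add: semidecidable_decidable decidable_const)
next
  case (insert i I)
  then show ?case by (simp add: semidecidable_conj)
qed

text \<open>The search runs over pairs of a value and a witness for that value; \<open>f\<close> is
  the first component of the least such pair.\<close>

lemma semidecidable_uniformize:
  assumes "semidecidable_in A (\<lambda>z. P (pfst z) (psnd z))" and "\<And>x. \<exists>y. P x y"
  obtains f where "computable_in A f" "\<And>x. P x (f x)"
proof -
  obtain Q where Q: "\<And>f g. computable_in A f \<Longrightarrow> computable_in A g \<Longrightarrow> decidable_in A (\<lambda>x. Q (f x) (g x))"
    "\<And>z. P (pfst z) (psnd z) \<longleftrightarrow> (\<exists>y. Q z y)"
    using semidecidableE[OF assms(1)] by blast
  define R where "R x w \<longleftrightarrow> Q (prod_encode (x, pfst w)) (psnd w)" for x w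
  have P: "P x y \<longleftrightarrow> (\<exists>w. Q (prod_encode (x, y)) w)" for x y
    using Q(2)[of "prod_encode (x, y)"] by simp
  have ex: "\<exists>w. R x w" for x
    using assms(2)[of x] unfolding R_def P by (metis fst_conv prod_encode_inverse snd_conv)
  \<comment> \<open>\<open>Mu\<close> stops at the value 0, so the code has to decide the negation
    of \<open>R\<close>.\<close>
  have "decidable_in A (\<lambda>z. \<not> R (pfst z) (psnd z))"
    unfolding R_def by (intro decidable_intros Q(1) computable_intros)
  then obtain c where c: "\<And>z. eval A c z (if \<not> R (pfst z) (psnd z) then 1 else 0)"
    unfolding decidable_in_def computable_in_def by blast
  define f where "f x = (LEAST w. R x w)" for x
  have "eval A (Mu c) x (f x)" for x
  proof (rule eval.Mu)
    show "eval A c (prod_encode (x, f x)) 0"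
      using c[of "prod_encode (x, f x)"] LeastI_ex[OF ex, of x] by (simp add: f_def)
    show "\<forall>m<f x. \<exists>v. eval A c (prod_encode (x, m)) (Suc v)"
    proof (intro allI impI)
      fix m assume "m < f x"
      then have "\<not> R x m" unfolding f_def by (rule not_less_Least)
      then show "\<exists>v. eval A c (prod_encode (x, m)) (Suc v)"
        using c[of "prod_encode (x, m)"] by auto
    qed
  qed
  then have "computable_in A (\<lambda>x. pfst (f x))" by (intro computable_fst computable_inI)
  moreover have "P x (pfst (f x))" for x
    using LeastI_ex[OF ex, of x] unfolding P R_def f_def by blast
  ultimately show ?thesis using that by blast
qed

section \<open>Semidecidability of evaluation and the use principle\<close>

lemma eval_Pair_iff: "eval A (Pair f g) x v \<longleftrightarrow>
    (\<exists>y z. v = prod_encode (y, z) \<and> eval A f x y \<and> eval A g x z)"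
  by (rule iffI, cases rule: eval.cases) (blast intro: eval.Pair)+

lemma eval_Comp_iff: "eval A (Comp f g) x z \<longleftrightarrow> (\<exists>y. eval A g x y \<and> eval A f y z)"
  by (rule iffI, cases rule: eval.cases) (blast intro: eval.Comp)+

lemma eval_Mu_iff: "eval A (Mu f) x n \<longleftrightarrow> eval A f (prod_encode (x, n)) 0 \<and>
    (\<forall>m<n. \<exists>v. eval A f (prod_encode (x, m)) (Suc v))"
  by (rule iffI, cases rule: eval.cases) (blast intro: eval.Mu)+

text \<open>One existential quantifier over the coded trace of values replaces the recursion. The
  conditions on the trace involve only \<open>f\<close> and \<open>g\<close>, so an induction on
  codes can use it.\<close>

lemma eval_Prec_iff: "eval A (Prec f g) z v \<longleftrightarrow>
    (\<exists>a. eval A f (pfst z) (seq_nth a 0) \<and> v = seq_nth a (psnd z) \<and>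
      (\<forall>n<psnd z. eval A g (prod_encode (pfst z, prod_encode (n, seq_nth a n))) (seq_nth a (Suc n))))"
    (is "?L z v \<longleftrightarrow> ?R z v")
proof
  have "\<exists>y. eval A f x (y 0) \<and> v = y n \<and>
      (\<forall>m<n. eval A g (prod_encode (x, prod_encode (m, y m))) (y (Suc m)))"
    if "eval A (Prec f g) (prod_encode (x, n)) v" for x n
    using that
  proof (induction n arbitrary: v)
    case 0
    then have "eval A f x v" by cases auto
    then show ?case by (intro exI[of _ "\<lambda>_. v"]) simp
  next
    case (Suc n)
    from Suc.prems obtain y where "eval A (Prec f g) (prod_encode (x, n)) y"
      and g: "eval A g (prod_encode (x, prod_encode (n, y))) v" by cases auto
    with Suc.IH obtain h where "eval A f x (h 0)" "y = h n"
      "\<forall>m<n. eval A g (prod_encode (x, prod_encode (m, h m))) (h (Suc m))" by blast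
    with g show ?case
      by (intro exI[of _ "h(Suc n := v)"]) (auto simp: less_Suc_eq)
  qed
  moreover assume "?L z v"
  moreover have "z = prod_encode (pfst z, psnd z)" by simp
  ultimately obtain y where y: "eval A f (pfst z) (y 0)" "v = y (psnd z)"
      "\<forall>m<psnd z. eval A g (prod_encode (pfst z, prod_encode (m, y m))) (y (Suc m))"
    by metis
  obtain a where "\<forall>m<Suc (psnd z). seq_nth a m = y m" using seq_nth_exists by blast
  with y show "?R z v" by (intro exI[of _ a]) auto
next
  assume "?R z v"
  then obtain a where a: "eval A f (pfst z) (seq_nth a 0)" "v = seq_nth a (psnd z)"
      "\<forall>n<psnd z. eval A g (prod_encode (pfst z, prod_encode (n, seq_nth a n))) (seq_nth a (Suc n))"
    by blast
  have "eval A (Prec f g) (prod_encode (pfst z, n)) (seq_nth a n)" if "n \<le> psnd z" for n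
    using that
  proof (induction n)
    case 0
    show ?case by (rule eval.Prec_0) (rule a)
  next
    case (Suc n)
    then show ?case using a(3) by (intro eval.Prec_Suc[of A f g "pfst z" n "seq_nth a n"]) auto
  qed
  from this[of "psnd z"] a(2) show "?L z v" by simp
qed

text \<open>The code is fixed, so no universal machine is needed.\<close>

lemma semidecidable_eval:
  assumes "decidable_in A (\<lambda>z. B (pfst z) (psnd z))" "computable_in A f" "computable_in A g"
  shows "semidecidable_in A (\<lambda>x. eval {m. B x m} c (f x) (g x))"
proof -
  \<comment> \<open>The oracle depends on the input \<open>x\<close>. The quantifiers that come with
    compound codes enlarge the input to a tuple, and \<open>p\<close> extracts the component on
    which the oracle depends.\<close>
  have subst: "decidable_in A (\<lambda>z. B (p (pfst z)) (psnd z))"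
    if "decidable_in A (\<lambda>z. B (pfst z) (psnd z))" "computable_in A p" for B p
  proof -
    have "computable_in A (\<lambda>z. prod_encode (p (pfst z), psnd z))"
      by (intro computable_basic computable_compose[OF that(2)])
    from decidable_compose[OF that(1) this] show ?thesis
      by (simp only: prod_encode_inverse fst_conv snd_conv)
  qed
  show ?thesis using assms
  proof (induction c arbitrary: B f g)
    case Zero
    have "eval {m. B x m} Zero (f x) (g x) \<longleftrightarrow> g x = 0" for x
      by (auto elim: eval.cases intro: eval.Zero)
    with Zero show ?case by (simp only:) (intro semidecidable_decidable decidable_eq_0)
  next
    case Succ
    have "eval {m. B x m} Succ (f x) (g x) \<longleftrightarrow> g x = Suc (f x)" for x
      by (auto elim: eval.cases intro: eval.Succ)
    with Succ show ?case
      by (simp only:) (intro semidecidable_decidable decidable_eq computable_Suc)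
  next
    case Fst
    have "eval {m. B x m} Fst (f x) (g x) \<longleftrightarrow> g x = pfst (f x)" for x
      by (auto elim: eval.cases intro: eval.Fst)
    with Fst show ?case
      by (simp only:) (intro semidecidable_decidable decidable_eq computable_fst)
  next
    case Snd
    have "eval {m. B x m} Snd (f x) (g x) \<longleftrightarrow> g x = psnd (f x)" for x
      by (auto elim: eval.cases intro: eval.Snd)
    with Snd show ?case
      by (simp only:) (intro semidecidable_decidable decidable_eq computable_snd)
  next
    case Oracle
    have "eval {m. B x m} Oracle (f x) (g x) \<longleftrightarrow> B x (f x) \<and> g x = 1 \<or> \<not> B x (f x) \<and> g x = 0" for x
      using eval.Oracle[of "{m. B x m}" "f x"]
      by (cases "B x (f x)") (auto dest: eval_deterministic)
    moreover have "decidable_in A (\<lambda>x. B x (f x))"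
      using decidable_compose[OF Oracle(1) computable_pair[OF computable_id Oracle(2)]] by simp
    ultimately show ?case using Oracle(3)
      by (simp only:)
        (intro semidecidable_decidable decidable_disj decidable_conj decidable_not decidable_eq
          computable_const)
  next
    case (Pair c d)
    show ?case unfolding eval_Pair_iff
      by (intro semidecidable_ex semidecidable_conj semidecidable_decidable decidable_intros
          computable_intros computable_compose[OF Pair.prems(2)] computable_compose[OF Pair.prems(3)]
          Pair.IH subst[OF Pair.prems(1)])
  next
    case (Comp c d)
    show ?case unfolding eval_Comp_iff
      by (intro semidecidable_ex semidecidable_conj Comp.IH subst[OF Comp.prems(1)]
          computable_intros computable_compose[OF Comp.prems(2)] computable_compose[OF Comp.prems(3)])
  next
    case (Prec c d)
    show ?case unfolding eval_Prec_iff
      by (intro semidecidable_ex semidecidable_conj semidecidable_ball Prec.IH subst[OF Prec.prems(1)]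
          computable_intros computable_seq_nth semidecidable_decidable decidable_intros
          computable_compose[OF Prec.prems(2)] computable_compose[OF Prec.prems(3)])
  next
    case (Mu c)
    show ?case unfolding eval_Mu_iff
      by (intro semidecidable_ex semidecidable_conj semidecidable_ball Mu.IH subst[OF Mu.prems(1)]
          computable_intros computable_compose[OF Mu.prems(2)] computable_compose[OF Mu.prems(3)])
  qed
qed

text \<open>A halting computation asks finitely many oracle questions. For \<open>Mu\<close> the
  bound covers the finitely many computations at all \<open>m < n\<close> as well as the one at
  \<open>n\<close>.\<close>

lemma eval_use:
  assumes "eval A c x y"
  shows "\<exists>u. \<forall>B. (\<forall>m<u. m \<in> B \<longleftrightarrow> m \<in> A) \<longrightarrow> eval B c x y"
  using assms
proof (induction rule: eval.induct)
  case (Oracle x)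
  show ?case
    by (rule exI[of _ "Suc x"]) (metis eval.Oracle lessI)
next
  case (Pair f x y g z)
  then obtain u v where "\<And>B. (\<forall>m<u. m \<in> B \<longleftrightarrow> m \<in> A) \<Longrightarrow> eval B f x y"
    "\<And>B. (\<forall>m<v. m \<in> B \<longleftrightarrow> m \<in> A) \<Longrightarrow> eval B g x z" by blast
  then have "eval B (Pair f g) x (prod_encode (y, z))" if "\<forall>m<max u v. m \<in> B \<longleftrightarrow> m \<in> A" for B
    using that by (simp add: eval.Pair)
  then show ?case by blast
next
  case (Comp g x y f z)
  then obtain u v where *: "\<And>B. (\<forall>m<u. m \<in> B \<longleftrightarrow> m \<in> A) \<Longrightarrow> eval B g x y"
    "\<And>B. (\<forall>m<v. m \<in> B \<longleftrightarrow> m \<in> A) \<Longrightarrow> eval B f y z" by blast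
  have "eval B (Comp f g) x z" if "\<forall>m<max u v. m \<in> B \<longleftrightarrow> m \<in> A" for B
    by (rule eval.Comp[of B g x y]) (use * that in simp_all)
  then show ?case by blast
next
  case (Prec_0 f x y g)
  then obtain u where "\<forall>B. (\<forall>m<u. m \<in> B \<longleftrightarrow> m \<in> A) \<longrightarrow> eval B f x y" by blast
  then show ?case by (blast intro: eval.Prec_0)
next
  case (Prec_Suc f g x n y z)
  then obtain u v where *: "\<And>B. (\<forall>m<u. m \<in> B \<longleftrightarrow> m \<in> A) \<Longrightarrow> eval B (Prec f g) (prod_encode (x, n)) y"
    "\<And>B. (\<forall>m<v. m \<in> B \<longleftrightarrow> m \<in> A) \<Longrightarrow> eval B g (prod_encode (x, prod_encode (n, y))) z" by blast
  have "eval B (Prec f g) (prod_encode (x, Suc n)) z"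
    if "\<forall>m<max u v. m \<in> B \<longleftrightarrow> m \<in> A" for B
    by (rule eval.Prec_Suc[of B f g x n y]) (use * that in simp_all)
  then show ?case by blast
next
  case (Mu f x n)
  from Mu(2) obtain u where u: "\<And>B. (\<forall>m<u. m \<in> B \<longleftrightarrow> m \<in> A) \<Longrightarrow> eval B f (prod_encode (x, n)) 0" by blast
  have "\<exists>w v. \<forall>B. (\<forall>k<w. k \<in> B \<longleftrightarrow> k \<in> A) \<longrightarrow> eval B f (prod_encode (x, m)) (Suc v)" if "m < n" for m
    using Mu(3) that by blast
  then obtain w v where w: "\<And>m B. m < n \<Longrightarrow> \<forall>k<w m. k \<in> B \<longleftrightarrow> k \<in> A \<Longrightarrow>
      eval B f (prod_encode (x, m)) (Suc (v m))" by metis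
  define U where "U = Max (insert u (w ` {..<n}))"
  have U: "u \<le> U" "\<And>m. m < n \<Longrightarrow> w m \<le> U" by (auto simp: U_def)
  have "eval B (Mu f) x n" if B: "\<forall>m<U. m \<in> B \<longleftrightarrow> m \<in> A" for B
  proof (rule eval.Mu)
    show "eval B f (prod_encode (x, n)) 0" by (rule u) (use B U(1) in simp)
    have "eval B f (prod_encode (x, m)) (Suc (v m))" if "m < n" for m
      by (rule w[OF that]) (use B U(2)[OF that] in simp)
    then show "\<forall>m<n. \<exists>v. eval B f (prod_encode (x, m)) (Suc v)" by blast
  qed
  then show ?case by blast
qed (auto intro: eval.Zero eval.Succ eval.Fst eval.Snd)

subsection \<open>Abundant sets of points\<close>

definition matching :: "(bool list \<Rightarrow> nat) \<Rightarrow> (bool list \<Rightarrow> nat) \<Rightarrow> (bool list \<times> bool list) set" where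
  "matching Y z = {(\<rho>, x). prefix \<rho> x \<and> Y x = z \<rho>}"

text \<open>An index \<open>(\<Lambda>, G)\<close> stands for the property that some \<open>g \<in> G\<close> can be found above roots in \<open>\<Lambda>\<close>,
  and \<open>B\<close> is the set of available points.\<close>

definition met :: "(bool list \<times> bool list) set \<Rightarrow> bool list set \<times> bool list set set \<Rightarrow> bool" where
  "met B i \<longleftrightarrow> (\<exists>g\<in>snd i. \<forall>x\<in>g. \<exists>\<rho>\<in>fst i. (\<rho>, x) \<in> B)"

text \<open>The selection may depend on both \<open>E\<close> and \<open>Y\<close>, but it has to
  serve all members of \<open>E\<close> at once. The parameter \<open>B\<close> allows the notion to
  be applied to shrinking sets of points.\<close>

definition abundant ::
  "(bool list set \<times> bool list set set) set \<Rightarrow> (bool list \<times> bool list) set \<Rightarrow> bool" where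
  "abundant M B \<longleftrightarrow> (\<forall>E Y. finite E \<and> E \<subseteq> M \<and> finite (range Y) \<longrightarrow>
    (\<exists>z. \<forall>i\<in>E. met (B \<inter> matching Y z) i))"

lemma abundantD:
  assumes "abundant M B" "finite E" "E \<subseteq> M" "finite (range Y)"
  shows "\<exists>z. \<forall>i\<in>E. met (B \<inter> matching Y z) i"
  using assms(1)[unfolded abundant_def, THEN spec, THEN spec, THEN mp] assms(2-4) by (meson conjI)

lemma not_abundantD:
  assumes "\<not> abundant M B"
  shows "\<exists>E Y. finite E \<and> E \<subseteq> M \<and> finite (range Y) \<and> (\<forall>z. \<exists>i\<in>E. \<not> met (B \<inter> matching Y z) i)"
  using assms unfolding abundant_def by (simp only: not_all not_imp not_ex conj_assoc ball_simps)

lemma met_relabel: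
  assumes "met B (\<phi> ` fst i, snd i)" "\<And>\<rho> x. \<rho> \<in> fst i \<Longrightarrow> (\<phi> \<rho>, x) \<in> B \<Longrightarrow> (\<rho>, x) \<in> B'"
  shows "met B' i"
proof -
  obtain g where g: "g \<in> snd i" "\<And>x. x \<in> g \<Longrightarrow> \<exists>\<rho>\<in>fst i. (\<phi> \<rho>, x) \<in> B"
    using assms(1) unfolding met_def by auto
  then have "\<forall>x\<in>g. \<exists>\<rho>\<in>fst i. (\<rho>, x) \<in> B'" using assms(2) by metis
  with g(1) show ?thesis unfolding met_def by (rule bexI[rotated])
qed

lemma met_mono_on:
  "met B i \<Longrightarrow> (\<And>\<rho> x. \<rho> \<in> fst i \<Longrightarrow> (\<rho>, x) \<in> B \<Longrightarrow> (\<rho>, x) \<in> B') \<Longrightarrow> met B' i"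
  using met_relabel[of B "\<lambda>\<rho>. \<rho>" i B'] by simp

lemma met_mono: "met B i \<Longrightarrow> B \<subseteq> B' \<Longrightarrow> met B' i"
  by (erule met_mono_on) auto

lemma abundant_mono:
  assumes "abundant M B" "B \<subseteq> B'" shows "abundant M B'"
  unfolding abundant_def
proof (intro allI impI, elim conjE)
  fix E Y assume "finite E" "E \<subseteq> M" "finite (range (Y :: bool list \<Rightarrow> nat))"
  then obtain z where "\<forall>i\<in>E. met (B \<inter> matching Y z) i" using abundantD[OF assms(1)] by blast
  moreover have "B \<inter> matching Y z \<subseteq> B' \<inter> matching Y z" using assms(2) by blast
  ultimately show "\<exists>z. \<forall>i\<in>E. met (B' \<inter> matching Y z) i" using met_mono by blast
qed

section \<open>Refining an abundant set by a finite colouring\<close>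

lemma common_refinement:
  fixes Y :: "'a \<Rightarrow> 'b \<Rightarrow> nat"
  assumes "finite I" "\<forall>i\<in>I. finite (range (Y i))"
  shows "\<exists>(U :: 'b \<Rightarrow> nat) f. finite (range U) \<and> (\<forall>i\<in>I. \<forall>x. Y i x = f i (U x))"
  using assms
proof (induction I)
  case empty
  have "finite (range (\<lambda>_ :: 'b. 0 :: nat))" by simp
  then show ?case by blast
next
  case (insert i I)
  from insert.IH insert.prems obtain U :: "'b \<Rightarrow> nat" and f
    where U: "finite (range U)" "\<And>j x. j \<in> I \<Longrightarrow> Y j x = f j (U x)" by blast
  \<comment> \<open>The new colour records the colour under \<open>Y i\<close> and the colour under
    \<open>U\<close>; \<open>h\<close> recovers every old colouring from it.\<close>
  define W where "W x = prod_encode (Y i x, U x)" for x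
  define h where "h j u = (if j = i then pfst u else f j (psnd u))" for j u
  have "range W \<subseteq> prod_encode ` (range (Y i) \<times> range U)" by (auto simp: W_def)
  moreover have "finite (prod_encode ` (range (Y i) \<times> range U))"
    using U(1) insert.prems by simp
  ultimately have "finite (range W)" by (rule finite_subset)
  moreover have "\<forall>j\<in>insert i I. \<forall>x. Y j x = h j (W x)"
    using U(2) by (simp add: h_def W_def)
  ultimately show ?case by blast
qed

text \<open>If every colour failed at \<rho>, take the finite families and colourings that witness
  the failures and refine all these colourings together with \<open>Y\<close>. A selection for the
  refinement determines a colour of \<open>Y\<close> at \<rho>, and it refutes the failure for that
  colour.\<close>

lemma abundant_refine_at:
  fixes Y :: "bool list \<Rightarrow> nat"
  assumes "abundant M B" "finite (range Y)"
  shows "\<exists>c\<in>range Y. abundant M (B \<inter> {(\<rho>', x). \<rho>' = \<rho> \<longrightarrow> Y x = c})"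
proof (rule ccontr)
  let ?B = "\<lambda>c. B \<inter> {(\<rho>', x). \<rho>' = \<rho> \<longrightarrow> Y x = c}"
  assume "\<not> ?thesis"
  then have "\<And>c. c \<in> range Y \<Longrightarrow> \<not> abundant M (?B c)" by blast
  from not_abundantD[OF this] have "\<And>c. c \<in> range Y \<Longrightarrow> \<exists>E U. finite E \<and> E \<subseteq> M \<and> finite (range U) \<and>
      (\<forall>z. \<exists>i\<in>E. \<not> met (?B c \<inter> matching U z) i)" .
  then obtain E U where E: "\<And>c. c \<in> range Y \<Longrightarrow> finite (E c)" "\<And>c. c \<in> range Y \<Longrightarrow> E c \<subseteq> M"
    and U: "\<And>c. c \<in> range Y \<Longrightarrow> finite (range (U c))"
    and fail: "\<And>c z. c \<in> range Y \<Longrightarrow> \<exists>i\<in>E c. \<not> met (?B c \<inter> matching (U c) z) i"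
    by metis
  \<comment> \<open>The index \<open>None\<close> stands for \<open>Y\<close> and
    \<open>Some c\<close> for the witness \<open>U c\<close>, so that one refinement covers them
    all.\<close>
  have "finite (range (case_option Y U j))" if "j \<in> insert None (Some ` range Y)" for j
    using that assms(2) U by auto
  moreover have "finite (insert None (Some ` range Y))" using assms(2) by simp
  ultimately have "\<exists>W f. finite (range (W :: bool list \<Rightarrow> nat)) \<and>
      (\<forall>j\<in>insert None (Some ` range Y). \<forall>x. case_option Y U j x = f j (W x))"
    by (intro common_refinement ballI)
  then obtain W :: "bool list \<Rightarrow> nat" and f where W: "finite (range W)"
    and f: "\<forall>j\<in>insert None (Some ` range Y). \<forall>x. case_option Y U j x = f j (W x)"
    by blast
  have fY: "Y x = f None (W x)" for x using bspec[OF f, of None] by simp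
  have fU: "U c x = f (Some c) (W x)" if "c \<in> range Y" for c x
    using bspec[OF f, of "Some c"] that by simp
  have "finite (\<Union>c\<in>range Y. E c)" "(\<Union>c\<in>range Y. E c) \<subseteq> M"
    using assms(2) E by (blast, blast)
  then obtain z where z: "\<And>i. i \<in> (\<Union>c\<in>range Y. E c) \<Longrightarrow> met (B \<inter> matching W z) i"
    using abundantD[OF assms(1) _ _ W] by meson
  \<comment> \<open>If the value selected at \<rho> induces no actual colour of \<open>Y\<close>,
    then no point at \<rho> is matched, and the default \<open>Y []\<close> is harmless.\<close>
  define c where "c = (if f None (z \<rho>) \<in> range Y then f None (z \<rho>) else Y [])"
  have c: "c \<in> range Y" by (simp add: c_def)
  have "B \<inter> matching W z \<subseteq> ?B c \<inter> matching (U c) (\<lambda>\<rho>. f (Some c) (z \<rho>))"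
  proof -
    have "Y x = c" if "W x = z \<rho>" for x
      using that fY[of x] unfolding c_def by (metis rangeI)
    then show ?thesis by (auto simp: matching_def fU[OF c])
  qed
  then have "\<forall>i\<in>E c. met (?B c \<inter> matching (U c) (\<lambda>\<rho>. f (Some c) (z \<rho>))) i"
    using z c by (meson UN_I met_mono)
  with fail[OF c] show False by blast
qed

text \<open>The colours are chosen one string at a time. This works in the limit because an index
  only involves finitely many strings \<open>\<rho>\<close>.\<close>

lemma abundant_refine:
  fixes Y :: "bool list \<Rightarrow> nat"
  assumes B: "abundant M B" and Y: "finite (range Y)" and fin: "\<forall>i\<in>M. finite (fst i)"
  shows "\<exists>z. range z \<subseteq> range Y \<and> abundant M (B \<inter> {(\<rho>, x). Y x = z \<rho>})"
proof -
  let ?B = "\<lambda>m z. B \<inter> {(\<rho>, x). str_encode \<rho> < m \<longrightarrow> Y x = z \<rho>}"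
  let ?P = "\<lambda>m z. range z \<subseteq> range Y \<and> abundant M (?B m z)"
  let ?Q = "\<lambda>m z z'. \<forall>\<rho>. str_encode \<rho> < m \<longrightarrow> z' \<rho> = z \<rho>"
  have "\<exists>z. \<forall>m. ?P m (z m) \<and> ?Q m (z m) (z (Suc m))"
  proof (rule dependent_nat_choice)
    show "\<exists>z. ?P 0 z" using B by (intro exI[of _ "\<lambda>_. Y []"]) simp
  next
    fix z m assume z: "?P m z"
    define \<rho> where "\<rho> = inv str_encode m"
    have \<rho>: "str_encode \<sigma> = m \<longleftrightarrow> \<sigma> = \<rho>" for \<sigma>
      using bij_inv_eq_iff[OF bij_str_encode, of \<sigma> m] by (auto simp: \<rho>_def)
    from abundant_refine_at[OF conjunct2[OF z] Y, of \<rho>]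
    obtain c where c: "c \<in> range Y" "abundant M (?B m z \<inter> {(\<rho>', x). \<rho>' = \<rho> \<longrightarrow> Y x = c})"
      by (rule bexE)
    have "Y x = (z(\<rho> := c)) \<sigma>"
      if "str_encode \<sigma> < m \<longrightarrow> Y x = z \<sigma>" "\<sigma> = \<rho> \<longrightarrow> Y x = c" "str_encode \<sigma> < Suc m" for \<sigma> x
      using that \<rho>[of \<sigma>] by (cases "\<sigma> = \<rho>") (simp_all add: less_Suc_eq)
    then have "?B m z \<inter> {(\<rho>', x). \<rho>' = \<rho> \<longrightarrow> Y x = c} \<subseteq> ?B (Suc m) (z(\<rho> := c))"
      by (auto simp del: fun_upd_apply)
    with c(2) have "abundant M (?B (Suc m) (z(\<rho> := c)))" by (rule abundant_mono)
    moreover have "range (z(\<rho> := c)) \<subseteq> range Y" using z c(1) by auto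
    moreover have "?Q m z (z(\<rho> := c))" using \<rho>[of \<rho>] by simp
    ultimately show "\<exists>z'. ?P (Suc m) z' \<and> ?Q m z z'" by (intro exI conjI)
  qed
  then obtain z where *: "\<forall>m. ?P m (z m) \<and> ?Q m (z m) (z (Suc m))" by (rule exE)
  then have z: "\<And>m. range (z m) \<subseteq> range Y" "\<And>m. abundant M (?B m (z m))"
    and agree: "\<And>m. ?Q m (z m) (z (Suc m))" by simp_all
  define zz where "zz \<rho> = z (Suc (str_encode \<rho>)) \<rho>" for \<rho>
  have zz: "z m \<rho> = zz \<rho>" if "str_encode \<rho> < m" for m \<rho>
  proof -
    from that have "Suc (str_encode \<rho>) \<le> m" by simp
    then show ?thesis
    proof (induction m rule: dec_induct)
      case base
      show ?case by (simp add: zz_def)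
    next
      case (step m)
      with agree[of m] show ?case by simp
    qed
  qed
  have "abundant M (B \<inter> {(\<rho>, x). Y x = zz \<rho>})"
    unfolding abundant_def
  proof (intro allI impI, elim conjE)
    fix E U assume E: "finite E" "E \<subseteq> M" and U: "finite (range (U :: bool list \<Rightarrow> nat))"
    have "finite (str_encode ` (\<Union>i\<in>E. fst i))"
      using E(2) by (intro finite_imageI finite_UN_I E(1)) (use fin in blast)
    then obtain m where m: "\<And>\<rho> i. i \<in> E \<Longrightarrow> \<rho> \<in> fst i \<Longrightarrow> str_encode \<rho> < m"
      unfolding finite_nat_set_iff_bounded by auto
    obtain v where v: "\<And>i. i \<in> E \<Longrightarrow> met (?B m (z m) \<inter> matching U v) i"
      using abundantD[OF z(2) E U] by blast
    have "met (B \<inter> {(\<rho>, x). Y x = zz \<rho>} \<inter> matching U v) i" if "i \<in> E" for i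
      by (rule met_mono_on[OF v[OF that]]) (use m[OF that] zz in auto)
    then show "\<exists>v. \<forall>i\<in>E. met (B \<inter> {(\<rho>, x). Y x = zz \<rho>} \<inter> matching U v) i" by blast
  qed
  moreover have "range zz \<subseteq> range Y" using z(1) by (auto simp: zz_def)
  ultimately show ?thesis by blast
qed

section \<open>Moving roots upwards and homogenizing pools\<close>

definition deepening :: "(bool list \<Rightarrow> bool list) \<Rightarrow> bool" where
  "deepening \<phi> \<longleftrightarrow> (\<forall>\<rho>. prefix \<rho> (\<phi> \<rho>))"

definition deepening_closed :: "(bool list set \<times> bool list set set) set \<Rightarrow> bool" where
  "deepening_closed M \<longleftrightarrow> (\<forall>\<phi> \<Lambda> G. deepening \<phi> \<longrightarrow> (\<Lambda>, G) \<in> M \<longrightarrow> (\<phi> ` \<Lambda>, G) \<in> M)"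

text \<open>The members of \<open>E\<close> with their roots moved by \<phi> belong to
  \<open>M\<close> as well. A selection for the moved properties, composed with \<phi>, serves the
  original ones.\<close>

lemma abundant_relabel:
  assumes "abundant M B" "deepening_closed M" "deepening \<phi>" "B \<subseteq> {(\<rho>, x). prefix \<rho> x}"
  shows "abundant M {(\<rho>, x). (\<phi> \<rho>, x) \<in> B}"
  unfolding abundant_def
proof (intro allI impI, elim conjE)
  fix E Y assume E: "finite E" "E \<subseteq> M" and Y: "finite (range (Y :: bool list \<Rightarrow> nat))"
  have "(\<lambda>i. (\<phi> ` fst i, snd i)) ` E \<subseteq> M"
    using E(2) assms(2,3) by (auto simp: deepening_closed_def)
  from abundantD[OF assms(1) finite_imageI[OF E(1)] this Y]
  obtain z where "\<forall>j\<in>(\<lambda>i. (\<phi> ` fst i, snd i)) ` E. met (B \<inter> matching Y z) j" by (rule exE)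
  then have z: "\<And>i. i \<in> E \<Longrightarrow> met (B \<inter> matching Y z) (\<phi> ` fst i, snd i)" by (rule bspec) simp
  have "met ({(\<rho>, x). (\<phi> \<rho>, x) \<in> B} \<inter> matching Y (z \<circ> \<phi>)) i" if "i \<in> E" for i
    by (rule met_relabel[OF z[OF that]])
      (use assms(3) in \<open>auto simp: matching_def deepening_def intro: prefix_order.trans\<close>)
  then show "\<exists>z. \<forall>i\<in>E. met ({(\<rho>, x). (\<phi> \<rho>, x) \<in> B} \<inter> matching Y z) i" by blast
qed

text \<open>Choose \<sigma> above \<rho> such that \<open>z\<close> takes the least number of values
  on its cone. No smaller cone can lose a value, so the value at \<sigma> recurs above every
  extension of \<sigma>.\<close>

lemma dense_colour:
  assumes "finite (range (z :: bool list \<Rightarrow> nat))"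
  shows "\<exists>\<sigma>. prefix \<rho> \<sigma> \<and> (\<forall>\<tau>. prefix \<sigma> \<tau> \<longrightarrow> (\<exists>\<upsilon>. prefix \<tau> \<upsilon> \<and> z \<upsilon> = z \<sigma>))"
proof -
  define K where "K \<sigma> = z ` {\<upsilon>. prefix \<sigma> \<upsilon>}" for \<sigma>
  have fin: "finite (K \<sigma>)" for \<sigma> unfolding K_def by (rule finite_subset[OF _ assms]) auto
  obtain \<sigma> where \<sigma>: "prefix \<rho> \<sigma>" "\<And>\<tau>. prefix \<rho> \<tau> \<Longrightarrow> card (K \<sigma>) \<le> card (K \<tau>)"
    using exists_least_iff[of "\<lambda>n. \<exists>\<sigma>. prefix \<rho> \<sigma> \<and> card (K \<sigma>) = n"]
    by (metis not_le prefix_order.refl)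
  have "z \<sigma> \<in> K \<tau>" if "prefix \<sigma> \<tau>" for \<tau>
  proof -
    have "K \<tau> \<subseteq> K \<sigma>" using that unfolding K_def by (auto intro: prefix_order.trans)
    moreover have "card (K \<sigma>) \<le> card (K \<tau>)" using \<sigma> that by (meson prefix_order.trans)
    ultimately have "K \<tau> = K \<sigma>" by (meson card_seteq fin)
    then show ?thesis by (auto simp: K_def)
  qed
  with \<sigma>(1) show ?thesis unfolding K_def by fastforce
qed

text \<open>The cones above \<open>\<Lambda>\<close> are restricted to \<open>X\<close>; the rest is unrestricted, which does no harm
  because abundance is monotone.\<close>

definition pool :: "bool list set \<Rightarrow> bool list set \<Rightarrow> (bool list \<times> bool list) set" where
  "pool \<Lambda> X = {(\<rho>, x). prefix \<rho> x \<and> ((\<exists>\<nu>\<in>\<Lambda>. prefix \<nu> \<rho>) \<longrightarrow> x \<in> X)}"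

text \<open>First \<open>abundant_refine\<close> fixes a colour \<open>z \<rho>\<close> for each
  root; then \<psi> moves roots to strings whose colour is dense above them. Every root above a slot
  from the range of \<psi> can thus be moved further to a root with the colour of such a slot, so
  thinning the pool to the colours of the slots keeps it abundant.\<close>

lemma abundant_homogenize:
  fixes Y :: "bool list \<Rightarrow> nat"
  assumes B: "abundant M (pool \<Lambda> X)" and Y: "finite (range Y)"
    and fin: "\<forall>i\<in>M. finite (fst i)" and closed: "deepening_closed M"
  obtains z \<psi> where "deepening \<psi>" "range z \<subseteq> range Y"
    "abundant M {(\<rho>, x). prefix (\<psi> \<rho>) x \<and> Y x = z (\<psi> \<rho>)}"
    "\<forall>\<Lambda>'. \<Lambda>' \<subseteq> range \<psi> \<longrightarrow> (\<forall>\<nu>'\<in>\<Lambda>'. \<exists>\<nu>\<in>\<Lambda>. prefix \<nu> \<nu>') \<longrightarrow>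
      abundant M (pool \<Lambda>' {x \<in> X. \<exists>\<nu>'\<in>\<Lambda>'. prefix \<nu>' x \<and> Y x = z \<nu>'})"
proof -
  obtain z where z: "range z \<subseteq> range Y" and "abundant M (pool \<Lambda> X \<inter> {(\<rho>, x). Y x = z \<rho>})"
    using abundant_refine[OF B Y fin] by (elim exE conjE)
  define B' where "B' = pool \<Lambda> X \<inter> {(\<rho>, x). Y x = z \<rho>}"
  have B': "abundant M B'" "B' \<subseteq> {(\<rho>, x). prefix \<rho> x}"
    using \<open>abundant M (pool _ _ \<inter> _)\<close> by (auto simp: B'_def pool_def)
  have "finite (range z)" using z Y by (rule finite_subset)
  from dense_colour[OF this] obtain \<psi> where \<psi>: "\<And>\<rho>. prefix \<rho> (\<psi> \<rho>)"
    "\<And>\<rho> \<tau>. prefix (\<psi> \<rho>) \<tau> \<Longrightarrow> \<exists>\<upsilon>. prefix \<tau> \<upsilon> \<and> z \<upsilon> = z (\<psi> \<rho>)" by metis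
  show ?thesis
  proof (rule that[OF _ z])
    show deep: "deepening \<psi>" using \<psi>(1) by (simp add: deepening_def)
    show "abundant M {(\<rho>, x). prefix (\<psi> \<rho>) x \<and> Y x = z (\<psi> \<rho>)}"
      by (rule abundant_mono[OF abundant_relabel[OF B'(1) closed deep B'(2)]])
        (auto simp: B'_def pool_def)
    show "\<forall>\<Lambda>'. \<Lambda>' \<subseteq> range \<psi> \<longrightarrow> (\<forall>\<nu>'\<in>\<Lambda>'. \<exists>\<nu>\<in>\<Lambda>. prefix \<nu> \<nu>') \<longrightarrow>
      abundant M (pool \<Lambda>' {x \<in> X. \<exists>\<nu>'\<in>\<Lambda>'. prefix \<nu>' x \<and> Y x = z \<nu>'})"
  proof (intro allI impI)
    fix \<Lambda>' assume \<Lambda>': "\<Lambda>' \<subseteq> range \<psi>" "\<forall>\<nu>'\<in>\<Lambda>'. \<exists>\<nu>\<in>\<Lambda>. prefix \<nu> \<nu>'"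
    have "\<exists>\<upsilon>. prefix \<rho> \<upsilon> \<and> ((\<exists>\<nu>'\<in>\<Lambda>'. prefix \<nu>' \<rho>) \<longrightarrow> (\<exists>\<nu>'\<in>\<Lambda>'. prefix \<nu>' \<rho> \<and> z \<upsilon> = z \<nu>'))" for \<rho>
    proof (cases "\<exists>\<nu>'\<in>\<Lambda>'. prefix \<nu>' \<rho>")
      case True
      then obtain \<nu>' where "\<nu>' \<in> \<Lambda>'" "prefix \<nu>' \<rho>" by blast
      moreover from this \<Lambda>'(1) obtain \<upsilon> where "prefix \<rho> \<upsilon>" "z \<upsilon> = z \<nu>'" using \<psi>(2) by blast
      ultimately show ?thesis by blast
    qed auto
    then obtain \<chi> where \<chi>: "\<And>\<rho>. prefix \<rho> (\<chi> \<rho>)" "\<And>\<rho>. \<exists>\<nu>'\<in>\<Lambda>'. prefix \<nu>' \<rho> \<Longrightarrow>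
        \<exists>\<nu>'\<in>\<Lambda>'. prefix \<nu>' \<rho> \<and> z (\<chi> \<rho>) = z \<nu>'" by metis
    have "(\<rho>, x) \<in> pool \<Lambda>' {x \<in> X. \<exists>\<nu>'\<in>\<Lambda>'. prefix \<nu>' x \<and> Y x = z \<nu>'}" if "(\<chi> \<rho>, x) \<in> B'" for \<rho> x
    proof -
      have x: "prefix \<rho> x" using that \<chi>(1)[of \<rho>] B'(2) by (auto intro: prefix_order.trans)
      moreover have "x \<in> X \<and> (\<exists>\<nu>'\<in>\<Lambda>'. prefix \<nu>' x \<and> Y x = z \<nu>')" if below: "\<exists>\<nu>'\<in>\<Lambda>'. prefix \<nu>' \<rho>"
      proof -
        obtain \<nu>' where \<nu>': "\<nu>' \<in> \<Lambda>'" "prefix \<nu>' \<rho>" "z (\<chi> \<rho>) = z \<nu>'" using \<chi>(2)[OF below] by blast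
        then obtain \<nu> where "\<nu> \<in> \<Lambda>" "prefix \<nu> \<nu>'" using \<Lambda>'(2) by blast
        then have "prefix \<nu> (\<chi> \<rho>)" using \<nu>'(2) \<chi>(1) by (meson prefix_order.trans)
        then have "x \<in> X" "Y x = z \<nu>'"
          using \<open>(\<chi> \<rho>, x) \<in> B'\<close> \<open>\<nu> \<in> \<Lambda>\<close> \<nu>'(3) by (auto simp: B'_def pool_def)
        moreover have "prefix \<nu>' x" using \<nu>'(2) x by (rule prefix_order.trans)
        ultimately show ?thesis using \<nu>'(1) by blast
      qed
      ultimately show ?thesis by (auto simp: pool_def)
    qed
    then have "{(\<rho>, x). (\<chi> \<rho>, x) \<in> B'} \<subseteq> pool \<Lambda>' {x \<in> X. \<exists>\<nu>'\<in>\<Lambda>'. prefix \<nu>' x \<and> Y x = z \<nu>'}"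
      by blast
    moreover have "abundant M {(\<rho>, x). (\<chi> \<rho>, x) \<in> B'}"
      using \<chi>(1) by (intro abundant_relabel[OF B'(1) closed _ B'(2)]) (simp add: deepening_def)
    ultimately show "abundant M (pool \<Lambda>' {x \<in> X. \<exists>\<nu>'\<in>\<Lambda>'. prefix \<nu>' x \<and> Y x = z \<nu>'})"
      by (rule abundant_mono[rotated])
    qed
  qed
qed

lemma abundant_avoid:
  fixes Y :: "bool list \<Rightarrow> nat"
  assumes B: "abundant M (pool \<Lambda> X)" and Y: "finite (range Y)"
    and fin: "\<forall>i\<in>M. finite (fst i)" and closed: "deepening_closed M"
    and E: "finite E" "E \<subseteq> M" and \<Phi>: "\<And>\<phi>. \<phi> \<in> \<Phi> \<Longrightarrow> deepening \<phi>"
    and fail: "\<And>z. \<forall>i\<in>E. met (matching Y z) i \<Longrightarrow> \<exists>\<phi>\<in>\<Phi>. \<not> met (matching Y z) (\<phi> ` \<Lambda>, G)"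
  obtains \<psi> X' where "deepening \<psi>" "X' \<subseteq> X" "abundant M (pool (\<psi> ` \<Lambda>) X')"
    "\<And>g. g \<in> G \<Longrightarrow> \<not> g \<subseteq> X'"
proof -
  obtain z \<psi> where \<psi>: "deepening \<psi>" and "range z \<subseteq> range Y"
    and ab: "abundant M {(\<rho>, x). prefix (\<psi> \<rho>) x \<and> Y x = z (\<psi> \<rho>)}"
    and pool: "\<forall>\<Lambda>'. \<Lambda>' \<subseteq> range \<psi> \<longrightarrow> (\<forall>\<nu>'\<in>\<Lambda>'. \<exists>\<nu>\<in>\<Lambda>. prefix \<nu> \<nu>') \<longrightarrow>
      abundant M (pool \<Lambda>' {x \<in> X. \<exists>\<nu>'\<in>\<Lambda>'. prefix \<nu>' x \<and> Y x = z \<nu>'})"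
    by (rule abundant_homogenize[OF B Y fin closed])
  have deep: "prefix \<rho> (\<psi> \<rho>)" for \<rho> using \<psi> by (simp add: deepening_def)
  have below: "prefix \<rho> x" if "prefix (\<psi> \<rho>) x" for \<rho> x
    using deep that by (rule prefix_order.trans)
  \<comment> \<open>With a one-colour colouring, abundance simply says that \<open>E\<close> is
    realized inside the homogenized set.\<close>
  have "finite (range (\<lambda>_ :: bool list. 0 :: nat))" by simp
  from abundantD[OF ab E this] obtain v where
    v: "\<forall>i\<in>E. met ({(\<rho>, x). prefix (\<psi> \<rho>) x \<and> Y x = z (\<psi> \<rho>)} \<inter> matching (\<lambda>_. 0) v) i"
    by (rule exE)
  have "met (matching Y (z \<circ> \<psi>)) i" if "i \<in> E" for i
    by (rule met_mono[OF bspec[OF v that]]) (auto simp: matching_def below)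
  then obtain \<phi> where \<phi>: "\<phi> \<in> \<Phi>" "\<not> met (matching Y (z \<circ> \<psi>)) (\<phi> ` \<Lambda>, G)" using fail by blast
  have deep': "prefix \<rho> (\<psi> (\<phi> \<rho>))" for \<rho>
    using \<Phi>[OF \<phi>(1)] deep unfolding deepening_def by (meson prefix_order.trans)
  define X' where "X' = {x \<in> X. \<exists>\<nu>'\<in>(\<psi> \<circ> \<phi>) ` \<Lambda>. prefix \<nu>' x \<and> Y x = z \<nu>'}"
  show ?thesis
  proof (rule that)
    show "deepening (\<psi> \<circ> \<phi>)" using deep' by (simp add: deepening_def)
    show "X' \<subseteq> X" by (auto simp: X'_def)
    show "abundant M (pool ((\<psi> \<circ> \<phi>) ` \<Lambda>) X')"
      unfolding X'_def
      by (rule pool[THEN spec, THEN mp, THEN mp]) (use deep' in auto)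
  next
    fix g assume g: "g \<in> G"
    have "\<exists>\<rho>\<in>\<phi> ` \<Lambda>. (\<rho>, x) \<in> matching Y (z \<circ> \<psi>)" if "x \<in> X'" for x
      using that below unfolding X'_def matching_def by auto
    then have "met (matching Y (z \<circ> \<psi>)) (\<phi> ` \<Lambda>, G)" if "g \<subseteq> X'"
      using that g unfolding met_def by (intro bexI[of _ g]) auto
    with \<phi>(2) show "\<not> g \<subseteq> X'" by blast
  qed
qed

text \<open>For the colouring of the theorem this provides the colour \<open>z (\<psi> [])\<close>
  of the tree and the slot \<open>\<psi> []\<close> of the initial condition.\<close>

lemma abundant_initial:
  assumes B: "abundant M {(\<rho>, x). prefix \<rho> x}" and Y: "finite (range (Y :: bool list \<Rightarrow> nat))"
    and fin: "\<forall>i\<in>M. finite (fst i)" and closed: "deepening_closed M"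
  obtains \<sigma> c where "c \<in> range Y" "abundant M (pool {\<sigma>} {x. Y x = c})"
proof -
  have "pool {[]} UNIV = {(\<rho>, x). prefix \<rho> x}" by (auto simp: pool_def)
  with B have "abundant M (pool {[]} UNIV)" by simp
  from abundant_homogenize[OF this Y fin closed]
  obtain z \<psi> where "deepening \<psi>" and z: "range z \<subseteq> range Y"
    and "abundant M {(\<rho>, x). prefix (\<psi> \<rho>) x \<and> Y x = z (\<psi> \<rho>)}"
    and pool: "\<forall>\<Lambda>'. \<Lambda>' \<subseteq> range \<psi> \<longrightarrow> (\<forall>\<nu>'\<in>\<Lambda>'. \<exists>\<nu>\<in>{[]}. prefix \<nu> \<nu>') \<longrightarrow>
      abundant M (pool \<Lambda>' {x \<in> UNIV. \<exists>\<nu>'\<in>\<Lambda>'. prefix \<nu>' x \<and> Y x = z \<nu>'})"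
    by this
  have "abundant M (pool {\<psi> []} {x \<in> UNIV. \<exists>\<nu>'\<in>{\<psi> []}. prefix \<nu>' x \<and> Y x = z \<nu>'})"
    by (rule pool[THEN spec, THEN mp, THEN mp]) auto
  then have "abundant M (pool {\<psi> []} {x. Y x = z (\<psi> [])})"
    by (rule abundant_mono) (auto simp: pool_def)
  with z show ?thesis using that by blast
qed

section \<open>A maximal abundant family\<close>

definition nonempty_at :: "bool list \<Rightarrow> bool list set \<times> bool list set set" where
  "nonempty_at \<rho> = ({\<rho>}, {g. finite g \<and> g \<noteq> {}})"

text \<open>The string \<rho> lies in its own cone, so \<open>Y\<close> itself can serve as the
  selection. Keeping these properties in the families ensures that an abundant pool has a point
  above each slot, which lets the tree grow.\<close>

lemma abundant_nonempty: "abundant (range nonempty_at) {(\<rho>, x). prefix \<rho> x}"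
  unfolding abundant_def
proof (intro allI impI, elim conjE)
  fix E and Y :: "bool list \<Rightarrow> nat" assume E: "E \<subseteq> range nonempty_at"
  have "met ({(\<rho>, x). prefix \<rho> x} \<inter> matching Y Y) (nonempty_at \<rho>)" for \<rho>
    unfolding met_def nonempty_at_def by (rule bexI[of _ "{\<rho>}"]) (auto simp: matching_def)
  with E have "\<forall>i\<in>E. met ({(\<rho>, x). prefix \<rho> x} \<inter> matching Y Y) i" by auto
  then show "\<exists>z. \<forall>i\<in>E. met ({(\<rho>, x). prefix \<rho> x} \<inter> matching Y z) i" by (intro exI[of _ Y])
qed

text \<open>Zorn's lemma applies because abundance concerns finite subfamilies, and each of these
  lies in a single member of a chain. Adding an omitted property destroys abundance, and the failure
  yields the finite witnesses \<open>E\<close>, \<Phi> and \<open>Y\<close>.\<close>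

lemma maximal_family:
  assumes I: "deepening_closed I" "range nonempty_at \<subseteq> I"
  shows "\<exists>M. M \<subseteq> I \<and> range nonempty_at \<subseteq> M \<and> deepening_closed M \<and>
    abundant M {(\<rho>, x). prefix \<rho> x} \<and> (\<forall>\<Lambda> G. (\<Lambda>, G) \<in> I - M \<longrightarrow>
      (\<exists>E \<Phi> Y. finite E \<and> E \<subseteq> M \<and> finite \<Phi> \<and> Ball \<Phi> deepening \<and>
        finite (range Y) \<and> \<not> (\<exists>z. (\<forall>i\<in>E. met (matching Y z) i) \<and>
          (\<forall>\<phi>\<in>\<Phi>. met (matching Y z) (\<phi> ` \<Lambda>, G)))))"
proof -
  let ?N = "range nonempty_at"
  let ?P = "{(\<rho> :: bool list, x). prefix \<rho> x}"
  let ?F = "{M. M \<subseteq> I \<and> ?N \<subseteq> M \<and> deepening_closed M \<and> abundant M ?P}"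
  have N: "?N \<in> ?F" using I(2) abundant_nonempty by (auto simp: deepening_closed_def nonempty_at_def)
  have "\<exists>M\<in>?F. \<forall>M'\<in>?F. M \<subseteq> M' \<longrightarrow> M' = M"
  proof (rule subset_Zorn_nonempty)
    show "?F \<noteq> {}" using N by blast
  next
    fix \<C> assume \<C>: "\<C> \<noteq> {}" "subset.chain ?F \<C>"
    then have mem: "\<And>M. M \<in> \<C> \<Longrightarrow> M \<in> ?F" by (auto simp: subset.chain_def)
    have "abundant (\<Union>\<C>) ?P"
      unfolding abundant_def
    proof (intro allI impI, elim conjE)
      fix E Y assume E: "finite E" "E \<subseteq> \<Union>\<C>" and Y: "finite (range (Y :: bool list \<Rightarrow> nat))"
      obtain M where "M \<in> \<C>" "E \<subseteq> M" by (rule finite_subset_Union_chain[OF E \<C>])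
      with mem have "abundant M ?P" by blast
      from abundantD[OF this E(1) \<open>E \<subseteq> M\<close> Y] show "\<exists>z. \<forall>i\<in>E. met (?P \<inter> matching Y z) i" .
    qed
    moreover have "deepening_closed (\<Union>\<C>)"
      using mem unfolding deepening_closed_def by blast
    moreover have "\<Union>\<C> \<subseteq> I" "?N \<subseteq> \<Union>\<C>" using mem \<C>(1) by blast+
    ultimately show "\<Union>\<C> \<in> ?F" by simp
  qed
  then obtain M where "M \<in> ?F" and max: "\<forall>M'\<in>?F. M \<subseteq> M' \<longrightarrow> M' = M" by (rule bexE)
  then have M: "M \<subseteq> I" "?N \<subseteq> M" "deepening_closed M" "abundant M ?P" by simp_all
  show ?thesis
  proof (rule exI[of _ M], intro conjI M allI impI)
    fix \<Lambda> G assume G: "(\<Lambda>, G) \<in> I - M"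
    \<comment> \<open>All deepenings of the omitted property are added, so that the enlarged family
      is again closed under deepening.\<close>
    define J where "J = {(\<phi> ` \<Lambda>, G) |\<phi>. deepening \<phi>}"
    have "(\<Lambda>, G) \<in> J" unfolding J_def deepening_def by (auto intro!: exI[of _ "\<lambda>\<rho>. \<rho>"])
    then have "M \<union> J \<noteq> M" using G by blast
    moreover have "deepening_closed (M \<union> J)"
      unfolding deepening_closed_def
    proof (intro allI impI)
      fix \<phi> \<Lambda>' G' assume \<phi>: "deepening \<phi>" and "(\<Lambda>', G') \<in> M \<union> J"
      then consider "(\<Lambda>', G') \<in> M" | \<psi> where "deepening \<psi>" "\<Lambda>' = \<psi> ` \<Lambda>" "G' = G"
        unfolding J_def by blast
      then show "(\<phi> ` \<Lambda>', G') \<in> M \<union> J"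
      proof cases
        case 1
        then show ?thesis using M(3) \<phi> unfolding deepening_closed_def by blast
      next
        case (2 \<psi>)
        then have "deepening (\<phi> \<circ> \<psi>)"
          using \<phi> unfolding deepening_def comp_def by (meson prefix_order.trans)
        then show ?thesis unfolding J_def using 2 by (auto simp: image_comp)
      qed
    qed
    moreover have "M \<union> J \<subseteq> I"
      using M(1) G I(1) unfolding J_def deepening_closed_def by blast
    moreover have "?N \<subseteq> M \<union> J" using M(2) by blast
    ultimately have "\<not> abundant (M \<union> J) ?P"
      using bspec[OF max, of "M \<union> J"] by (metis (mono_tags, lifting) Un_upper1 mem_Collect_eq)
    from not_abundantD[OF this] obtain E and Y :: "bool list \<Rightarrow> nat" where E: "finite E" "E \<subseteq> M \<union> J"
      and Y: "finite (range Y)" and fail: "\<forall>z. \<exists>i\<in>E. \<not> met (?P \<inter> matching Y z) i"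
      by (elim exE conjE)
    have "\<forall>i\<in>E \<inter> J. \<exists>\<phi>. deepening \<phi> \<and> i = (\<phi> ` \<Lambda>, G)" unfolding J_def by blast
    then obtain p where p: "\<And>i. i \<in> E \<inter> J \<Longrightarrow> deepening (p i) \<and> i = (p i ` \<Lambda>, G)" by metis
    have "?P \<inter> matching Y z = matching Y z" for z by (auto simp: matching_def)
    with fail have fail: "\<And>z. \<exists>i\<in>E. \<not> met (matching Y z) i" by simp
    have "\<not> ((\<forall>i\<in>E \<inter> M. met (matching Y z) i) \<and> (\<forall>\<phi>\<in>p ` (E \<inter> J). met (matching Y z) (\<phi> ` \<Lambda>, G)))" for z
    proof
      assume *: "(\<forall>i\<in>E \<inter> M. met (matching Y z) i) \<and> (\<forall>\<phi>\<in>p ` (E \<inter> J). met (matching Y z) (\<phi> ` \<Lambda>, G))"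
      obtain i where i: "i \<in> E" "\<not> met (matching Y z) i" using fail by (rule bexE)
      with * E(2) have "i \<in> E \<inter> J" by blast
      with * p[OF this] i(2) show False by (metis imageI)
    qed
    then show "\<exists>E \<Phi> Y. finite E \<and> E \<subseteq> M \<and> finite \<Phi> \<and> Ball \<Phi> deepening \<and>
      finite (range Y) \<and> \<not> (\<exists>z. (\<forall>i\<in>E. met (matching Y z) i) \<and>
        (\<forall>\<phi>\<in>\<Phi>. met (matching Y z) (\<phi> ` \<Lambda>, G)))"
      using E(1) Y p by (intro exI[of _ "E \<inter> M"] exI[of _ "p ` (E \<inter> J)"] exI[of _ Y]) auto
  qed
qed

subsection \<open>Coding strings and finite sets of strings\<close>

lemma computable_graph:
  assumes "semidecidable_in A (\<lambda>z. h (pfst z) = psnd z)" shows "computable_in A h"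
proof -
  obtain f where "computable_in A f" "\<And>x. h x = f x"
    using semidecidable_uniformize[OF assms] by blast
  then show ?thesis by presburger
qed

lemma computable_div:
  assumes "computable_in A f" "computable_in A g" shows "computable_in A (\<lambda>x. f x div g x)"
proof -
  have iff: "m div n = q \<longleftrightarrow> n = 0 \<and> q = 0 \<or> q * n \<le> m \<and> m < Suc q * n" for m n q :: nat
  proof (cases "n = 0")
    case False
    have "m div n = q" if "q * n \<le> m" "m < Suc q * n"
      using that by (intro div_nat_eqI) (simp_all add: mult.commute)
    moreover have "m div n * n \<le> m" "m < Suc (m div n) * n"
      using False dividend_less_div_times[of n m] by (auto simp: add.commute)
    ultimately show ?thesis using False by blast
  qed auto
  have "computable_in A (\<lambda>x. pfst x div psnd x)"
    by (rule computable_graph, subst iff)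
      (intro semidecidable_decidable decidable_intros computable_intros)
  from computable_compose[OF this computable_pair[OF assms]] show ?thesis by simp
qed

lemma computable_mod:
  assumes "computable_in A f" "computable_in A g" shows "computable_in A (\<lambda>x. f x mod g x)"
  unfolding minus_div_mult_eq_mod[symmetric]
  by (intro computable_diff computable_mult computable_div assms)

lemma decidable_mem_set_decode:
  assumes "computable_in A f" "computable_in A g"
  shows "decidable_in A (\<lambda>x. f x \<in> set_decode (g x))"
  unfolding set_decode_def mem_Collect_eq odd_iff_mod_2_eq_one
  by (intro decidable_eq computable_mod computable_div computable_power computable_const assms)

lemma mem_set_decode_less: "m \<in> set_decode c \<Longrightarrow> m < c"
proof -
  assume "m \<in> set_decode c"
  then have "c div 2 ^ m \<noteq> 0" by (metis dvd_0_right mem_Collect_eq set_decode_def)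
  then have "2 ^ m \<le> c" by (simp add: div_eq_0_iff)
  then show "m < c" using less_exp[of m] by linarith
qed

lemma set_encode_less: "A \<subseteq> {..<n} \<Longrightarrow> set_encode A < 2 ^ n"
proof -
  assume "A \<subseteq> {..<n}"
  then have "set_encode A \<le> (\<Sum>i<n. 2 ^ i)"
    unfolding set_encode_def by (intro sum_mono2) auto
  also have "\<dots> < 2 ^ n" by (induction n) auto
  finally show ?thesis .
qed

text \<open>In contrast to \<open>seq_nth\<close>, all functions from \<open>n\<close> to
  \<open>b\<close> have codes below \<open>b ^ n\<close>. This makes quantification over colourings
  of finitely many strings a bounded one.\<close>

definition digit :: "nat \<Rightarrow> nat \<Rightarrow> nat \<Rightarrow> nat" where
  "digit b y m = y div b ^ m mod b"

lemma digits_exist: "(\<And>m. m < n \<Longrightarrow> f m < b) \<Longrightarrow> \<exists>y<b ^ n. \<forall>m<n. digit b y m = f m"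
proof (induction n)
  case 0
  show ?case by simp
next
  case (Suc n)
  then obtain y where y: "y < b ^ n" "\<And>m. m < n \<Longrightarrow> digit b y m = f m" by auto
  have f: "f n < b" using Suc.prems by simp
  then have b: "b > 0" by simp
  have "y + f n * b ^ n < b ^ n + f n * b ^ n" using y(1) by simp
  also have "\<dots> = Suc (f n) * b ^ n" by simp
  also have "\<dots> \<le> b * b ^ n" using f by (intro mult_right_mono) auto
  finally have "y + f n * b ^ n < b ^ Suc n" by simp
  moreover have "digit b (y + f n * b ^ n) m = f m" if "m < Suc n" for m
  proof (cases "m = n")
    case True
    then show ?thesis using y(1) f b by (simp add: digit_def)
  next
    case False
    with that have m: "m < n" by simp
    then have "b ^ n = b ^ m * b * b ^ (n - Suc m)"
      by (metis Suc_leI le_add_diff_inverse power_add power_Suc2)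
    then have *: "f n * b ^ n = (f n * b ^ (n - Suc m) * b) * b ^ m" by (simp add: ac_simps)
    have "(y + f n * b ^ n) div b ^ m = f n * b ^ (n - Suc m) * b + y div b ^ m"
      unfolding * by (rule div_mult_self1) (use b in simp)
    then show ?thesis using y(2)[OF m] by (simp add: digit_def)
  qed
  ultimately show ?case by blast
qed

lemma computable_digit:
  "computable_in A f \<Longrightarrow> computable_in A g \<Longrightarrow> computable_in A h \<Longrightarrow>
    computable_in A (\<lambda>x. digit (f x) (g x) (h x))"
  unfolding digit_def by (intro computable_mod computable_div computable_power)

definition str_decode :: "nat \<Rightarrow> bool list" where
  "str_decode = inv str_encode"

lemma str_decode_inverse [simp]: "str_encode (str_decode n) = n"
  unfolding str_decode_def by (simp add: bij_is_surj bij_str_encode surj_f_inv_f)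

lemma str_encode_inverse [simp]: "str_decode (str_encode s) = s"
  unfolding str_decode_def by (simp add: bij_is_inj bij_str_encode)

lemma str_encode_eq_iff [simp]: "str_encode s = str_encode t \<longleftrightarrow> s = t"
  by (metis str_encode_inverse)

text \<open>\<open>Suc (str_encode s)\<close> is the number with binary expansion 1 followed by the
  bits of \<open>s\<close>. Appending \<open>t\<close> shifts it by \<open>length t\<close> places
  and adds the number \<open>r\<close> formed by the bits of \<open>t\<close>.\<close>

lemma str_encode_append:
  "\<exists>r<2 ^ length t. Suc (str_encode (s @ t)) = Suc (str_encode s) * 2 ^ length t + r"
proof (induction t rule: rev_induct)
  case Nil
  show ?case by simp
next
  case (snoc b t)
  then obtain r where "r < 2 ^ length t"
    "Suc (str_encode (s @ t)) = Suc (str_encode s) * 2 ^ length t + r" by blast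
  then show ?case
    using str_encode_snoc[of "s @ t" b]
    by (intro exI[of _ "2 * r + (if b then 1 else 0)"]) (auto simp: algebra_simps)
qed

lemma length_le_str_encode: "length s \<le> str_encode s"
  by (induction s rule: rev_induct) (auto simp: str_encode_snoc)

lemma length_eq_iff_str_encode:
  "length s = n \<longleftrightarrow> 2 ^ n \<le> Suc (str_encode s) \<and> Suc (str_encode s) < 2 ^ Suc n"
proof -
  obtain r where "r < 2 ^ length s" "Suc (str_encode s) = 2 ^ length s + r"
    using str_encode_append[of s "[]"] by (auto simp: str_encode_Nil)
  then have *: "2 ^ length s \<le> Suc (str_encode s)" "Suc (str_encode s) < 2 ^ Suc (length s)" by auto
  have "length s = n" if n: "2 ^ n \<le> Suc (str_encode s)" "Suc (str_encode s) < 2 ^ Suc n"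
  proof -
    have "2 ^ n < (2 :: nat) ^ Suc (length s)" "2 ^ length s < (2 :: nat) ^ Suc n"
      using * n by linarith+
    then have "n < Suc (length s)" "length s < Suc n" by (simp_all only: power_strict_increasing_iff)
    then show ?thesis by simp
  qed
  with * show ?thesis by blast
qed

text \<open>Here \<open>m\<close> is the number of bits by which \<open>t\<close> exceeds
  \<open>s\<close>. The code of \<open>t\<close> bounds it, so the prefix relation becomes
  arithmetic with bounded quantifiers.\<close>

lemma prefix_iff_str_encode:
  "prefix s t \<longleftrightarrow> (\<exists>m<Suc (str_encode t). \<exists>r<2 ^ m.
    Suc (str_encode t) = Suc (str_encode s) * 2 ^ m + r)"
proof
  assume "prefix s t"
  then obtain u where u: "t = s @ u" by (auto simp: prefix_def)
  have "length u < Suc (str_encode t)" using length_le_str_encode[of t] u by simp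
  with str_encode_append[of u s] show "\<exists>m<Suc (str_encode t). \<exists>r<2 ^ m.
    Suc (str_encode t) = Suc (str_encode s) * 2 ^ m + r" unfolding u by blast
next
  have "prefix s t" if "Suc (str_encode t) = Suc (str_encode s) * 2 ^ m + r" "r < 2 ^ m" for m r
    using that
  proof (induction m arbitrary: t r)
    case 0
    then show ?case by simp
  next
    case (Suc m)
    show ?case
    proof (cases t rule: rev_cases)
      case Nil
      then have "Suc (str_encode s) * 2 ^ Suc m \<le> 1"
        using Suc.prems(1) by (simp add: str_encode_Nil)
      moreover have "1 * 2 \<le> Suc (str_encode s) * 2 ^ Suc m"
        by (rule mult_le_mono) auto
      ultimately show ?thesis by linarith
    next
      case (snoc u b)
      have "Suc (str_encode t) = 2 * Suc (str_encode u) + (if b then 1 else 0)"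
        by (simp add: snoc str_encode_snoc)
      then have "Suc (str_encode u) = (Suc (str_encode s) * 2 ^ Suc m + r) div 2"
        using Suc.prems(1) by (cases b) simp_all
      also have "\<dots> = Suc (str_encode s) * 2 ^ m + r div 2" by simp
      finally have "prefix s u" using Suc.prems(2) by (intro Suc.IH[of u "r div 2"]) auto
      then show ?thesis by (simp add: snoc)
    qed
  qed
  then show "\<exists>m<Suc (str_encode t). \<exists>r<2 ^ m.
    Suc (str_encode t) = Suc (str_encode s) * 2 ^ m + r \<Longrightarrow> prefix s t" by blast
qed

lemma decidable_prefix:
  assumes "computable_in A f" "computable_in A g"
  shows "decidable_in A (\<lambda>x. prefix (str_decode (f x)) (str_decode (g x)))"
  unfolding prefix_iff_str_encode str_decode_inverse
  by (intro decidable_intros computable_intros computable_compose[OF assms(1)]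
      computable_compose[OF assms(2)])

lemma decidable_length:
  assumes "computable_in A f" "computable_in A g"
  shows "decidable_in A (\<lambda>x. length (str_decode (f x)) = g x)"
  unfolding length_eq_iff_str_encode str_decode_inverse
  by (intro decidable_intros computable_intros assms)

definition fin_decode :: "nat \<Rightarrow> bool list set" where
  "fin_decode c = str_decode ` set_decode c"

lemma finite_fin_decode [simp]: "finite (fin_decode c)"
  by (simp add: fin_decode_def)

lemma fin_decode_inverse [simp]: "fin_encode (fin_decode c) = c"
  by (simp add: fin_encode_def fin_decode_def image_image)

lemma fin_encode_inverse [simp]: "finite F \<Longrightarrow> fin_decode (fin_encode F) = F"
  by (simp add: fin_encode_def fin_decode_def image_image)

lemma mem_fin_decode: "s \<in> fin_decode c \<longleftrightarrow> str_encode s \<in> set_decode c"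
  unfolding fin_decode_def by (metis image_iff str_decode_inverse str_encode_inverse)

lemma ball_fin_decode: "(\<forall>s\<in>fin_decode c. P s) \<longleftrightarrow> (\<forall>m<c. m \<in> set_decode c \<longrightarrow> P (str_decode m))"
  unfolding fin_decode_def using mem_set_decode_less by blast

lemma bex_fin_decode: "(\<exists>s\<in>fin_decode c. P s) \<longleftrightarrow> (\<exists>m<c. m \<in> set_decode c \<and> P (str_decode m))"
  unfolding fin_decode_def using mem_set_decode_less by blast

text \<open>Induction on the fixed bound: a set has at most \<open>Suc n\<close> elements if all of
  them except possibly one, \<open>a\<close>, lie in a set \<open>d\<close> with at most
  \<open>n\<close> elements.\<close>

lemma semidecidable_card:
  assumes "computable_in A f" shows "semidecidable_in A (\<lambda>x. card (fin_decode (f x)) \<le> n)"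
  using assms
proof (induction n arbitrary: f)
  case 0
  have "card (fin_decode (f x)) \<le> 0 \<longleftrightarrow> f x = 0" for x
    by (simp add: fin_decode_def) (metis set_decode_inverse set_decode_zero set_encode_empty)
  then show ?case using 0 by (simp only:) (intro semidecidable_decidable decidable_eq_0)
next
  case (Suc n)
  have iff: "card (fin_decode c) \<le> Suc n \<longleftrightarrow> (\<exists>d. \<exists>a. card (fin_decode d) \<le> n \<and>
      (\<forall>m<c. m \<in> set_decode c \<longrightarrow> m = a \<or> m \<in> set_decode d))" (is "?L \<longleftrightarrow> ?R") for c
  proof
    assume ?L
    obtain s where s: "fin_decode c \<noteq> {} \<Longrightarrow> s \<in> fin_decode c" by blast
    have "card (fin_decode c - {s}) \<le> n" using \<open>?L\<close> s by (cases "fin_decode c = {}") auto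
    moreover have "m = str_encode s \<or> m \<in> set_decode (fin_encode (fin_decode c - {s}))"
      if "m \<in> set_decode c" for m
      using that mem_fin_decode[of "str_decode m" "fin_encode (fin_decode c - {s})"]
        mem_fin_decode[of "str_decode m" c] by auto
    ultimately show ?R
      by (intro exI[of _ "fin_encode (fin_decode c - {s})"] exI[of _ "str_encode s"]) auto
  next
    assume ?R
    then obtain d a where d: "card (fin_decode d) \<le> n"
      and sub: "\<And>m. m \<in> set_decode c \<Longrightarrow> m = a \<or> m \<in> set_decode d"
      using mem_set_decode_less by blast
    have "fin_decode c \<subseteq> insert (str_decode a) (fin_decode d)"
      using sub unfolding fin_decode_def by blast
    then have "card (fin_decode c) \<le> card (insert (str_decode a) (fin_decode d))"
      by (intro card_mono) auto
    also have "\<dots> \<le> Suc n" using d card_insert_le_m1[of "Suc n" "fin_decode d" "str_decode a"] by simp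
    finally show ?L .
  qed
  show ?case unfolding iff
    by (intro semidecidable_ex semidecidable_conj Suc.IH semidecidable_decidable decidable_intros
        decidable_mem_set_decode computable_intros computable_compose[OF Suc.prems])
qed

subsection \<open>Diagonalization against bounded enumerations\<close>

definition semidecidable_family :: "nat set \<Rightarrow> bool list set set \<Rightarrow> bool" where
  "semidecidable_family D G \<longleftrightarrow> (\<forall>g\<in>G. finite g) \<and> semidecidable_in D (\<lambda>c. fin_decode c \<in> G)"

text \<open>\<open>\<Theta> g n w\<close> says that the computation with \<open>g\<close> outputs \<open>w\<close> at \<open>n\<close>. For \<open>V = {}\<close> only the size of
  the output is constrained.\<close>

definition missing ::
  "nat \<Rightarrow> (bool list set \<Rightarrow> nat \<Rightarrow> bool list set \<Rightarrow> bool) \<Rightarrow> nat \<Rightarrow> bool list set \<Rightarrow> bool list set set" where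
  "missing l \<Theta> n V = {g. finite g \<and> (\<exists>w. finite w \<and> card w \<le> l \<and> w \<inter> V = {} \<and> \<Theta> g n w)}"

text \<open>Substitution of computable functions is built in, so no coding of triples is
  required.\<close>

definition semidecidable_relation ::
  "nat set \<Rightarrow> (bool list set \<Rightarrow> nat \<Rightarrow> bool list set \<Rightarrow> bool) \<Rightarrow> bool" where
  "semidecidable_relation D \<Theta> \<longleftrightarrow> (\<forall>f g h. computable_in D f \<longrightarrow> computable_in D g \<longrightarrow> computable_in D h \<longrightarrow>
    semidecidable_in D (\<lambda>x. \<Theta> (fin_decode (f x)) (g x) (fin_decode (h x))))"

lemma semidecidable_missing:
  assumes \<Theta>: "semidecidable_relation D \<Theta>"
    and f: "computable_in D f" and g: "computable_in D g" and h: "computable_in D h"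
  shows "semidecidable_in D (\<lambda>x. fin_decode (f x) \<in> missing l \<Theta> (g x) (fin_decode (h x)))"
proof -
  have iff: "fin_decode c \<in> missing l \<Theta> n (fin_decode v) \<longleftrightarrow> (\<exists>w. card (fin_decode w) \<le> l \<and>
      (\<forall>m<w. m \<in> set_decode w \<longrightarrow> m \<notin> set_decode v) \<and> \<Theta> (fin_decode c) n (fin_decode w))" for c n v
  proof -
    have disj: "fin_decode w \<inter> fin_decode v = {} \<longleftrightarrow> (\<forall>m<w. m \<in> set_decode w \<longrightarrow> m \<notin> set_decode v)" for w
      unfolding disjoint_iff ball_fin_decode[unfolded Ball_def] mem_fin_decode[of _ v] by simp
    show ?thesis unfolding missing_def disj[symmetric]
    proof (intro iffI CollectI conjI; (elim exE conjE CollectE)?)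
      fix w assume "finite w" "card w \<le> l" "w \<inter> fin_decode v = {}" "\<Theta> (fin_decode c) n w"
      then show "\<exists>w. card (fin_decode w) \<le> l \<and> fin_decode w \<inter> fin_decode v = {} \<and>
          \<Theta> (fin_decode c) n (fin_decode w)"
        by (intro exI[of _ "fin_encode w"]) simp
    next
      fix w assume "card (fin_decode w) \<le> l" "fin_decode w \<inter> fin_decode v = {}"
        "\<Theta> (fin_decode c) n (fin_decode w)"
      then show "\<exists>w. finite w \<and> card w \<le> l \<and> w \<inter> fin_decode v = {} \<and> \<Theta> (fin_decode c) n w"
        by (intro exI[of _ "fin_decode w"]) simp
    qed simp
  qed
  have rel: "semidecidable_in D (\<lambda>z. \<Theta> (fin_decode (f (pfst z))) (g (pfst z)) (fin_decode (psnd z)))"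
    by (intro \<Theta>[unfolded semidecidable_relation_def, rule_format] computable_basic
        computable_compose[OF f] computable_compose[OF g])
  show ?thesis unfolding iff
    by (intro semidecidable_ex semidecidable_conj semidecidable_card rel computable_basic)
      (intro semidecidable_decidable decidable_intros decidable_mem_set_decode computable_basic
        computable_compose[OF h])
qed

text \<open>The colourings and selections are coded by the digits of \<open>y\<close> and \<open>z\<close>, and only strings with
  code below \<open>N\<close> are used.\<close>

definition met_below ::
  "nat \<Rightarrow> nat \<Rightarrow> nat \<Rightarrow> nat \<Rightarrow> bool list set \<times> bool list set set \<Rightarrow> bool" where
  "met_below b N y z i \<longleftrightarrow> (\<exists>g\<in>snd i. \<forall>x\<in>g. str_encode x < N \<and>
    (\<exists>\<rho>\<in>fst i. prefix \<rho> x \<and> digit b y (str_encode x) = digit b z (str_encode \<rho>)))"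

lemma semidecidable_met_below:
  assumes N: "computable_in D N" and y: "computable_in D y" and z: "computable_in D z"
    and G: "semidecidable_in D (\<lambda>q. fin_decode (psnd q) \<in> G (pfst q))" "\<And>x g. g \<in> G x \<Longrightarrow> finite g"
    and \<Lambda>: "finite \<Lambda>"
  shows "semidecidable_in D (\<lambda>x. met_below b (N x) (y x) (z x) (\<Lambda>, G x))"
proof -
  obtain c where c: "\<Lambda> = fin_decode c" using fin_encode_inverse[OF \<Lambda>] by metis
  have iff: "met_below b N y z (\<Lambda>, G x) \<longleftrightarrow> (\<exists>g. fin_decode g \<in> G x \<and>
      (\<forall>m<g. m \<in> set_decode g \<longrightarrow> m < N \<and> (\<exists>r<c. r \<in> set_decode c \<and>
        prefix (str_decode r) (str_decode m) \<and> digit b y m = digit b z r)))" for N y z x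
  proof -
    have "met_below b N y z (\<Lambda>, G x) \<longleftrightarrow> (\<exists>g. fin_decode g \<in> G x \<and> (\<forall>x\<in>fin_decode g. str_encode x < N \<and>
        (\<exists>\<rho>\<in>\<Lambda>. prefix \<rho> x \<and> digit b y (str_encode x) = digit b z (str_encode \<rho>))))"
      (is "?L \<longleftrightarrow> ?R")
    proof
      assume ?L
      then obtain g where "g \<in> G x" "\<forall>x\<in>g. str_encode x < N \<and>
          (\<exists>\<rho>\<in>\<Lambda>. prefix \<rho> x \<and> digit b y (str_encode x) = digit b z (str_encode \<rho>))"
        unfolding met_below_def fst_conv snd_conv by (rule bexE)
      with G(2)[of g x] show ?R by (intro exI[of _ "fin_encode g"]) simp
    next
      assume ?R
      then show ?L unfolding met_below_def fst_conv snd_conv by (elim exE conjE) (rule bexI)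
    qed
    then show ?thesis unfolding c ball_fin_decode bex_fin_decode str_decode_inverse .
  qed
  show ?thesis unfolding iff
    by (intro semidecidable_ex semidecidable_conj G(1))
      (intro semidecidable_decidable decidable_intros decidable_mem_set_decode decidable_prefix
        computable_digit computable_basic computable_compose[OF N] computable_compose[OF y] computable_compose[OF z])
qed

text \<open>This is Koenig's lemma for \<open>b\<close>-fold branching: values are fixed position by
  position such that infinitely many of the \<open>y N\<close> agree with all choices made so
  far.\<close>

lemma compactness:
  fixes y :: "nat \<Rightarrow> nat \<Rightarrow> nat"
  assumes "\<And>N m. y N m < b"
  obtains Y where "\<And>m. Y m < b" "\<And>m. \<exists>N\<ge>m. \<forall>j<m. y N j = Y j"
proof -
  let ?P = "\<lambda>m Y. (\<forall>j. Y j < b) \<and> infinite {N. \<forall>j<m. y N j = Y j}"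
  let ?Q = "\<lambda>m Y Y'. \<forall>j<m. Y' j = (Y j :: nat)"
  have "\<exists>Y. \<forall>m. ?P m (Y m) \<and> ?Q m (Y m) (Y (Suc m))"
  proof (rule dependent_nat_choice)
    show "\<exists>Y. ?P 0 Y" using assms by (intro exI[of _ "y 0"]) simp
  next
    fix Y m assume Y: "?P m Y"
    have "{N. \<forall>j<m. y N j = Y j} \<subseteq> (\<Union>c<b. {N. (\<forall>j<m. y N j = Y j) \<and> y N m = c})"
      using assms by auto
    then have "infinite (\<Union>c<b. {N. (\<forall>j<m. y N j = Y j) \<and> y N m = c})"
      using Y finite_subset by blast
    then obtain c where c: "c < b" "infinite {N. (\<forall>j<m. y N j = Y j) \<and> y N m = c}" by auto
    have "{N. \<forall>j<Suc m. y N j = (Y(m := c)) j} = {N. (\<forall>j<m. y N j = Y j) \<and> y N m = c}"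
      by (auto simp: less_Suc_eq)
    then have "?P (Suc m) (Y(m := c))" using Y c by simp
    moreover have "?Q m Y (Y(m := c))" by simp
    ultimately show "\<exists>Y'. ?P (Suc m) Y' \<and> ?Q m Y Y'" by (intro exI[of _ "Y(m := c)"]) (rule conjI)
  qed
  then obtain Y where Y: "\<forall>m. ?P m (Y m) \<and> ?Q m (Y m) (Y (Suc m))" by (rule exE)
  define Z where "Z j = Y (Suc j) j" for j
  have Z: "Y m j = Z j" if "j < m" for m j
  proof -
    from that have "Suc j \<le> m" by simp
    then show ?thesis
    proof (induction m rule: dec_induct)
      case base
      show ?case by (simp add: Z_def)
    next
      case (step m)
      with Y have "Y (Suc m) j = Y m j" by simp
      with step show ?case by simp
    qed
  qed
  show ?thesis
  proof (rule that[of Z])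
    show "Z m < b" for m using Y by (simp add: Z_def)
    fix m
    have "infinite {N. \<forall>j<m. y N j = Y m j}" using Y by simp
    then obtain N where "N > m" "\<forall>j<m. y N j = Y m j"
      unfolding finite_nat_set_iff_bounded_le by (auto simp: not_le)
    then show "\<exists>N\<ge>m. \<forall>j<m. y N j = Z j" using Z by (intro exI[of _ N]) simp
  qed
qed

text \<open>The bound \<open>N\<close> serves semidecidability: for each \<open>N\<close> only
  finitely many colourings \<open>y\<close> have to be examined, and selections can be searched for.
  The next two lemmas relate this to arbitrary colourings with values below
  \<open>b\<close>.\<close>

definition unavoidable ::
  "nat \<Rightarrow> (bool list set \<times> bool list set set) set \<Rightarrow> bool" where
  "unavoidable b K \<longleftrightarrow> (\<exists>N. \<forall>y<b ^ N. \<exists>z. \<forall>i\<in>K. met_below b N y z i)"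

lemma unavoidableD:
  assumes "unavoidable b K" and Y: "\<And>x. Y x < b"
  shows "\<exists>z. \<forall>i\<in>K. met (matching Y z) i"
proof -
  obtain N where N: "\<And>y. y < b ^ N \<Longrightarrow> \<exists>z. \<forall>i\<in>K. met_below b N y z i"
    using assms(1) unfolding unavoidable_def by blast
  obtain y where y: "y < b ^ N" "\<And>m. m < N \<Longrightarrow> digit b y m = Y (str_decode m)"
    using digits_exist[of N "\<lambda>m. Y (str_decode m)" b] Y by blast
  obtain z where z: "\<And>i. i \<in> K \<Longrightarrow> met_below b N y z i" using N[OF y(1)] by blast
  have "met (matching Y (\<lambda>\<rho>. digit b z (str_encode \<rho>))) i" if i: "i \<in> K" for i
  proof -
    obtain g where g: "g \<in> snd i" "\<forall>x\<in>g. str_encode x < N \<and>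
        (\<exists>\<rho>\<in>fst i. prefix \<rho> x \<and> digit b y (str_encode x) = digit b z (str_encode \<rho>))"
      using z[OF i] unfolding met_below_def by (rule bexE)
    have "\<exists>\<rho>\<in>fst i. (\<rho>, x) \<in> matching Y (\<lambda>\<rho>. digit b z (str_encode \<rho>))" if "x \<in> g" for x
      using bspec[OF g(2) that] y(2)[of "str_encode x"] by (auto simp: matching_def)
    with g(1) show ?thesis unfolding met_def by (intro bexI[of _ g]) simp_all
  qed
  then show ?thesis by blast
qed

text \<open>For each \<open>N\<close> some colouring defeats all selections; let \<open>Y\<close> be
  a limit of these by compactness. A selection for \<open>Y\<close> involves finitely many strings,
  hence would already succeed against \<open>y N\<close> for a large \<open>N\<close> at which
  \<open>y N\<close> agrees with \<open>Y\<close> on them.\<close>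

lemma not_unavoidableD:
  assumes "\<not> unavoidable b K" and K: "finite K" "\<forall>i\<in>K. finite (fst i) \<and> (\<forall>g\<in>snd i. finite g)"
    and b: "b > 0"
  shows "\<exists>Y. (\<forall>x. Y x < b) \<and> \<not> (\<exists>z. \<forall>i\<in>K. met (matching Y z) i)"
proof -
  obtain y where y: "\<And>N z. \<exists>i\<in>K. \<not> met_below b N (y N) z i"
    using assms(1) unfolding unavoidable_def by metis
  obtain Y where Y: "\<And>m. Y m < b" "\<And>m. \<exists>N\<ge>m. \<forall>j<m. digit b (y N) j = Y j"
    using compactness[of "\<lambda>N j. digit b (y N) j" b] b by (auto simp: digit_def)
  show ?thesis
  proof (intro exI[of _ "\<lambda>x. Y (str_encode x)"] conjI)
    show "\<forall>x. Y (str_encode x) < b" using Y by simp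
    show "\<not> (\<exists>z. \<forall>i\<in>K. met (matching (\<lambda>x. Y (str_encode x)) z) i)"
    proof
      assume "\<exists>z. \<forall>i\<in>K. met (matching (\<lambda>x. Y (str_encode x)) z) i"
      then obtain z where z: "\<forall>i\<in>K. met (matching (\<lambda>x. Y (str_encode x)) z) i" by (rule exE)
      then have "\<forall>i\<in>K. \<exists>g. g \<in> snd i \<and> (\<forall>x\<in>g. \<exists>\<rho>\<in>fst i. prefix \<rho> x \<and> Y (str_encode x) = z \<rho>)"
        unfolding met_def matching_def by auto
      then obtain g where g: "\<And>i. i \<in> K \<Longrightarrow> g i \<in> snd i"
        "\<And>i x. i \<in> K \<Longrightarrow> x \<in> g i \<Longrightarrow> \<exists>\<rho>\<in>fst i. prefix \<rho> x \<and> Y (str_encode x) = z \<rho>" by metis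
      have "finite (str_encode ` (\<Union>i\<in>K. g i \<union> fst i))" using K g(1) by auto
      then obtain m where m: "\<And>i x. i \<in> K \<Longrightarrow> x \<in> g i \<Longrightarrow> str_encode x < m"
        "\<And>i \<rho>. i \<in> K \<Longrightarrow> \<rho> \<in> fst i \<Longrightarrow> str_encode \<rho> < m"
        unfolding finite_nat_set_iff_bounded by auto
      obtain N where N: "N \<ge> m" "\<And>j. j < m \<Longrightarrow> digit b (y N) j = Y j" using Y(2) by blast
      \<comment> \<open>Digits must be below \<open>b\<close>. Replacing larger values by 0 does no
        harm, because the selected values that are used are colours of \<open>Y\<close>.\<close>
      define z' where "z' j = (if z (str_decode j) < b then z (str_decode j) else 0)" for j
      have "z' j < b" for j using b by (simp add: z'_def)
      then obtain v where "\<forall>j<m. digit b v j = z' j" using digits_exist[of m z' b] by auto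
      then have v: "digit b v j = z' j" if "j < m" for j using that by simp
      have "met_below b N (y N) v i" if i: "i \<in> K" for i
        unfolding met_below_def
      proof (intro bexI[of _ "g i"] ballI conjI)
        fix x assume x: "x \<in> g i"
        then show "str_encode x < N" using m(1)[OF i] N(1) by fastforce
        obtain \<rho> where \<rho>: "\<rho> \<in> fst i" "prefix \<rho> x" "Y (str_encode x) = z \<rho>"
          using g(2)[OF i x] by blast
        moreover have "digit b (y N) (str_encode x) = digit b v (str_encode \<rho>)"
          using N(2)[OF m(1)[OF i x]] v[OF m(2)[OF i \<rho>(1)]] \<rho>(3) Y(1)[of "str_encode x"] by (simp add: z'_def)
        ultimately show "\<exists>\<rho>\<in>fst i. prefix \<rho> x \<and>
            digit b (y N) (str_encode x) = digit b v (str_encode \<rho>)" by blast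
      qed (rule g(1)[OF i])
      with y[of N v] show False by blast
    qed
  qed
qed

text \<open>One selection has to serve all requirements in \<open>R\<close> simultaneously. The
  assumption \<open>large\<close> provides outputs of bounded size for each \<open>n\<close>; the
  proof shows that a colouring \<open>Y\<close> without the desired selection would make
  \<open>S\<close> computably enumerable with a bound.\<close>

lemma diagonalize:
  fixes \<Lambda> :: "'r \<Rightarrow> bool list set" and l :: "'r \<Rightarrow> nat" and Y :: "bool list \<Rightarrow> nat"
  assumes S: "\<not> computes_bounded_enumeration D S"
    and E: "finite E" "\<And>i. i \<in> E \<Longrightarrow> finite (fst i) \<and> semidecidable_family D (snd i)"
    and R: "finite R" "\<And>r. r \<in> R \<Longrightarrow> finite (\<Lambda> r) \<and> semidecidable_relation D (\<Theta> r)"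
    and large: "\<And>n Y. finite (range (Y :: bool list \<Rightarrow> nat)) \<Longrightarrow> \<exists>z. (\<forall>i\<in>E. met (matching Y z) i) \<and>
      (\<forall>r\<in>R. met (matching Y z) (\<Lambda> r, missing (l r) (\<Theta> r) n {}))"
    and Y: "finite (range Y)"
  shows "\<exists>z. (\<forall>i\<in>E. met (matching Y z) i) \<and>
    (\<forall>r\<in>R. met (matching Y z) (\<Lambda> r, \<Union>n. missing (l r) (\<Theta> r) n (S \<inter> {s. length s = n})))"
proof (rule ccontr)
  assume bad: "\<not> ?thesis"
  obtain b where b: "\<And>x. Y x < b"
    using Y unfolding finite_nat_set_iff_bounded by auto
  then have "b > 0" by (metis gr0I not_less0)
  define K where "K n V = E \<union> (\<lambda>r. (\<Lambda> r, missing (l r) (\<Theta> r) n V)) ` R" for n V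
  have K: "finite (K n V)" "\<forall>i\<in>K n V. finite (fst i) \<and> (\<forall>g\<in>snd i. finite g)" for n V
    using E R by (auto simp: K_def semidecidable_family_def missing_def)
  \<comment> \<open>The supposed counterexample \<open>Y\<close> shows that the level sets of
    \<open>S\<close> are never found to be unavoidable.\<close>
  have true: "\<not> unavoidable b (K n (S \<inter> {s. length s = n}))" for n
  proof
    assume "unavoidable b (K n (S \<inter> {s. length s = n}))"
    from unavoidableD[OF this b] obtain z where
      z: "\<forall>i\<in>K n (S \<inter> {s. length s = n}). met (matching Y z) i" by (rule exE)
    have "met (matching Y z) (\<Lambda> r, \<Union>n. missing (l r) (\<Theta> r) n (S \<inter> {s. length s = n}))" if "r \<in> R" for r
    proof -
      have "met (matching Y z) (\<Lambda> r, missing (l r) (\<Theta> r) n (S \<inter> {s. length s = n}))"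
        using z that by (simp add: K_def)
      then obtain g where "g \<in> missing (l r) (\<Theta> r) n (S \<inter> {s. length s = n})"
        "\<forall>x\<in>g. \<exists>\<rho>\<in>\<Lambda> r. (\<rho>, x) \<in> matching Y z" unfolding met_def by auto
      then show ?thesis unfolding met_def by (intro bexI[of _ g]) auto
    qed
    moreover have "met (matching Y z) i" if "i \<in> E" for i using z that by (simp add: K_def)
    ultimately show False by - (rule notE[OF bad], intro exI[of _ z] conjI ballI)
  qed
  \<comment> \<open>The outputs of all requirements will be united, so their bounds are added
    up.\<close>
  define L where "L = (\<Sum>r\<in>R. l r)"
  define Q where "Q n w \<longleftrightarrow> (\<exists>V. V \<subseteq> {s. length s = n} \<and> w \<inter> V = {} \<and> \<not> unavoidable b (K n V))" for n w
  \<comment> \<open>Otherwise each level has a set \<open>w\<close> of size at most \<open>L\<close>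
    that meets every avoidable \<open>V\<close>, in particular the level set of \<open>S\<close> by
    \<open>true\<close>. Being such a \<open>w\<close> is semidecidable in \<open>D\<close>, so a
    search would enumerate \<open>S\<close>.\<close>
  have "\<exists>n. \<forall>w. finite w \<and> card w \<le> L \<longrightarrow> Q n w"
  proof (rule ccontr)
    assume "\<not> ?thesis"
    then have hit: "\<And>n. \<exists>w. finite w \<and> card w \<le> L \<and> \<not> Q n w" by blast
    \<comment> \<open>Strings of length \<open>n\<close> have codes below \<open>2 ^ Suc n\<close>,
      so sets of them have codes below \<open>2 ^ 2 ^ Suc n\<close>. This bounds the quantifier over
      \<open>V\<close>.\<close>
    define P where "P n c \<longleftrightarrow> card (fin_decode c) \<le> L \<and> (\<forall>v<2 ^ 2 ^ Suc n.
        (\<exists>m<v. m \<in> set_decode v \<and> length (str_decode m) \<noteq> n) \<or>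
        (\<exists>m<c. m \<in> set_decode c \<and> m \<in> set_decode v) \<or> unavoidable b (K n (fin_decode v)))" for n c
    have P: "P n c \<longleftrightarrow> card (fin_decode c) \<le> L \<and> \<not> Q n (fin_decode c)" for n c
    proof -
      have A: "(\<exists>m<v. m \<in> set_decode v \<and> length (str_decode m) \<noteq> n) \<longleftrightarrow> \<not> fin_decode v \<subseteq> {s. length s = n}" for v
        using ball_fin_decode[of v "\<lambda>s. length s = n"] by auto
      have B: "(\<exists>m<c. m \<in> set_decode c \<and> m \<in> set_decode v) \<longleftrightarrow> fin_decode c \<inter> fin_decode v \<noteq> {}" for v
        using bex_fin_decode[of c "\<lambda>s. s \<in> fin_decode v"] by (auto simp: mem_fin_decode)
      have C: "\<exists>v<2 ^ 2 ^ Suc n. V = fin_decode v" if "V \<subseteq> {s. length s = n}" for V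
      proof (intro exI conjI)
        have "finite V" using that finite_lists_length_eq[of "UNIV :: bool set" n]
          by (auto intro: finite_subset)
        then show "V = fin_decode (fin_encode V)" by simp
        have "str_encode ` V \<subseteq> {..<2 ^ Suc n}"
        proof
          fix m assume "m \<in> str_encode ` V"
          then obtain s where s: "m = str_encode s" and "s \<in> V" by (rule imageE)
          then have "length s = n" using that by blast
          then have "Suc (str_encode s) < 2 ^ Suc n" using length_eq_iff_str_encode[of s n] by blast
          then show "m \<in> {..<2 ^ Suc n}" using s(1) by simp
        qed
        then show "fin_encode V < 2 ^ 2 ^ Suc n" unfolding fin_encode_def by (rule set_encode_less)
      qed
      have "(\<forall>v<2 ^ 2 ^ Suc n. \<not> fin_decode v \<subseteq> {s. length s = n} \<or> fin_decode c \<inter> fin_decode v \<noteq> {} \<or>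
          unavoidable b (K n (fin_decode v))) \<longleftrightarrow> \<not> Q n (fin_decode c)" (is "?all \<longleftrightarrow> _")
      proof (intro iffI notI allI impI)
        assume ?all and "Q n (fin_decode c)"
        then obtain V where V: "V \<subseteq> {s. length s = n}" "fin_decode c \<inter> V = {}" "\<not> unavoidable b (K n V)"
          unfolding Q_def by (elim exE conjE)
        obtain v where "v < 2 ^ 2 ^ Suc n" "V = fin_decode v" using C[OF V(1)] by (elim exE conjE)
        with \<open>?all\<close> V show False by simp
      next
        fix v assume "\<not> Q n (fin_decode c)"
        then show "\<not> fin_decode v \<subseteq> {s. length s = n} \<or> fin_decode c \<inter> fin_decode v \<noteq> {} \<or>
          unavoidable b (K n (fin_decode v))" unfolding Q_def by simp
      qed
      then show ?thesis unfolding P_def A B by simp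
    qed
    have unav: "unavoidable b (K n (fin_decode v)) \<longleftrightarrow> (\<exists>N. \<forall>y<b ^ N. \<exists>z. (\<forall>i\<in>E. met_below b N y z i) \<and>
        (\<forall>r\<in>R. met_below b N y z (\<Lambda> r, missing (l r) (\<Theta> r) n (fin_decode v))))" for n v
      unfolding unavoidable_def K_def by (simp add: ball_Un)
    have met_E: "semidecidable_in D (\<lambda>x. met_below b (N x) (y x) (z x) i)"
      if "i \<in> E" "computable_in D N" "computable_in D y" "computable_in D z" for N y z i
    proof -
      have i: "\<And>g. g \<in> snd i \<Longrightarrow> finite g" "semidecidable_in D (\<lambda>c. fin_decode c \<in> snd i)"
        using E(2)[OF that(1)] unfolding semidecidable_family_def by blast+
      have "semidecidable_in D (\<lambda>q. fin_decode (psnd q) \<in> snd i)"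
        by (rule semidecidable_compose[OF i(2)]) (intro computable_basic)
      from semidecidable_met_below[OF that(2-4) this i(1), of "fst i" b] E(2)[OF that(1)]
      show ?thesis by simp
    qed
    have met_R: "semidecidable_in D (\<lambda>x. met_below b (N x) (y x) (z x)
        (\<Lambda> r, missing (l r) (\<Theta> r) (n x) (fin_decode (v x))))"
      if "r \<in> R" "computable_in D N" "computable_in D y" "computable_in D z" "computable_in D n"
        "computable_in D v" for N y z n v r
    proof (rule semidecidable_met_below[OF that(2-4)])
      show "semidecidable_in D (\<lambda>q. fin_decode (psnd q) \<in> missing (l r) (\<Theta> r) (n (pfst q)) (fin_decode (v (pfst q))))"
        using R(2)[OF that(1)]
        by (intro semidecidable_missing computable_basic computable_compose[OF that(5)]
            computable_compose[OF that(6)]) simp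
    qed (use R(2)[OF that(1)] in \<open>auto simp: missing_def\<close>)
    have "semidecidable_in D (\<lambda>q. P (pfst q) (psnd q))"
      unfolding P_def unav
      by (intro semidecidable_conj semidecidable_card semidecidable_ball semidecidable_disj
          semidecidable_ex semidecidable_finite_ball E(1) R(1) met_E met_R computable_basic
          computable_power; (assumption | intro semidecidable_decidable decidable_intros
          decidable_mem_set_decode decidable_length computable_basic))
    moreover have "\<exists>c. P n c" for n
      unfolding P using hit[of n] by (metis fin_encode_inverse)
    ultimately obtain f where f: "computable_in D f" "\<And>n. P n (f n)"
      using semidecidable_uniformize[of D P] by blast
    have "enumeration L S (\<lambda>n. fin_decode (f n))"
      unfolding enumeration_def
    proof (intro allI conjI)
      fix n
      show "finite (fin_decode (f n))" by simp
      show "card (fin_decode (f n)) \<le> L" using f(2) unfolding P by blast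
      show "fin_decode (f n) \<inter> S \<inter> {s. length s = n} \<noteq> {}"
        using f(2)[of n] true[of n] unfolding P Q_def by (metis Int_assoc inf_le2)
    qed
    moreover have "computable_in D (\<lambda>n. fin_encode (fin_decode (f n)))" using f(1) by simp
    ultimately have "computes_bounded_enumeration D S"
      unfolding computes_bounded_enumeration_def bounded_enumeration_def
      by (intro exI[of _ "\<lambda>n. fin_decode (f n)"] conjI exI[of _ L])
    with S show False by (rule notE)
  qed
  then obtain n where n: "\<And>w. finite w \<Longrightarrow> card w \<le> L \<Longrightarrow> Q n w" by blast
  define \<V> where "\<V> = {V. V \<subseteq> {s. length s = n} \<and> \<not> unavoidable b (K n V)}"
  have "finite {s :: bool list. length s = n}"
    using finite_lists_length_eq[of "UNIV :: bool set" n] by simp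
  then have "finite \<V>" unfolding \<V>_def by simp
  have "\<exists>Y. (\<forall>x. Y x < b) \<and> \<not> (\<exists>z. \<forall>i\<in>K n V. met (matching Y z) i)" if "V \<in> \<V>" for V
  proof -
    have "\<not> unavoidable b (K n V)" using that by (simp add: \<V>_def)
    from not_unavoidableD[OF this K \<open>b > 0\<close>] show ?thesis .
  qed
  \<comment> \<open>Each avoidable \<open>V\<close> has its own preventing colouring
    \<open>W V\<close>. A selection for a common refinement induces a selection for each of
    them.\<close>
  then obtain W where W: "\<And>V x. V \<in> \<V> \<Longrightarrow> W V x < b"
    "\<And>V z. V \<in> \<V> \<Longrightarrow> \<exists>i\<in>K n V. \<not> met (matching (W V) z) i" by metis
  have "finite (range (W V))" if "V \<in> \<V>" for V
    by (rule finite_subset[of _ "{..<b}"]) (use W(1)[OF that] in auto)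
  then have "\<forall>V\<in>\<V>. finite (range (W V))" by simp
  from common_refinement[OF \<open>finite \<V>\<close> this] obtain U :: "bool list \<Rightarrow> nat" and f where
    U: "finite (range U)" and f: "\<forall>V\<in>\<V>. \<forall>x. W V x = f V (U x)" by blast
  from large[OF U, of n] obtain z where zE: "\<forall>i\<in>E. met (matching U z) i"
    and zR: "\<forall>r\<in>R. met (matching U z) (\<Lambda> r, missing (l r) (\<Theta> r) n {})" by (elim exE conjE)
  have "\<forall>r\<in>R. \<exists>g w. finite g \<and> finite w \<and> card w \<le> l r \<and> \<Theta> r g n w \<and>
      (\<forall>x\<in>g. \<exists>\<rho>\<in>\<Lambda> r. (\<rho>, x) \<in> matching U z)"
  proof
    fix r assume "r \<in> R"
    with zR have "met (matching U z) (\<Lambda> r, missing (l r) (\<Theta> r) n {})" by blast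
    then obtain g where "g \<in> missing (l r) (\<Theta> r) n {}"
      and "\<forall>x\<in>g. \<exists>\<rho>\<in>\<Lambda> r. (\<rho>, x) \<in> matching U z"
      unfolding met_def fst_conv snd_conv by (rule bexE)
    then show "\<exists>g w. finite g \<and> finite w \<and> card w \<le> l r \<and> \<Theta> r g n w \<and>
        (\<forall>x\<in>g. \<exists>\<rho>\<in>\<Lambda> r. (\<rho>, x) \<in> matching U z)"
      unfolding missing_def by auto
  qed
  then obtain g w where g: "\<And>r. r \<in> R \<Longrightarrow> finite (g r)" "\<And>r. r \<in> R \<Longrightarrow> \<Theta> r (g r) n (w r)"
    "\<And>r. r \<in> R \<Longrightarrow> \<forall>x\<in>g r. \<exists>\<rho>\<in>\<Lambda> r. (\<rho>, x) \<in> matching U z"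
    and w: "\<And>r. r \<in> R \<Longrightarrow> finite (w r)" "\<And>r. r \<in> R \<Longrightarrow> card (w r) \<le> l r" by metis
  \<comment> \<open>The union of the outputs is small enough to miss some avoidable
    \<open>V\<close>. Each single output then misses this \<open>V\<close>, so all of
    \<open>K n V\<close> is met despite \<open>W V\<close>.\<close>
  have "card (\<Union>r\<in>R. w r) \<le> (\<Sum>r\<in>R. card (w r))" by (rule card_UN_le[OF R(1)])
  also have "\<dots> \<le> L" unfolding L_def using w(2) by (rule sum_mono)
  finally obtain V where V: "V \<in> \<V>" "(\<Union>r\<in>R. w r) \<inter> V = {}"
    using n[of "\<Union>r\<in>R. w r"] R(1) w(1) unfolding \<V>_def Q_def by auto
  have sub: "matching U z \<subseteq> matching (W V) (f V \<circ> z)"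
    using f V(1) by (auto simp: matching_def)
  have "met (matching (W V) (f V \<circ> z)) (\<Lambda> r, missing (l r) (\<Theta> r) n V)" if r: "r \<in> R" for r
  proof -
    have "w r \<inter> V = {}" using V(2) r by blast
    then have "g r \<in> missing (l r) (\<Theta> r) n V"
      unfolding missing_def using g(1,2)[OF r] w[OF r] by blast
    then show ?thesis unfolding met_def using g(3)[OF r] sub by (intro bexI[of _ "g r"]) auto
  qed
  then have "\<forall>i\<in>K n V. met (matching (W V) (f V \<circ> z)) i"
    unfolding K_def using zE met_mono[OF _ sub] by auto
  with W(2)[OF V(1), of "f V \<circ> z"] show False by blast
qed

text \<open>The witness \<open>w\<close> is the longest common prefix of \<open>x\<close> and
  \<open>y\<close>. In this form all quantifiers over strings range over \<open>F\<close>, so the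
  property is decidable for finite sets.\<close>

definition meet_closed :: "bool list set \<Rightarrow> bool" where
  "meet_closed F \<longleftrightarrow> (\<forall>x\<in>F. \<forall>y\<in>F. \<exists>w\<in>F. prefix w x \<and> prefix w y \<and>
    (w = x \<or> w = y \<or> (\<exists>b. prefix (w @ [b]) x \<and> prefix (w @ [\<not> b]) y)))"

text \<open>Meet-closedness is required here because only meet-closed extensions of \<open>F\<close>
  lead to a condition again.\<close>

definition extension_output ::
  "nat set \<Rightarrow> code \<Rightarrow> bool list set \<Rightarrow> bool list set \<Rightarrow> nat \<Rightarrow> bool list set \<Rightarrow> bool" where
  "extension_output D e F g n w \<longleftrightarrow>
    meet_closed (F \<union> g) \<and> eval (D \<oplus>\<^sub>T (str_encode ` (F \<union> g))) e n (fin_encode w)"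

lemma str_decode_snoc:
  "str_decode (2 * m + 1) = str_decode m @ [False]" "str_decode (2 * m + 2) = str_decode m @ [True]"
  using str_encode_snoc[of "str_decode m" False] str_encode_snoc[of "str_decode m" True]
  by (metis str_decode_inverse str_encode_inverse)+

lemma decidable_meet_closed:
  assumes "finite F" "computable_in A f"
  shows "decidable_in A (\<lambda>x. meet_closed (F \<union> fin_decode (f x)))"
proof -
  obtain k where k: "F = fin_decode k" using fin_encode_inverse[OF assms(1)] by metis
  define In where "In c m \<longleftrightarrow> m \<in> set_decode k \<or> m \<in> set_decode c" for c m
  have all: "(\<forall>s\<in>F \<union> fin_decode c. P s) \<longleftrightarrow> (\<forall>m<k + c. In c m \<longrightarrow> P (str_decode m))" for P c
    unfolding k ball_Un ball_fin_decode In_def by (auto dest: mem_set_decode_less)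
  have ex: "(\<exists>s\<in>F \<union> fin_decode c. P s) \<longleftrightarrow> (\<exists>m<k + c. In c m \<and> P (str_decode m))" for P c
    using all[of c "\<lambda>s. \<not> P s"] by blast
  have bool: "(\<exists>b. Q b) \<longleftrightarrow> Q False \<or> Q True" for Q by (metis (full_types))
  have eq: "str_decode m = str_decode n \<longleftrightarrow> m = n" for m n by (metis str_decode_inverse)
  show ?thesis
    unfolding meet_closed_def all ex bool str_decode_snoc[symmetric] not_True_eq_False not_False_eq_True eq
      In_def
    by (intro decidable_intros decidable_mem_set_decode decidable_prefix computable_add computable_mult
        computable_basic computable_compose[OF assms(2)])
qed

text \<open>The finite part of the oracle can be read off from the code of \<open>g\<close>, so
  membership in the oracle is decidable in \<open>D\<close> uniformly and
  \<open>semidecidable_eval\<close> applies.\<close>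

lemma semidecidable_extension_output:
  assumes F: "finite F" shows "semidecidable_relation D (extension_output D e F)"
  unfolding semidecidable_relation_def
proof (intro allI impI)
  fix f g h assume f: "computable_in D f" and g: "computable_in D g" and h: "computable_in D h"
  obtain k where k: "F = fin_decode k" using fin_encode_inverse[OF F] by metis
  define B where "B x m \<longleftrightarrow> (\<exists>j<Suc m. m = 2 * j \<and> j \<in> D) \<or>
    (\<exists>j<Suc m. m = 2 * j + 1 \<and> (j \<in> set_decode k \<or> j \<in> set_decode (f x)))" for x m
  have enc: "str_encode ` (F \<union> fin_decode c) = set_decode k \<union> set_decode c" for c
    unfolding k fin_decode_def by (simp add: image_Un image_image)
  have B: "D \<oplus>\<^sub>T (str_encode ` (F \<union> fin_decode (f x))) = {m. B x m}" for x
    unfolding enc join_def B_def by auto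
  have "decidable_in D (\<lambda>z. B (pfst z) (psnd z))"
    unfolding B_def
    by (intro decidable_intros decidable_oracle decidable_mem_set_decode computable_add computable_mult
        computable_basic computable_compose[OF f])
  from semidecidable_eval[OF this g h]
  have "semidecidable_in D (\<lambda>x. eval (D \<oplus>\<^sub>T (str_encode ` (F \<union> fin_decode (f x)))) e (g x) (h x))"
    unfolding B .
  then show "semidecidable_in D (\<lambda>x. extension_output D e F (fin_decode (f x)) (g x) (fin_decode (h x)))"
    unfolding extension_output_def fin_decode_inverse
    by (intro semidecidable_conj semidecidable_decidable[OF decidable_meet_closed[OF F f]])
qed

text \<open>The first alternative supplies, in every abundant pool with slots \<Lambda>, an
  extension whose output misses \<open>S\<close>. In the second, a colouring excludes all outputs of
  size at most \<open>l\<close> at one fixed \<open>n\<close>, so that the pool can be thinned out.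
  \<open>settle\<close> acts accordingly.\<close>

definition decisive ::
  "(bool list set \<times> bool list set set) set \<Rightarrow> nat set \<Rightarrow> bool list set \<Rightarrow> bool" where
  "decisive M D S \<longleftrightarrow> (\<forall>F \<Lambda> e l. finite F \<longrightarrow> finite \<Lambda> \<longrightarrow>
      (\<Lambda>, \<Union>n. missing l (extension_output D e F) n (S \<inter> {s. length s = n})) \<in> M \<or>
      (\<exists>n E \<Phi> Y. finite E \<and> E \<subseteq> M \<and> Ball \<Phi> deepening \<and> finite (range Y) \<and>
        \<not> (\<exists>z. (\<forall>i\<in>E. met (matching Y z) i) \<and>
          (\<forall>\<phi>\<in>\<Phi>. met (matching Y z) (\<phi> ` \<Lambda>, missing l (extension_output D e F) n {})))))"

text \<open>Requirements all of whose instances without \<open>S\<close> belong to the maximal family \<open>M\<^sub>0\<close> can be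
  diagonalized against \<open>S\<close>, so adding these diagonalizations keeps the family abundant.\<close>

lemma decisive_family:
  assumes S: "\<not> computes_bounded_enumeration D S"
  shows "\<exists>M. (\<forall>i\<in>M. finite (fst i)) \<and> deepening_closed M \<and> range nonempty_at \<subseteq> M \<and>
    abundant M {(\<rho>, x). prefix \<rho> x} \<and> decisive M D S"
proof -
  \<comment> \<open>Only properties that are semidecidable in \<open>D\<close> compete for
    maximality, as \<open>diagonalize\<close> demands this of its family \<open>E\<close>.\<close>
  define I where "I = {i :: bool list set \<times> _. finite (fst i) \<and> semidecidable_family D (snd i)}"
  define V where "V r n = (case r of (F, \<Lambda> :: bool list set, e, l) \<Rightarrow> missing l (extension_output D e F) n {})" for r n
  define W where "W r = (case r of (F, \<Lambda> :: bool list set, e, l) \<Rightarrow>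
    \<Union>n. missing l (extension_output D e F) n (S \<inter> {s. length s = n}))" for r
  have "deepening_closed I" by (auto simp: I_def deepening_closed_def)
  moreover have "range nonempty_at \<subseteq> I"
  proof -
    have "set_decode c = {} \<longleftrightarrow> c = 0" for c
      by (metis set_decode_inverse set_decode_zero set_encode_empty)
    then have "fin_decode c \<in> {g. finite g \<and> g \<noteq> {}} \<longleftrightarrow> \<not> c = 0" for c
      by (simp add: fin_decode_def)
    then have "semidecidable_in D (\<lambda>c. fin_decode c \<in> {g. finite g \<and> g \<noteq> {}})"
      by (simp only:) (intro semidecidable_decidable decidable_not decidable_eq_0 computable_id)
    then show ?thesis by (auto simp: I_def nonempty_at_def semidecidable_family_def)
  qed
  ultimately have "\<exists>M. M \<subseteq> I \<and> range nonempty_at \<subseteq> M \<and> deepening_closed M \<and>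
    abundant M {(\<rho>, x). prefix \<rho> x} \<and> (\<forall>\<Lambda> G. (\<Lambda>, G) \<in> I - M \<longrightarrow>
      (\<exists>E \<Phi> Y. finite E \<and> E \<subseteq> M \<and> finite \<Phi> \<and> Ball \<Phi> deepening \<and>
        finite (range Y) \<and> \<not> (\<exists>z. (\<forall>i\<in>E. met (matching Y z) i) \<and>
          (\<forall>\<phi>\<in>\<Phi>. met (matching Y z) (\<phi> ` \<Lambda>, G)))))"
    by (rule maximal_family)
  then obtain M0 where M0: "M0 \<subseteq> I" "range nonempty_at \<subseteq> M0" "deepening_closed M0"
      "abundant M0 {(\<rho>, x). prefix \<rho> x}"
    and omit: "\<forall>\<Lambda> G. (\<Lambda>, G) \<in> I - M0 \<longrightarrow> (\<exists>E \<Phi> Y. finite E \<and> E \<subseteq> M0 \<and> finite \<Phi> \<and> Ball \<Phi> deepening \<and>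
      finite (range Y) \<and> \<not> (\<exists>z. (\<forall>i\<in>E. met (matching Y z) i) \<and>
        (\<forall>\<phi>\<in>\<Phi>. met (matching Y z) (\<phi> ` \<Lambda>, G))))"
    by (elim exE conjE)
  define Good where "Good = {(F, \<Lambda>, e, l). finite F \<and> finite \<Lambda> \<and> (\<forall>n. (\<Lambda>, V (F, \<Lambda>, e, l) n) \<in> M0)}"
  define M where "M = M0 \<union> (\<lambda>r. (fst (snd r), W r)) ` Good"
  have "\<forall>i\<in>M. finite (fst i)" using M0(1) by (auto simp: M_def I_def Good_def)
  moreover have "deepening_closed M"
    unfolding deepening_closed_def
  proof (intro allI impI)
    fix \<phi> \<Lambda> G assume \<phi>: "deepening \<phi>" and "(\<Lambda>, G) \<in> M"
    then consider "(\<Lambda>, G) \<in> M0" | r where "r \<in> Good" "\<Lambda> = fst (snd r)" "G = W r"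
      unfolding M_def by auto
    then show "(\<phi> ` \<Lambda>, G) \<in> M"
    proof cases
      case 1
      then show ?thesis using M0(3) \<phi> by (simp add: M_def deepening_closed_def)
    next
      case (2 r)
      obtain F e l where r: "r = (F, \<Lambda>, e, l)" using 2(2) by (cases r) auto
      \<comment> \<open>Moving the roots of a good requirement gives a good requirement, since
        \<open>M0\<close> is closed under deepening; its set \<open>W\<close> is the same, as it
        does not depend on the roots.\<close>
      have "(F, \<phi> ` \<Lambda>, e, l) \<in> Good"
        using 2(1) M0(3) \<phi> by (auto simp: Good_def r V_def deepening_closed_def)
      moreover have "W (F, \<phi> ` \<Lambda>, e, l) = G" using 2(3) by (simp add: W_def r)
      ultimately show ?thesis
        unfolding M_def by (intro UnI2 image_eqI[of _ _ "(F, \<phi> ` \<Lambda>, e, l)"]) simp_all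
    qed
  qed
  moreover have "range nonempty_at \<subseteq> M" using M0(2) by (auto simp: M_def)
  moreover have "abundant M {(\<rho>, x). prefix \<rho> x}"
    unfolding abundant_def
  proof (intro allI impI, elim conjE)
    fix E' and Y :: "bool list \<Rightarrow> nat" assume E': "finite E'" "E' \<subseteq> M" and Y: "finite (range Y)"
    have P: "{(\<rho>, x). prefix \<rho> x} \<inter> matching Y z = matching Y z" for Y z by (auto simp: matching_def)
    obtain R where R: "R \<subseteq> Good" "finite R" "E' - M0 = (\<lambda>r. (fst (snd r), W r)) ` R"
      using finite_subset_image[of "E' - M0" "\<lambda>r. (fst (snd r), W r)" Good] E' unfolding M_def by blast
    define E where "E = E' \<inter> M0"
    have "\<exists>z. (\<forall>i\<in>E. met (matching Y z) i) \<and>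
      (\<forall>r\<in>R. met (matching Y z) (fst (snd r), \<Union>n. missing (snd (snd (snd r)))
        (extension_output D (fst (snd (snd r))) (fst r)) n (S \<inter> {s. length s = n})))"
    proof (rule diagonalize[OF S _ _ R(2) _ _ Y])
      show "finite E" using E'(1) by (simp add: E_def)
      show "finite (fst i) \<and> semidecidable_family D (snd i)" if "i \<in> E" for i
        using that M0(1) by (auto simp: E_def I_def)
      show "finite (fst (snd r)) \<and> semidecidable_relation D (extension_output D (fst (snd (snd r))) (fst r))"
        if "r \<in> R" for r
        using that R(1) semidecidable_extension_output by (auto simp: Good_def)
      fix n and Y :: "bool list \<Rightarrow> nat" assume Y: "finite (range Y)"
      \<comment> \<open>For a fixed \<open>n\<close> the size-only instances of the requirements in
        \<open>R\<close> lie in \<open>M0\<close>, so abundance of \<open>M0\<close> yields the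
        largeness assumption of \<open>diagonalize\<close>.\<close>
      have "E \<union> (\<lambda>r. (fst (snd r), V r n)) ` R \<subseteq> M0" using R(1) by (auto simp: E_def Good_def)
      moreover have "finite (E \<union> (\<lambda>r. (fst (snd r), V r n)) ` R)" using E'(1) R(2) by (simp add: E_def)
      ultimately obtain z where "\<forall>i\<in>E \<union> (\<lambda>r. (fst (snd r), V r n)) ` R. met (matching Y z) i"
        using abundantD[OF M0(4) _ _ Y] unfolding P by meson
      then show "\<exists>z. (\<forall>i\<in>E. met (matching Y z) i) \<and>
        (\<forall>r\<in>R. met (matching Y z) (fst (snd r), missing (snd (snd (snd r)))
          (extension_output D (fst (snd (snd r))) (fst r)) n {}))"
        by (intro exI[of _ z]) (simp add: V_def case_prod_beta)
    qed
    then obtain z where z: "\<forall>i\<in>E. met (matching Y z) i" "\<forall>r\<in>R. met (matching Y z) (fst (snd r), W r)"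
      unfolding W_def case_prod_beta by (elim exE conjE)
    have "met (matching Y z) i" if "i \<in> E'" for i
    proof (cases "i \<in> M0")
      case True
      then show ?thesis using z(1) that by (simp add: E_def)
    next
      case False
      then have "i \<in> (\<lambda>r. (fst (snd r), W r)) ` R" using R(3) that by blast
      then show ?thesis using z(2) by auto
    qed
    then show "\<exists>z. \<forall>i\<in>E'. met ({(\<rho>, x). prefix \<rho> x} \<inter> matching Y z) i"
      unfolding P by (intro exI[of _ z] ballI)
  qed
  moreover have "decisive M D S"
    unfolding decisive_def
  proof (intro allI impI)
    fix F \<Lambda> e l assume F: "finite (F :: bool list set)" and \<Lambda>: "finite (\<Lambda> :: bool list set)"
    show "(\<Lambda>, \<Union>n. missing l (extension_output D e F) n (S \<inter> {s. length s = n})) \<in> M \<or>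
      (\<exists>n E \<Phi> Y. finite E \<and> E \<subseteq> M \<and> Ball \<Phi> deepening \<and> finite (range Y) \<and>
        \<not> (\<exists>z. (\<forall>i\<in>E. met (matching Y z) i) \<and>
          (\<forall>\<phi>\<in>\<Phi>. met (matching Y z) (\<phi> ` \<Lambda>, missing l (extension_output D e F) n {}))))"
    proof (cases "(F, \<Lambda>, e, l) \<in> Good")
      case True
      then have "(\<Lambda>, W (F, \<Lambda>, e, l)) \<in> M"
        unfolding M_def by (intro UnI2 image_eqI[of _ _ "(F, \<Lambda>, e, l)"]) simp_all
      then show ?thesis by (simp add: W_def)
    next
      case False
      then obtain n where n: "(\<Lambda>, missing l (extension_output D e F) n {}) \<notin> M0"
        using F \<Lambda> by (auto simp: Good_def V_def)
      \<comment> \<open>\<open>fin_decode 0\<close> is the empty set, which makes this an instance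
        of the general lemma on \<open>missing\<close>.\<close>
      have "semidecidable_in D (\<lambda>c. fin_decode c \<in> missing l (extension_output D e F) n (fin_decode 0))"
        by (intro semidecidable_missing semidecidable_extension_output F computable_basic)
      then have "(\<Lambda>, missing l (extension_output D e F) n {}) \<in> I - M0"
        using \<Lambda> n by (auto simp: I_def semidecidable_family_def missing_def fin_decode_def)
      from omit[THEN spec, THEN spec, THEN mp, OF this] obtain E \<Phi> Y where E: "finite E" "E \<subseteq> M0"
        and "finite \<Phi>" and *: "Ball \<Phi> deepening" "finite (range Y)"
        "\<not> (\<exists>z. (\<forall>i\<in>E. met (matching Y z) i) \<and>
            (\<forall>\<phi>\<in>\<Phi>. met (matching Y z) (\<phi> ` \<Lambda>, missing l (extension_output D e F) n {})))"
        by (elim exE conjE)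
      from E(2) have "E \<subseteq> M" by (auto simp: M_def)
      with E(1) * show ?thesis
        by (intro disjI2 exI[of _ n] exI[of _ E] exI[of _ \<Phi>] exI[of _ Y] conjI)
    qed
  qed
  ultimately show ?thesis by (intro exI[of _ M] conjI)
qed

subsection \<open>Meet-closed sets as perfect trees\<close>

lemma not_prefix_both: "prefix (w @ [b]) x \<Longrightarrow> prefix (w @ [\<not> b]) x \<Longrightarrow> False"
  by (auto simp: prefix_def)

lemma meet_closedE:
  assumes "meet_closed F" "x \<in> F" "y \<in> F"
  obtains "prefix x y" | "prefix y x"
    | w b where "w \<in> F" "prefix (w @ [b]) x" "prefix (w @ [\<not> b]) y"
proof -
  from bspec[OF bspec[OF assms(1)[unfolded meet_closed_def] assms(2)] assms(3)]
  obtain w where "w \<in> F" "prefix w x \<and> prefix w y \<and>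
    (w = x \<or> w = y \<or> (\<exists>b. prefix (w @ [b]) x \<and> prefix (w @ [\<not> b]) y))" by (rule bexE)
  then show ?thesis using that by auto
qed

text \<open>A shortest member \<open>y\<close> above \<open>p\<close> works: if another member above
  \<open>p\<close> branched off from \<open>y\<close>, the branching node would be a shorter member
  above \<open>p\<close>.\<close>

lemma meet_closed_least:
  assumes T: "meet_closed T" and ex: "\<exists>y\<in>T. prefix p y"
  shows "\<exists>y\<in>T. prefix p y \<and> (\<forall>y'\<in>T. prefix p y' \<longrightarrow> prefix y y')"
proof -
  obtain y0 where "y0 \<in> T \<and> prefix p y0" using ex by blast
  from ex_has_least_nat[of "\<lambda>y. y \<in> T \<and> prefix p y", OF this, of length]
  obtain y where y: "y \<in> T" "prefix p y" and min: "\<And>y'. y' \<in> T \<Longrightarrow> prefix p y' \<Longrightarrow> length y \<le> length y'"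
    by auto
  have "prefix y y'" if y': "y' \<in> T" "prefix p y'" for y'
  proof -
    from T y(1) y'(1) show ?thesis
    proof (cases rule: meet_closedE)
      case 2
      moreover have "length y \<le> length y'" using min y' by simp
      ultimately have "y' = y" by (auto simp: prefix_def)
      then show ?thesis by simp
    next
      case v: (3 v b)
      have "prefix p (v @ [b]) \<or> prefix (v @ [b]) p"
        using y(2) v(2) prefix_same_cases by blast
      moreover have "\<not> prefix (v @ [b]) p"
        using v(3) y'(2) not_prefix_both[of v b y'] prefix_order.trans by blast
      ultimately have "prefix p v" by (metis prefix_order.refl prefix_snoc)
      then have "length y \<le> length v" using min v(1) by simp
      moreover have "length (v @ [b]) \<le> length y" using v(2) by (rule prefix_length_le)
      ultimately show ?thesis by simp
    qed
  qed
  with y show ?thesis by (intro bexI[of _ y] conjI ballI impI)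
qed

text \<open>The isomorphism \<open>h\<close> starts at the least member of \<open>T\<close> and
  sends \<open>s @ [b]\<close> to the least member above \<open>h s @ [b]\<close>. It reflects the
  order because incomparable strings are sent to different sides of a common node.\<close>

lemma meet_closed_infinite_perfect_tree:
  assumes T: "meet_closed T" "T \<noteq> {}" and split: "\<And>w b. w \<in> T \<Longrightarrow> \<exists>y\<in>T. prefix (w @ [b]) y"
  shows "infinite_perfect_tree T"
proof -
  define nx where "nx p = (SOME y. y \<in> T \<and> prefix p y \<and> (\<forall>y'\<in>T. prefix p y' \<longrightarrow> prefix y y'))" for p
  have nx: "nx p \<in> T \<and> prefix p (nx p) \<and> (\<forall>y'\<in>T. prefix p y' \<longrightarrow> prefix (nx p) y')"
    if "\<exists>y\<in>T. prefix p y" for p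
    unfolding nx_def using meet_closed_least[OF T(1) that, unfolded Bex_def] by (rule someI_ex)
  define h where "h s = foldl (\<lambda>y b. nx (y @ [b])) (nx []) s" for s
  have h_snoc: "h (s @ [b]) = nx (h s @ [b])" for s b by (simp add: h_def)
  have root: "h [] \<in> T" "\<And>y. y \<in> T \<Longrightarrow> prefix (h []) y"
    using nx[of "[]"] T(2) by (auto simp: h_def)
  have mem: "h s \<in> T" for s
  proof (induction s rule: rev_induct)
    case Nil
    show ?case by (rule root)
  next
    case (snoc b s)
    then show ?case using nx[OF split[OF snoc]] by (simp add: h_snoc)
  qed
  have step: "prefix (h s @ [b]) (h (s @ [b]))" "\<And>y. y \<in> T \<Longrightarrow> prefix (h s @ [b]) y \<Longrightarrow> prefix (h (s @ [b])) y"
    for s b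
    using nx[OF split[OF mem]] by (simp_all add: h_snoc)
  have mono: "prefix (h s) (h (s @ u))" for s u
  proof (induction u rule: rev_induct)
    case (snoc b u)
    moreover have "prefix (h (s @ u)) (h ((s @ u) @ [b]))"
      using step(1) by (rule append_prefixD)
    ultimately show ?case by (metis append_assoc prefix_order.trans)
  qed simp
  have strict: "prefix (h s @ [b]) (h (s @ b # u))" for s b u
    using mono[of "s @ [b]" u] step(1)[of s b] by (auto intro: prefix_order.trans)
  have refl: "prefix s t" if "prefix (h s) (h t)" for s t
  proof (rule ccontr)
    assume "\<not> prefix s t"
    then consider "strict_prefix t s" | "s \<parallel> t" using prefix_cases[of s t] by blast
    then show False
    proof cases
      case 1
      then obtain b u where "s = t @ b # u" by (rule strict_prefixE')
      then have "prefix (h t @ [b]) (h t)" using strict[of t b u] that prefix_order.trans by blast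
      then show False by (auto dest: prefix_length_le)
    next
      case 2
      from parallel_decomp[OF this] obtain v b s' c t' where "b \<noteq> c" and s: "s = v @ b # s'"
        and t: "t = v @ c # t'" by (elim exE conjE)
      then have c: "c = (\<not> b)" by simp
      have "prefix (h v @ [b]) (h t)"
        using strict[of v b s'] that unfolding s by (rule prefix_order.trans)
      moreover have "prefix (h v @ [\<not> b]) (h t)" using strict[of v c t'] unfolding t c .
      ultimately show False by (rule not_prefix_both)
    qed
  qed
  \<comment> \<open>While \<open>h s\<close> is a proper prefix of \<open>y\<close>, leastness keeps
    the next value of \<open>h\<close> on the way to \<open>y\<close> below \<open>y\<close>, and
    the difference of lengths decreases.\<close>
  have onto: "\<exists>t. h t = y" if "y \<in> T" "prefix (h s) y" for y s
    using that
  proof (induction "length y - length (h s)" arbitrary: s rule: less_induct)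
    case less
    show ?case
    proof (cases "h s = y")
      case False
      with less.prems(2) have "strict_prefix (h s) y" by (simp add: strict_prefix_def)
      then obtain b u where "y = h s @ b # u" by (rule strict_prefixE')
      then have "prefix (h s @ [b]) y" by simp
      with less.prems(1) have *: "prefix (h (s @ [b])) y" by (rule step(2))
      have "length (h s) < length (h (s @ [b]))" using prefix_length_le[OF step(1)[of s b]] by simp
      moreover have "length (h (s @ [b])) \<le> length y" using * by (rule prefix_length_le)
      ultimately show ?thesis using less.hyps[OF _ less.prems(1) *] by simp
    qed blast
  qed
  have "bij_betw h UNIV T"
  proof (rule bij_betwI')
    show "h s = h t \<longleftrightarrow> s = t" for s t using refl[of s t] refl[of t s] prefix_order.antisym by auto
    show "h s \<in> T" for s by (rule mem)
    show "\<exists>s\<in>UNIV. y = h s" if "y \<in> T" for y using onto[OF that root(2)[OF that]] by auto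
  qed
  moreover have "prefix s t \<longleftrightarrow> prefix (h s) (h t)" for s t
  proof
    assume "prefix s t"
    then obtain u where "t = s @ u" by (rule prefixE)
    then show "prefix (h s) (h t)" using mono by simp
  qed (rule refl)
  ultimately show ?thesis unfolding infinite_perfect_tree_def by (intro exI[of _ h] conjI allI)
qed

subsection \<open>The forcing construction\<close>

text \<open>A hole of \<open>F\<close> is a side of a node of \<open>F\<close> on which \<open>F\<close> does not continue. In a condition, each hole
  has a slot \<open>\<nu> \<in> \<Lambda>\<close> above it, and \<open>F\<close> is extended by elements of \<open>X\<close> above the slots.\<close>

definition holes :: "bool list set \<Rightarrow> bool list set" where
  "holes F = (if F = {} then {[]} else {w @ [b] |w b. w \<in> F \<and> (\<forall>y\<in>F. \<not> prefix (w @ [b]) y)})"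

lemma finite_holes: "finite F \<Longrightarrow> finite (holes F)"
proof -
  assume "finite F"
  then have "finite (insert [] ((\<lambda>(w, b). w @ [b]) ` (F \<times> (UNIV :: bool set))))" by simp
  moreover have "holes F \<subseteq> insert [] ((\<lambda>(w, b). w @ [b]) ` (F \<times> UNIV))" by (auto simp: holes_def)
  ultimately show ?thesis by (rule finite_subset[rotated])
qed

definition region :: "bool list set \<Rightarrow> bool list set \<Rightarrow> bool list set" where
  "region \<Lambda> X = {x \<in> X. \<exists>\<nu>\<in>\<Lambda>. prefix \<nu> x}"

definition condition ::
  "(bool list set \<times> bool list set set) set \<Rightarrow> bool list set \<Rightarrow> bool list set \<Rightarrow> bool list set \<Rightarrow> bool" where
  "condition M F \<Lambda> X \<longleftrightarrow> finite F \<and> finite \<Lambda> \<and> meet_closed F \<and>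
    (\<forall>\<eta>\<in>holes F. \<exists>\<nu>\<in>\<Lambda>. prefix \<eta> \<nu>) \<and> abundant M (pool \<Lambda> X)"

text \<open>Failure at \<open>n\<close> is demanded for finite extensions only. By the use principle
  this controls the infinite tree as well.\<close>

definition settled ::
  "nat set \<Rightarrow> bool list set \<Rightarrow> code \<Rightarrow> nat \<Rightarrow> bool list set \<Rightarrow> bool list set \<Rightarrow> bool" where
  "settled D S e l F P \<longleftrightarrow> (\<exists>n. \<forall>g w. finite g \<longrightarrow> g \<subseteq> P \<longrightarrow> meet_closed (F \<union> g) \<longrightarrow>
    finite w \<longrightarrow> card w \<le> l \<longrightarrow> w \<inter> S \<inter> {s. length s = n} \<noteq> {} \<longrightarrow>
    \<not> eval (D \<oplus>\<^sub>T (str_encode ` (F \<union> g))) e n (fin_encode w))"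

lemma settled_mono:
  assumes "settled D S e l F P" "F \<subseteq> F'" "F' - F \<subseteq> P" "P' \<subseteq> P" "finite F'"
  shows "settled D S e l F' P'"
proof -
  obtain n where n: "\<forall>g w. finite g \<longrightarrow> g \<subseteq> P \<longrightarrow> meet_closed (F \<union> g) \<longrightarrow> finite w \<longrightarrow> card w \<le> l \<longrightarrow>
      w \<inter> S \<inter> {s. length s = n} \<noteq> {} \<longrightarrow> \<not> eval (D \<oplus>\<^sub>T (str_encode ` (F \<union> g))) e n (fin_encode w)"
    using assms(1) unfolding settled_def by (rule exE)
  have "\<not> eval (D \<oplus>\<^sub>T (str_encode ` (F' \<union> g))) e n (fin_encode w)"
    if "finite g" "g \<subseteq> P'" "meet_closed (F' \<union> g)" "finite w" "card w \<le> l"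
      "w \<inter> S \<inter> {s. length s = n} \<noteq> {}" for g w
  proof -
    have "F' \<union> g = F \<union> ((F' - F) \<union> g)" using assms(2) by blast
    moreover have "finite ((F' - F) \<union> g)" "(F' - F) \<union> g \<subseteq> P" using assms(3-5) that(1,2) by auto
    ultimately show ?thesis using n[THEN spec, THEN spec, of "(F' - F) \<union> g" w] that(3-6) by simp
  qed
  then show ?thesis unfolding settled_def by (intro exI[of _ n] allI impI)
qed

text \<open>A surviving old hole lies below an old slot; a new hole lies above an element of
  \<open>g\<close>, hence above an old slot. Padding with \<open>False\<close> makes the new slots
  long enough not to disturb a given computation.\<close>

lemma new_slots:
  assumes F: "finite F" and g: "finite g" "g \<subseteq> region \<Lambda> X"
    and cover: "\<forall>\<eta>\<in>holes F. \<exists>\<nu>\<in>\<Lambda>. prefix \<eta> \<nu>"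
  shows "\<exists>\<Lambda>'. finite \<Lambda>' \<and> (\<forall>\<eta>\<in>holes (F \<union> g). \<exists>\<nu>\<in>\<Lambda>'. prefix \<eta> \<nu>) \<and>
    (\<forall>\<nu>'\<in>\<Lambda>'. m \<le> length \<nu>' \<and> (\<exists>\<nu>\<in>\<Lambda>. prefix \<nu> \<nu>'))"
proof -
  have pad: "\<exists>t. prefix \<eta> t \<and> m \<le> length t \<and> (\<exists>\<nu>\<in>\<Lambda>. prefix \<nu> t)"
    if "prefix \<eta> s" "\<nu> \<in> \<Lambda>" "prefix \<nu> s" for \<eta> s \<nu>
    using that by (intro exI[of _ "s @ replicate m False"]) (auto intro!: bexI[of _ \<nu>])
  have "\<exists>t. prefix \<eta> t \<and> m \<le> length t \<and> (\<exists>\<nu>\<in>\<Lambda>. prefix \<nu> t)" if \<eta>: "\<eta> \<in> holes (F \<union> g)" for \<eta>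
  proof (cases "\<eta> \<in> holes F")
    case True
    then obtain \<nu> where "\<nu> \<in> \<Lambda>" "prefix \<eta> \<nu>" using cover by blast
    then show ?thesis using pad[of \<eta> \<nu> \<nu>] by simp
  next
    case False
    then have "F \<union> g \<noteq> {}" using \<eta> by (auto simp: holes_def)
    with \<eta> have "\<eta> \<in> {w @ [b] |w b. w \<in> F \<union> g \<and> (\<forall>y\<in>F \<union> g. \<not> prefix (w @ [b]) y)}"
      unfolding holes_def by (simp only: if_False)
    then obtain w b where w: "\<eta> = w @ [b]" "w \<in> F \<union> g" "\<forall>y\<in>F \<union> g. \<not> prefix (w @ [b]) y"
      by blast
    have "w \<in> g"
    proof (rule ccontr)
      assume "w \<notin> g"
      then have "w \<in> F" using w(2) by simp
      then have "\<eta> \<in> holes F" using w by (auto simp: holes_def)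
      with False show False by simp
    qed
    then obtain \<nu> where "\<nu> \<in> \<Lambda>" "prefix \<nu> w" using g(2) by (auto simp: region_def)
    then show ?thesis using pad[of \<eta> \<eta> \<nu>] w(1) by (auto simp: prefix_def)
  qed
  then obtain t where t: "\<And>\<eta>. \<eta> \<in> holes (F \<union> g) \<Longrightarrow> prefix \<eta> (t \<eta>) \<and> m \<le> length (t \<eta>) \<and> (\<exists>\<nu>\<in>\<Lambda>. prefix \<nu> (t \<eta>))"
    by metis
  have "finite (holes (F \<union> g))" using F g(1) by (intro finite_holes) simp
  then show ?thesis using t by (intro exI[of _ "t ` holes (F \<union> g)"]) auto
qed

text \<open>The new slots lie above old ones and hence restrict fewer cones:
  \<open>pool \<Lambda> X \<subseteq> pool \<Lambda>' X\<close>, so abundance is inherited.\<close>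

lemma condition_extend:
  assumes c: "condition M F \<Lambda> X" and g: "finite g" "g \<subseteq> region \<Lambda> X" "meet_closed (F \<union> g)"
  shows "\<exists>\<Lambda>'. condition M (F \<union> g) \<Lambda>' X \<and> region \<Lambda>' X \<subseteq> region \<Lambda> X \<and> (\<forall>x\<in>region \<Lambda>' X. m \<le> length x)"
proof -
  have F: "finite F" and cover: "\<forall>\<eta>\<in>holes F. \<exists>\<nu>\<in>\<Lambda>. prefix \<eta> \<nu>" and ab: "abundant M (pool \<Lambda> X)"
    using c by (simp_all add: condition_def)
  from new_slots[OF F g(1,2) cover, of m] obtain \<Lambda>' where \<Lambda>': "finite \<Lambda>'"
    "\<forall>\<eta>\<in>holes (F \<union> g). \<exists>\<nu>\<in>\<Lambda>'. prefix \<eta> \<nu>" "\<forall>\<nu>'\<in>\<Lambda>'. m \<le> length \<nu>' \<and> (\<exists>\<nu>\<in>\<Lambda>. prefix \<nu> \<nu>')"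
    by (elim exE conjE)
  have below: "\<exists>\<nu>\<in>\<Lambda>. prefix \<nu> x" if \<nu>': "\<nu>' \<in> \<Lambda>'" "prefix \<nu>' x" for \<nu>' x
  proof -
    obtain \<nu> where "\<nu> \<in> \<Lambda>" "prefix \<nu> \<nu>'" using \<Lambda>'(3) \<nu>'(1) by blast
    then show ?thesis using prefix_order.trans[OF _ \<nu>'(2)] by blast
  qed
  have "pool \<Lambda> X \<subseteq> pool \<Lambda>' X" using below by (auto simp: pool_def)
  with ab have "abundant M (pool \<Lambda>' X)" by (rule abundant_mono)
  then have "condition M (F \<union> g) \<Lambda>' X" using F g \<Lambda>' by (simp add: condition_def)
  moreover have "region \<Lambda>' X \<subseteq> region \<Lambda> X" using below by (auto simp: region_def)
  moreover have "m \<le> length x" if x: "x \<in> region \<Lambda>' X" for x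
  proof -
    obtain \<nu>' where "\<nu>' \<in> \<Lambda>'" "prefix \<nu>' x" using x by (auto simp: region_def)
    then have "m \<le> length \<nu>'" "length \<nu>' \<le> length x" using \<Lambda>'(3) prefix_length_le by auto
    then show ?thesis by simp
  qed
  ultimately show ?thesis by blast
qed

text \<open>The code of a string is at least its length, so strings of length at least
  \<open>u\<close> do not influence the oracle below \<open>u\<close>.\<close>

lemma join_agree:
  assumes "\<And>x. x \<in> A - B \<Longrightarrow> u \<le> length x" "\<And>x. x \<in> B - A \<Longrightarrow> u \<le> length x" "m < u"
  shows "m \<in> D \<oplus>\<^sub>T (str_encode ` A) \<longleftrightarrow> m \<in> D \<oplus>\<^sub>T (str_encode ` B)"
proof -
  have "x \<in> A \<longleftrightarrow> x \<in> B" if "m = 2 * str_encode x + 1" for x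
  proof -
    have "length x < u" using length_le_str_encode[of x] that assms(3) by simp
    then show ?thesis using assms(1)[of x] assms(2)[of x] by auto
  qed
  then show ?thesis unfolding join_def by blast
qed

lemma pool_met:
  assumes "abundant M (pool \<Lambda> X)" "(\<Lambda>', G) \<in> M" "\<Lambda>' \<subseteq> \<Lambda>"
  shows "\<exists>g\<in>G. g \<subseteq> region \<Lambda>' X"
proof -
  have "finite (range (\<lambda>_ :: bool list. 0 :: nat))" by simp
  from abundantD[OF assms(1) _ _ this, of "{(\<Lambda>', G)}"] assms(2)
  obtain z where "met (pool \<Lambda> X \<inter> matching (\<lambda>_. 0) z) (\<Lambda>', G)" by auto
  then have "met (pool \<Lambda> X) (\<Lambda>', G)" by (rule met_mono) simp
  then obtain g where g: "g \<in> G" "\<forall>x\<in>g. \<exists>\<rho>\<in>\<Lambda>'. (\<rho>, x) \<in> pool \<Lambda> X"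
    unfolding met_def fst_conv snd_conv by (rule bexE)
  have "g \<subseteq> region \<Lambda>' X"
  proof
    fix x assume "x \<in> g"
    then obtain \<rho> where "\<rho> \<in> \<Lambda>'" "(\<rho>, x) \<in> pool \<Lambda> X" using g(2) by blast
    then show "x \<in> region \<Lambda>' X" using assms(3) by (auto simp: pool_def region_def)
  qed
  with g(1) show ?thesis by blast
qed

text \<open>Either an extension whose output misses \<open>S\<close> is added, and slots longer than
  the use of the computation preserve this output; or \<open>abundant_avoid\<close> thins out the
  pool until no extension from it has an output of size at most \<open>l\<close> at
  \<open>n\<close>.\<close>

lemma settle:
  assumes c: "condition M F \<Lambda> X" and dec: "decisive M D S"
    and fin: "\<forall>i\<in>M. finite (fst i)" and closed: "deepening_closed M"
  shows "\<exists>F' \<Lambda>' X'. condition M F' \<Lambda>' X' \<and> F \<subseteq> F' \<and> F' - F \<subseteq> region \<Lambda> X \<and>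
    region \<Lambda>' X' \<subseteq> region \<Lambda> X \<and> settled D S e l F' (region \<Lambda>' X')"
proof -
  have F: "finite F" and \<Lambda>: "finite \<Lambda>" and cover: "\<forall>\<eta>\<in>holes F. \<exists>\<nu>\<in>\<Lambda>. prefix \<eta> \<nu>"
    and ab: "abundant M (pool \<Lambda> X)" and mc: "meet_closed F"
    using c by (simp_all add: condition_def)
  let ?W = "\<Union>n. missing l (extension_output D e F) n (S \<inter> {s. length s = n})"
  have "(\<Lambda>, ?W) \<in> M \<or> (\<exists>n E \<Phi> Y. finite E \<and> E \<subseteq> M \<and> Ball \<Phi> deepening \<and> finite (range Y) \<and>
        \<not> (\<exists>z. (\<forall>i\<in>E. met (matching Y z) i) \<and>
          (\<forall>\<phi>\<in>\<Phi>. met (matching Y z) (\<phi> ` \<Lambda>, missing l (extension_output D e F) n {}))))"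
    by (rule dec[unfolded decisive_def, THEN spec, THEN spec, THEN spec, THEN spec, THEN mp, THEN mp,
          OF F \<Lambda>])
  then show ?thesis
  proof
    assume 1: "(\<Lambda>, ?W) \<in> M"
    obtain g where "g \<in> ?W" and g: "g \<subseteq> region \<Lambda> X" using pool_met[OF ab 1 order_refl] by blast
    then obtain n w where gw: "finite g" "finite w" "w \<inter> (S \<inter> {s. length s = n}) = {}"
      "extension_output D e F g n w"
      unfolding missing_def by auto
    then have mc': "meet_closed (F \<union> g)" and "eval (D \<oplus>\<^sub>T (str_encode ` (F \<union> g))) e n (fin_encode w)"
      by (simp_all add: extension_output_def)
    from eval_use[OF this(2)] obtain u where u: "\<And>B. \<forall>m<u. m \<in> B \<longleftrightarrow> m \<in> D \<oplus>\<^sub>T (str_encode ` (F \<union> g)) \<Longrightarrow>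
        eval B e n (fin_encode w)" by auto
    from condition_extend[OF c gw(1) g mc', of u] obtain \<Lambda>' where \<Lambda>': "condition M (F \<union> g) \<Lambda>' X"
      "region \<Lambda>' X \<subseteq> region \<Lambda> X" "\<forall>x\<in>region \<Lambda>' X. u \<le> length x" by (elim exE conjE)
    have "settled D S e l (F \<union> g) (region \<Lambda>' X)"
      unfolding settled_def
    proof (intro exI[of _ n] allI impI notI)
      fix g' w' assume g': "g' \<subseteq> region \<Lambda>' X" and w': "finite w'" "w' \<inter> S \<inter> {s. length s = n} \<noteq> {}"
        and ev: "eval (D \<oplus>\<^sub>T (str_encode ` (F \<union> g \<union> g'))) e n (fin_encode w')"
      have "eval (D \<oplus>\<^sub>T (str_encode ` (F \<union> g \<union> g'))) e n (fin_encode w)"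
      proof (intro u allI impI join_agree)
        fix x assume "x \<in> F \<union> g \<union> g' - (F \<union> g)"
        then show "u \<le> length x" using g' \<Lambda>'(3) by blast
      qed auto
      from eval_deterministic[OF ev this] have "fin_decode (fin_encode w') = fin_decode (fin_encode w)"
        by simp
      then have "w' = w" using w'(1) gw(2) by simp
      with w'(2) gw(3) show False by blast
    qed
    moreover have "F \<union> g - F \<subseteq> region \<Lambda> X" using g by blast
    ultimately show ?thesis using \<Lambda>'(1,2) by blast
  next
    assume "\<exists>n E \<Phi> Y. finite E \<and> E \<subseteq> M \<and> Ball \<Phi> deepening \<and> finite (range Y) \<and>
        \<not> (\<exists>z. (\<forall>i\<in>E. met (matching Y z) i) \<and>
          (\<forall>\<phi>\<in>\<Phi>. met (matching Y z) (\<phi> ` \<Lambda>, missing l (extension_output D e F) n {})))"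
    then obtain n E \<Phi> Y where E: "finite E" "E \<subseteq> M" and \<Phi>: "Ball \<Phi> deepening" and Y: "finite (range Y)"
      and fail: "\<not> (\<exists>z. (\<forall>i\<in>E. met (matching Y z) i) \<and>
          (\<forall>\<phi>\<in>\<Phi>. met (matching Y z) (\<phi> ` \<Lambda>, missing l (extension_output D e F) n {})))"
      by (elim exE conjE)
    obtain \<psi> X' where \<psi>: "deepening \<psi>" "X' \<subseteq> X" "abundant M (pool (\<psi> ` \<Lambda>) X')"
      and avoid: "\<And>g. g \<in> missing l (extension_output D e F) n {} \<Longrightarrow> \<not> g \<subseteq> X'"
    proof (rule abundant_avoid[OF ab Y fin closed E])
      show "deepening \<phi>" if "\<phi> \<in> \<Phi>" for \<phi> using \<Phi> that by blast
      show "\<exists>\<phi>\<in>\<Phi>. \<not> met (matching Y z) (\<phi> ` \<Lambda>, missing l (extension_output D e F) n {})"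
        if "\<forall>i\<in>E. met (matching Y z) i" for z
        using fail that by meson
    qed (rule that)
    have deep: "prefix \<rho> (\<psi> \<rho>)" for \<rho> using \<psi>(1) by (simp add: deepening_def)
    have "\<exists>\<nu>\<in>\<psi> ` \<Lambda>. prefix \<eta> \<nu>" if \<eta>: "\<eta> \<in> holes F" for \<eta>
    proof -
      obtain \<nu> where \<nu>: "\<nu> \<in> \<Lambda>" "prefix \<eta> \<nu>" using bspec[OF cover \<eta>] by (rule bexE)
      have "prefix \<eta> (\<psi> \<nu>)" using \<nu>(2) deep by (rule prefix_order.trans)
      with \<nu>(1) show ?thesis by (intro bexI[of _ "\<psi> \<nu>"]) simp_all
    qed
    then have "condition M F (\<psi> ` \<Lambda>) X'" using F \<Lambda> mc \<psi>(3) by (simp add: condition_def)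
    moreover have "region (\<psi> ` \<Lambda>) X' \<subseteq> region \<Lambda> X"
    proof
      fix x assume "x \<in> region (\<psi> ` \<Lambda>) X'"
      then obtain \<nu> where \<nu>: "x \<in> X'" "\<nu> \<in> \<Lambda>" "prefix (\<psi> \<nu>) x" by (auto simp: region_def)
      have "prefix \<nu> x" using deep \<nu>(3) by (rule prefix_order.trans)
      with \<nu> \<psi>(2) show "x \<in> region \<Lambda> X" by (auto simp: region_def)
    qed
    moreover have "settled D S e l F (region (\<psi> ` \<Lambda>) X')"
      unfolding settled_def
    proof (intro exI[of _ n] allI impI notI)
      fix g w assume g: "finite g" "g \<subseteq> region (\<psi> ` \<Lambda>) X'" "meet_closed (F \<union> g)"
        and w: "finite w" "card w \<le> l" and "eval (D \<oplus>\<^sub>T (str_encode ` (F \<union> g))) e n (fin_encode w)"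
      then have "extension_output D e F g n w" by (simp add: extension_output_def)
      with g(1) w have "g \<in> missing l (extension_output D e F) n {}" unfolding missing_def by auto
      moreover have "g \<subseteq> X'" using g(2) by (auto simp: region_def)
      ultimately show False using avoid by blast
    qed
    ultimately show ?thesis by blast
  qed
qed

text \<open>Two strings are related by \<open>R\<close> if they are comparable or split at a node of
  \<open>F\<close>. The string put into a hole \<open>w @ [b]\<close> splits from elements of
  \<open>F\<close> properly above \<open>w\<close> at \<open>w\<close> itself, since these lie on
  the other side; otherwise it inherits its position from \<open>w\<close>.\<close>

lemma meet_closed_fill_holes:
  assumes F: "meet_closed F" and x: "\<And>\<eta>. \<eta> \<in> holes F \<Longrightarrow> prefix \<eta> (x \<eta>)"
  shows "meet_closed (F \<union> x ` holes F)"
proof (cases "F = {}")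
  case True
  then show ?thesis by (auto simp: holes_def meet_closed_def)
next
  case False
  define R where "R p q \<longleftrightarrow> prefix p q \<or> prefix q p \<or>
    (\<exists>w\<in>F. \<exists>b. prefix (w @ [b]) p \<and> prefix (w @ [\<not> b]) q)" for p q
  have sym: "R q p" if pq: "R p q" for p q
  proof -
    consider "prefix p q" | "prefix q p"
      | w b where "w \<in> F" "prefix (w @ [b]) p" "prefix (w @ [\<not> b]) q"
      using pq unfolding R_def by blast
    then show ?thesis
    proof cases
      case (3 w b)
      then show ?thesis unfolding R_def by (intro disjI2 bexI[of _ w] exI[of _ "\<not> b"]) simp_all
    qed (simp_all add: R_def)
  qed
  have split: "R p q" if "w \<in> F" "prefix (w @ [b]) p" "prefix (w @ [\<not> b]) q" for w b p q
    unfolding R_def using that by (intro disjI2 bexI[of _ w] exI[of _ b]) simp_all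
  have hole: "\<exists>w b. w \<in> F \<and> \<eta> = w @ [b] \<and> (\<forall>y\<in>F. \<not> prefix (w @ [b]) y) \<and> prefix (w @ [b]) (x \<eta>)"
    if "\<eta> \<in> holes F" for \<eta>
    using that x[OF that] False by (auto simp: holes_def)
  have branch: "w = q \<or> prefix (w @ [\<not> b]) q" if wq: "prefix w q" "\<not> prefix (w @ [b]) q" for w b q
  proof -
    obtain u where u: "q = w @ u" using wq(1) by (rule prefixE)
    show ?thesis using wq(2) unfolding u by (cases u) auto
  qed
  have old: "R p q" if "p \<in> F" "q \<in> F" for p q
    using F that
  proof (cases rule: meet_closedE)
    case (3 w b)
    then show ?thesis by (rule split)
  qed (simp_all add: R_def)
  have cross: "R (x \<eta>) q" if \<eta>: "\<eta> \<in> holes F" and q: "q \<in> F" for \<eta> q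
  proof -
    obtain w b where w: "w \<in> F" "\<eta> = w @ [b]" "\<forall>y\<in>F. \<not> prefix (w @ [b]) y" "prefix (w @ [b]) (x \<eta>)"
      using hole[OF \<eta>] by (elim exE conjE)
    then have wx: "prefix w (x \<eta>)" by (auto dest: append_prefixD)
    from F w(1) q show ?thesis
    proof (cases rule: meet_closedE)
      case 1
      then have "w = q \<or> prefix (w @ [\<not> b]) q" using w(3) q by (intro branch) auto
      then show ?thesis using wx split[OF w(1) w(4)] by (auto simp: R_def)
    next
      case 2
      then show ?thesis using wx unfolding R_def by (auto intro: prefix_order.trans)
    next
      case (3 v c)
      have "prefix (v @ [c]) (x \<eta>)" using 3(2) wx by (rule prefix_order.trans)
      then show ?thesis using 3 by (intro split[of v c])
    qed
  qed
  have new: "R (x \<eta>) (x \<eta>')" if \<eta>: "\<eta> \<in> holes F" "\<eta>' \<in> holes F" for \<eta> \<eta>'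
  proof -
    obtain w b where w: "w \<in> F" "\<eta> = w @ [b]" "\<forall>y\<in>F. \<not> prefix (w @ [b]) y" "prefix (w @ [b]) (x \<eta>)"
      using hole[OF \<eta>(1)] by (elim exE conjE)
    obtain w' b' where w': "w' \<in> F" "\<eta>' = w' @ [b']" "\<forall>y\<in>F. \<not> prefix (w' @ [b']) y"
      "prefix (w' @ [b']) (x \<eta>')"
      using hole[OF \<eta>(2)] by (elim exE conjE)
    have wx: "prefix w (x \<eta>)" "prefix w' (x \<eta>')" using w(4) w'(4) by (auto dest: append_prefixD)
    show ?thesis
    proof (cases "w = w'")
      case True
      show ?thesis
      proof (cases "b = b'")
        case True
        then show ?thesis using \<open>w = w'\<close> w(2) w'(2) by (simp add: R_def)
      next
        case False
        then have "b' = (\<not> b)" by simp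
        then show ?thesis using w w' \<open>w = w'\<close> by (intro split[of w b]) simp_all
      qed
    next
      case False
      from F w(1) w'(1) show ?thesis
      proof (cases rule: meet_closedE)
        case 1
        then have "prefix (w @ [\<not> b]) w'" using branch[of w w' b] w(3) w'(1) False by blast
        then have "prefix (w @ [\<not> b]) (x \<eta>')" using wx(2) by (rule prefix_order.trans)
        then show ?thesis by (rule split[OF w(1,4)])
      next
        case 2
        then have "prefix (w' @ [\<not> b']) w" using branch[of w' w b'] w'(3) w(1) False by blast
        then have "prefix (w' @ [\<not> b']) (x \<eta>)" using wx(1) by (rule prefix_order.trans)
        then show ?thesis by (rule sym[OF split[OF w'(1,4)]])
      next
        case (3 v c)
        show ?thesis
          by (rule split[OF 3(1) prefix_order.trans[OF 3(2) wx(1)] prefix_order.trans[OF 3(3) wx(2)]])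
      qed
    qed
  qed
  have R: "R p q" if "p \<in> F \<union> x ` holes F" "q \<in> F \<union> x ` holes F" for p q
    using that old cross sym[OF cross] new by blast
  show ?thesis
    unfolding meet_closed_def
  proof (intro ballI)
    fix p q assume pq: "p \<in> F \<union> x ` holes F" "q \<in> F \<union> x ` holes F"
    from R[OF this] consider "prefix p q" | "prefix q p"
      | w b where "w \<in> F" "prefix (w @ [b]) p" "prefix (w @ [\<not> b]) q"
      unfolding R_def by blast
    then show "\<exists>w\<in>F \<union> x ` holes F. prefix w p \<and> prefix w q \<and>
        (w = p \<or> w = q \<or> (\<exists>b. prefix (w @ [b]) p \<and> prefix (w @ [\<not> b]) q))"
    proof cases
      case 1
      then show ?thesis using pq by (intro bexI[of _ p]) simp_all
    next
      case 2
      then show ?thesis using pq by (intro bexI[of _ q]) simp_all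
    next
      case (3 w b)
      then show ?thesis by (intro bexI[of _ w]) (auto dest: append_prefixD)
    qed
  qed
qed

text \<open>One string of the pool is put above each hole, so both sides of every node of
  \<open>F\<close> are continued. For empty \<open>F\<close> the only hole is \<open>[]\<close>, and
  the string chosen for it becomes the root.\<close>

lemma grow:
  assumes c: "condition M F \<Lambda> X" and N: "range nonempty_at \<subseteq> M"
  shows "\<exists>F' \<Lambda>'. condition M F' \<Lambda>' X \<and> F \<subseteq> F' \<and> F' - F \<subseteq> region \<Lambda> X \<and>
    region \<Lambda>' X \<subseteq> region \<Lambda> X \<and> F' \<noteq> {} \<and> (\<forall>w\<in>F. \<forall>b. \<exists>y\<in>F'. prefix (w @ [b]) y)"
proof -
  have F: "finite F" and cover: "\<forall>\<eta>\<in>holes F. \<exists>\<nu>\<in>\<Lambda>. prefix \<eta> \<nu>"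
    and ab: "abundant M (pool \<Lambda> X)" and mc: "meet_closed F"
    using c by (simp_all add: condition_def)
  have "\<exists>x. prefix \<eta> x \<and> x \<in> region \<Lambda> X" if \<eta>: "\<eta> \<in> holes F" for \<eta>
  proof -
    obtain \<nu> where \<nu>: "\<nu> \<in> \<Lambda>" "prefix \<eta> \<nu>" using bspec[OF cover \<eta>] by (rule bexE)
    have "({\<nu>}, {g. finite g \<and> g \<noteq> {}}) \<in> M" using N by (auto simp: nonempty_at_def)
    from pool_met[OF ab this] \<nu>(1) obtain g where "g \<noteq> {}" "g \<subseteq> region {\<nu>} X" by auto
    then obtain x where x: "x \<in> X" "prefix \<nu> x" by (auto simp: region_def)
    have "prefix \<eta> x" using \<nu>(2) x(2) by (rule prefix_order.trans)
    with x \<nu>(1) show ?thesis by (auto simp: region_def)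
  qed
  then obtain x where x: "\<And>\<eta>. \<eta> \<in> holes F \<Longrightarrow> prefix \<eta> (x \<eta>) \<and> x \<eta> \<in> region \<Lambda> X" by metis
  have "finite (x ` holes F)" using finite_holes[OF F] by simp
  moreover have sub: "x ` holes F \<subseteq> region \<Lambda> X" using x by blast
  moreover have "meet_closed (F \<union> x ` holes F)" using meet_closed_fill_holes[OF mc] x by blast
  ultimately have "\<exists>\<Lambda>'. condition M (F \<union> x ` holes F) \<Lambda>' X \<and> region \<Lambda>' X \<subseteq> region \<Lambda> X \<and>
      (\<forall>x\<in>region \<Lambda>' X. 0 \<le> length x)"
    by (rule condition_extend[OF c])
  then obtain \<Lambda>' where "condition M (F \<union> x ` holes F) \<Lambda>' X" "region \<Lambda>' X \<subseteq> region \<Lambda> X"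
    by (elim exE conjE)
  moreover have "F \<union> x ` holes F \<noteq> {}" by (auto simp: holes_def)
  moreover have "\<exists>y\<in>F \<union> x ` holes F. prefix (w @ [b]) y" if w: "w \<in> F" for w b
  proof (cases "w @ [b] \<in> holes F")
    case True
    then show ?thesis using x by blast
  next
    case False
    have "w @ [b] \<in> holes F" if "\<forall>y\<in>F. \<not> prefix (w @ [b]) y"
      using that w by (auto simp: holes_def)
    with False show ?thesis by blast
  qed
  ultimately show ?thesis using sub by (intro exI[of _ "F \<union> x ` holes F"] exI[of _ \<Lambda>']) auto
qed

text \<open>Settling comes first. Growing then draws its strings from the settled region, so
  \<open>settled_mono\<close> carries the result over.\<close>

lemma condition_step:
  assumes c: "condition M F \<Lambda> X" and dec: "decisive M D S" and N: "range nonempty_at \<subseteq> M"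
    and fin: "\<forall>i\<in>M. finite (fst i)" and closed: "deepening_closed M"
  shows "\<exists>F' \<Lambda>' X'. condition M F' \<Lambda>' X' \<and> F \<subseteq> F' \<and> F' - F \<subseteq> region \<Lambda> X \<and>
    region \<Lambda>' X' \<subseteq> region \<Lambda> X \<and> settled D S e l F' (region \<Lambda>' X') \<and> F' \<noteq> {} \<and>
    (\<forall>w\<in>F. \<forall>b. \<exists>y\<in>F'. prefix (w @ [b]) y)"
proof -
  from settle[OF c dec fin closed, of e l] obtain F1 \<Lambda>1 X1 where 1: "condition M F1 \<Lambda>1 X1" "F \<subseteq> F1"
    "F1 - F \<subseteq> region \<Lambda> X" "region \<Lambda>1 X1 \<subseteq> region \<Lambda> X" and s: "settled D S e l F1 (region \<Lambda>1 X1)"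
    by (elim exE conjE)
  from grow[OF 1(1) N] obtain F2 \<Lambda>2 where 2: "condition M F2 \<Lambda>2 X1" "F1 \<subseteq> F2"
    "F2 - F1 \<subseteq> region \<Lambda>1 X1" "region \<Lambda>2 X1 \<subseteq> region \<Lambda>1 X1" "F2 \<noteq> {}"
    "\<forall>w\<in>F1. \<forall>b. \<exists>y\<in>F2. prefix (w @ [b]) y" by (elim exE conjE)
  have "finite F2" using 2(1) by (simp add: condition_def)
  then have "settled D S e l F2 (region \<Lambda>2 X1)" using settled_mono[OF s 2(2,3,4)] by simp
  moreover have "F \<subseteq> F2" "F2 - F \<subseteq> region \<Lambda> X" "region \<Lambda>2 X1 \<subseteq> region \<Lambda> X" using 1 2 by auto
  moreover have "\<forall>w\<in>F. \<forall>b. \<exists>y\<in>F2. prefix (w @ [b]) y" using 1(2) 2(6) by blast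
  ultimately show ?thesis using 2(1,5) by (intro exI[of _ F2] exI[of _ \<Lambda>2] exI[of _ X1] conjI)
qed

section \<open>The tree as the union of a sequence of conditions\<close>

instance code :: countable
  by countable_datatype

theorem theorem4p1:
  fixes k :: nat and D :: "nat set" and S :: "bool list set" and C :: "bool list \<Rightarrow> nat"
  assumes "k \<ge> 1"
    and "\<not> computes_bounded_enumeration D S"
    and "\<forall>s. C s < k"
  shows "\<exists>T. infinite_perfect_tree T \<and> (\<exists>c<k. \<forall>t\<in>T. C t = c) \<and>
    \<not> computes_bounded_enumeration (D \<oplus>\<^sub>T (str_encode ` T)) S"
proof -
  obtain M where fin: "\<forall>i\<in>M. finite (fst i)" and closed: "deepening_closed M"
    and N: "range nonempty_at \<subseteq> M" and ab: "abundant M {(\<rho>, x). prefix \<rho> x}"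
    and dec: "decisive M D S"
    using decisive_family[OF assms(2)] by (elim exE conjE)
  have "range C \<subseteq> {..<k}" using assms(3) by auto
  then have "finite (range C)" by (rule finite_subset) simp
  from abundant_initial[OF ab this fin closed] obtain \<sigma> c where
    c: "c \<in> range C" "abundant M (pool {\<sigma>} {x. C x = c})" by metis
  \<comment> \<open>Stage \<open>m\<close> treats one pair of a code and a bound. As
    \<open>from_nat\<close> is a left inverse of \<open>to_nat\<close>, every pair gets its
    turn.\<close>
  define req :: "nat \<Rightarrow> code \<times> nat" where "req = from_nat"
  let ?P = "\<lambda>(F, \<Lambda>, X). condition M F \<Lambda> X \<and> F \<subseteq> {x. C x = c} \<and> region \<Lambda> X \<subseteq> {x. C x = c}"
  let ?Q = "\<lambda>m (F, \<Lambda>, X) (F', \<Lambda>', X'). F \<subseteq> F' \<and> F' - F \<subseteq> region \<Lambda> X \<and> region \<Lambda>' X' \<subseteq> region \<Lambda> X \<and>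
    settled D S (fst (req m)) (snd (req m)) F' (region \<Lambda>' X') \<and> F' \<noteq> {} \<and>
    (\<forall>w\<in>F. \<forall>b. \<exists>y\<in>F'. prefix (w @ [b]) y)"
  have "\<exists>s. \<forall>m. ?P (s m) \<and> ?Q m (s m) (s (Suc m))"
  proof (rule dependent_nat_choice)
    \<comment> \<open>The empty set has the single hole \<open>[]\<close>, and this lies below the
      slot \<sigma>.\<close>
    have "condition M {} {\<sigma>} {x. C x = c}"
      using c(2) by (simp add: condition_def meet_closed_def holes_def)
    then show "\<exists>s. ?P s"
      by (intro exI[of _ "({}, {\<sigma>}, {x. C x = c})"]) (auto simp: region_def)
  next
    fix s m assume "?P s"
    moreover obtain F \<Lambda> X where s: "s = (F, \<Lambda>, X)" by (cases s)
    ultimately have P: "condition M F \<Lambda> X" "F \<subseteq> {x. C x = c}" "region \<Lambda> X \<subseteq> {x. C x = c}" by simp_all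
    from condition_step[OF P(1) dec N fin closed, of "fst (req m)" "snd (req m)"]
    obtain F' \<Lambda>' X' where *: "condition M F' \<Lambda>' X'" "F \<subseteq> F'" "F' - F \<subseteq> region \<Lambda> X"
      "region \<Lambda>' X' \<subseteq> region \<Lambda> X" "settled D S (fst (req m)) (snd (req m)) F' (region \<Lambda>' X')"
      "F' \<noteq> {}" "\<forall>w\<in>F. \<forall>b. \<exists>y\<in>F'. prefix (w @ [b]) y" by (elim exE conjE)
    have "F' \<subseteq> {x. C x = c}" "region \<Lambda>' X' \<subseteq> {x. C x = c}" using P(2,3) *(3,4) by blast+
    with * show "\<exists>s'. ?P s' \<and> ?Q m s s'"
      unfolding s by (intro exI[of _ "(F', \<Lambda>', X')"]) simp
  qed
  then obtain s where s: "\<forall>m. ?P (s m) \<and> ?Q m (s m) (s (Suc m))" by (rule exE)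
  define F where "F m = fst (s m)" for m
  define R where "R m = region (fst (snd (s m))) (snd (snd (s m)))" for m
  have s_eq: "s m = (F m, fst (snd (s m)), snd (snd (s m)))" for m by (simp add: F_def)
  have P: "finite (F m)" "meet_closed (F m)" "F m \<subseteq> {x. C x = c}" for m
    using s[THEN spec, of m] s_eq[of m] by (auto simp: condition_def split: prod.splits)
  have Q: "F m \<subseteq> F (Suc m)" "F (Suc m) - F m \<subseteq> R m" "R (Suc m) \<subseteq> R m"
    "settled D S (fst (req m)) (snd (req m)) (F (Suc m)) (R (Suc m))"
    "F (Suc m) \<noteq> {}" "\<And>w b. w \<in> F m \<Longrightarrow> \<exists>y\<in>F (Suc m). prefix (w @ [b]) y" for m
    using s[THEN spec, of m] unfolding F_def R_def by (auto simp: case_prod_beta)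
  have F_mono: "F m \<subseteq> F n" if "m \<le> n" for m n
    using that Q(1) by (rule lift_Suc_mono_le[rotated])
  have new: "F n - F m \<subseteq> R m \<and> R n \<subseteq> R m" if "m \<le> n" for m n
    using that
  proof (induction n rule: dec_induct)
    case (step n)
    then show ?case using Q(2,3)[of n] by blast
  qed simp
  define T where "T = (\<Union>m. F m)"
  have common: "\<exists>m. x \<in> F m \<and> y \<in> F m" if xy: "x \<in> T" "y \<in> T" for x y
  proof -
    obtain i j where "x \<in> F i" "y \<in> F j" using xy by (auto simp: T_def)
    then have "x \<in> F (max i j) \<and> y \<in> F (max i j)"
      using F_mono[of i "max i j"] F_mono[of j "max i j"] by auto
    then show ?thesis by blast
  qed
  have "infinite_perfect_tree T"
  proof (rule meet_closed_infinite_perfect_tree)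
    show "meet_closed T"
      unfolding meet_closed_def
    proof (intro ballI)
      fix x y assume "x \<in> T" "y \<in> T"
      then obtain m where m: "x \<in> F m" "y \<in> F m" using common by blast
      from bspec[OF bspec[OF P(2)[unfolded meet_closed_def] m(1)] m(2)]
      obtain w where "w \<in> F m" "prefix w x \<and> prefix w y \<and>
        (w = x \<or> w = y \<or> (\<exists>b. prefix (w @ [b]) x \<and> prefix (w @ [\<not> b]) y))" by (rule bexE)
      then show "\<exists>w\<in>T. prefix w x \<and> prefix w y \<and>
        (w = x \<or> w = y \<or> (\<exists>b. prefix (w @ [b]) x \<and> prefix (w @ [\<not> b]) y))"
        by (intro bexI[of _ w]) (auto simp: T_def)
    qed
    show "T \<noteq> {}" using Q(5)[of 0] by (auto simp: T_def)
    show "\<exists>y\<in>T. prefix (w @ [b]) y" if w: "w \<in> T" for w b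
    proof -
      obtain m where "w \<in> F m" using w by (auto simp: T_def)
      from Q(6)[OF this, of b] obtain y where "y \<in> F (Suc m)" "prefix (w @ [b]) y" by (rule bexE)
      then show ?thesis by (intro bexI[of _ y]) (auto simp: T_def)
    qed
  qed
  moreover have "c < k" using c(1) assms(3) by auto
  moreover have "\<forall>t\<in>T. C t = c" using P(3) by (auto simp: T_def)
  moreover have "\<not> computes_bounded_enumeration (D \<oplus>\<^sub>T (str_encode ` T)) S"
  proof
    assume "computes_bounded_enumeration (D \<oplus>\<^sub>T (str_encode ` T)) S"
    then obtain g l e where g: "enumeration l S g"
      and e: "\<And>n. eval (D \<oplus>\<^sub>T (str_encode ` T)) e n (fin_encode (g n))"
      unfolding computes_bounded_enumeration_def bounded_enumeration_def computable_in_def by blast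
    define m where "m = to_nat (e, l)"
    have "settled D S e l (F (Suc m)) (R (Suc m))" using Q(4)[of m] by (simp add: m_def req_def)
    then obtain n where n: "\<forall>g w. finite g \<longrightarrow> g \<subseteq> R (Suc m) \<longrightarrow> meet_closed (F (Suc m) \<union> g) \<longrightarrow>
      finite w \<longrightarrow> card w \<le> l \<longrightarrow> w \<inter> S \<inter> {s. length s = n} \<noteq> {} \<longrightarrow>
      \<not> eval (D \<oplus>\<^sub>T (str_encode ` (F (Suc m) \<union> g))) e n (fin_encode w)"
      unfolding settled_def by (rule exE)
    \<comment> \<open>A computation from \<open>T\<close> uses finitely many strings, so some
      \<open>F j'\<close> with \<open>j'\<close> at least \<open>Suc m\<close> yields the same
      output at \<open>n\<close>. As \<open>F j'\<close> extends \<open>F (Suc m)\<close> within the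
      settled region, this is impossible.\<close>
    from eval_use[OF e[of n]] obtain u where u: "\<And>B. \<forall>j<u. j \<in> B \<longleftrightarrow> j \<in> D \<oplus>\<^sub>T (str_encode ` T) \<Longrightarrow>
        eval B e n (fin_encode (g n))" by auto
    have "finite {x :: bool list. length x < u}"
      using finite_lists_length_le[of "UNIV :: bool set" u] by (rule finite_subset[rotated]) auto
    then have short: "finite (T \<inter> {x. length x < u})" by simp
    have "\<forall>x\<in>T \<inter> {x. length x < u}. \<exists>j. x \<in> F j" by (auto simp: T_def)
    then obtain i where i: "\<forall>x\<in>T \<inter> {x. length x < u}. x \<in> F (i x)" by metis
    define j where "j = Max (insert 0 (i ` (T \<inter> {x. length x < u})))"
    have j: "x \<in> F j" if "x \<in> T" "length x < u" for x
    proof -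
      have "i x \<le> j" unfolding j_def using short that by (intro Max_ge) auto
      then show ?thesis using F_mono i that by blast
    qed
    define j' where "j' = max j (Suc m)"
    have "eval (D \<oplus>\<^sub>T (str_encode ` F j')) e n (fin_encode (g n))"
    proof (intro u allI impI join_agree)
      show "u \<le> length x" if "x \<in> F j' - T" for x using that by (auto simp: T_def)
      show "u \<le> length x" if "x \<in> T - F j'" for x
      proof (rule ccontr)
        assume "\<not> u \<le> length x"
        then have "x \<in> F j" using that by (intro j) auto
        then show False using that F_mono[of j j'] by (auto simp: j'_def)
      qed
    qed
    moreover have "F j' = F (Suc m) \<union> (F j' - F (Suc m))" using F_mono[of "Suc m" j'] by (auto simp: j'_def)
    moreover have "F j' - F (Suc m) \<subseteq> R (Suc m)" using new[of "Suc m" j'] by (simp add: j'_def)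
    moreover have "finite (g n)" "card (g n) \<le> l" "g n \<inter> S \<inter> {s. length s = n} \<noteq> {}"
      using g by (simp_all add: enumeration_def)
    ultimately show False
      using n[THEN spec, THEN spec, of "F j' - F (Suc m)" "g n"] P(1,2)[of j'] by simp
  qed
  ultimately show ?thesis by (intro exI[of _ T] conjI exI[of _ c])
qed

end
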